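(* Let $\Sigma$ be an open simply connected Riemann surface with global conformal parameter $z$, and let $G:\Sigma\to\mathbb{H}^2\subset\mathbb{L}^3$ be a harmonic map admitting Weierstrass data $\{-Q,2\tau\}$. Assume the set of singular points of $G$ has empty interior, let $z_0\in\Sigma$ be a regular point of $G$ and $\vartheta_0\in\mathbb{C}$. Then there exists a conformal immersion $\psi=(N,h):\Sigma\to\mathbb{H}^2\times\mathbb{R}\subset\mathbb{L}^4$ with regular vertical projection and constant mean curvature $1/2$ with respect to its canonical orientation, unique up to vertical translations, such that: (i) $G$ is the hyperbolic Gauss map of $\psi$; (ii) $\tau=\lambda u^2/2$, where $\langle d\psi,d\psi\rangle=\lambda|dz|^2$ and $u$ is the angle function of $\psi$; (iii) $dh(z_0)=\vartheta_0\,dz+\overline{\vartheta_0}\,d\bar z$. Moreover, $h$ is the (unique up to additive constants) solution of $$h_{zz}=(\log\tau)_z\,h_z+Q\sqrt{\frac{\tau+2|h_z|^2}{\tau}},\qquad h_{z\bar z}=\frac12\sqrt{\tau(\tau+2|h_z|^2)},\qquad h_z(z_0)=\vartheta_0,$$ and $$\psi=\left(\frac{4\,\mathrm{Re}\big(G_z(2\overline{Q}h_z+\tau h_{\bar z})\big)}{\tau^2-4|Q|^2}+G\sqrt{\frac{\tau+2|h_z|^2}{\tau}},\ h\right)$$ at every regular point of $G$.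
   Context: $\mathbb{L}^4$ is $\mathbb{R}^4$ with metric $\langle,\rangle=-dx_0^2+dx_1^2+dx_2^2+dx_3^2$, $\mathbb{L}^3$ the first three coordinates, $\mathbb{H}^2=\{x\in\mathbb{L}^3:\langle x,x\rangle=-1,x_0>0\}$, $\mathbb{H}^2\times\mathbb{R}\subset\mathbb{L}^4$; vertical translations are $(x,t)\mapsto(x,t+c)$. For a conformal immersion $\psi=(N,h)$ with metric $\lambda|dz|^2$: $\eta=(\hat N,u)$ is its unit normal tangent to $\mathbb{H}^2\times\mathbb{R}$ and $u$ the angle function; regular vertical projection means $u\ne0$ everywhere, canonical orientation means $u>0$; the hyperbolic Gauss map $G$ is defined by $(G,1)=(\eta+N)/u$. For a harmonic map $G$ into $\mathbb{H}^2$, with $Q_0=\langle G_z,G_z\rangle$ and $\mu=2\langle G_z,G_{\bar z}\rangle$, Weierstrass data is a pair $\{Q_0,\tau_0\}$, $\tau_0>0$ smooth, with $\mu=\tau_0/4+4|Q_0|^2/\tau_0$; here $Q_0=-Q$, $\tau_0=2\tau$. A regular point of $G$ is one where $dG$ has rank 2. *)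

theory Defs
  imports "HOL-Analysis.Analysis"
begin

type_synonym L3 = "real \<times> real \<times> real"
type_synonym L4 = "L3 \<times> real"

fun lor3 :: "L3 \<Rightarrow> L3 \<Rightarrow> real" where
  "lor3 (a0, a1, a2) (b0, b1, b2) = - a0 * b0 + a1 * b1 + a2 * b2"

fun lor4 :: "L4 \<Rightarrow> L4 \<Rightarrow> real" where
  "lor4 (a, s) (b, t) = lor3 a b + s * t"

definition H2 :: "L3 set" where
  "H2 = {x. lor3 x x = -1 \<and> fst x > 0}"

definition pdx :: "(complex \<Rightarrow> 'a::real_normed_vector) \<Rightarrow> complex \<Rightarrow> 'a" where
  "pdx f p = vector_derivative (\<lambda>t::real. f (p + of_real t)) (at 0)"

definition pdy :: "(complex \<Rightarrow> 'a::real_normed_vector) \<Rightarrow> complex \<Rightarrow> 'a" where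
  "pdy f p = vector_derivative (\<lambda>t::real. f (p + \<i> * of_real t)) (at 0)"

primrec iter_pd :: "bool list \<Rightarrow> (complex \<Rightarrow> 'a::real_normed_vector) \<Rightarrow> complex \<Rightarrow> 'a" where
  "iter_pd [] f = f"
| "iter_pd (d # ds) f = (if d then pdx (iter_pd ds f) else pdy (iter_pd ds f))"

definition smooth_on :: "complex set \<Rightarrow> (complex \<Rightarrow> 'a::real_normed_vector) \<Rightarrow> bool" where
  "smooth_on S f \<longleftrightarrow> (\<forall>ds. iter_pd ds f differentiable_on S)"

definition wz :: "(complex \<Rightarrow> complex) \<Rightarrow> complex \<Rightarrow> complex" where
  "wz f p = (pdx f p - \<i> * pdy f p) / 2"

definition wzb :: "(complex \<Rightarrow> complex) \<Rightarrow> complex \<Rightarrow> complex" where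
  "wzb f p = (pdx f p + \<i> * pdy f p) / 2"

text \<open>The complex bilinear extension: <G_z,G_z> and <G_z,G_zbar>, written out in terms of G_x, G_y.\<close>
definition GzGz :: "(complex \<Rightarrow> L3) \<Rightarrow> complex \<Rightarrow> complex" where
  "GzGz G p = Complex ((lor3 (pdx G p) (pdx G p) - lor3 (pdy G p) (pdy G p)) / 4)
                      (- lor3 (pdx G p) (pdy G p) / 2)"

definition GzGzb :: "(complex \<Rightarrow> L3) \<Rightarrow> complex \<Rightarrow> real" where
  "GzGzb G p = (lor3 (pdx G p) (pdx G p) + lor3 (pdy G p) (pdy G p)) / 4"

text \<open>Harmonic map into H^2: G_xx + G_yy = <grad G, grad G> G (tension field vanishes).\<close>
definition harmonic_H2 :: "complex set \<Rightarrow> (complex \<Rightarrow> L3) \<Rightarrow> bool" where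
  "harmonic_H2 S G \<longleftrightarrow> smooth_on S G \<and> (\<forall>p\<in>S. G p \<in> H2) \<and>
     (\<forall>p\<in>S. pdx (pdx G) p + pdy (pdy G) p
              = (lor3 (pdx G p) (pdx G p) + lor3 (pdy G p) (pdy G p)) *\<^sub>R G p)"

definition weierstrass_data ::
  "complex set \<Rightarrow> (complex \<Rightarrow> L3) \<Rightarrow> (complex \<Rightarrow> complex) \<Rightarrow> (complex \<Rightarrow> real) \<Rightarrow> bool" where
  "weierstrass_data S G Q0 tau0 \<longleftrightarrow> smooth_on S tau0 \<and> (\<forall>p\<in>S. tau0 p > 0) \<and>
     (\<forall>p\<in>S. Q0 p = GzGz G p \<and> 2 * GzGzb G p = tau0 p / 4 + 4 * (cmod (Q0 p))\<^sup>2 / tau0 p)"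

definition regular_pt :: "(complex \<Rightarrow> L3) \<Rightarrow> complex \<Rightarrow> bool" where
  "regular_pt G p \<longleftrightarrow> (\<forall>a b::real. a *\<^sub>R pdx G p + b *\<^sub>R pdy G p = 0 \<longrightarrow> a = 0 \<and> b = 0)"

definition lam :: "(complex \<Rightarrow> L4) \<Rightarrow> complex \<Rightarrow> real" where
  "lam psi p = lor4 (pdx psi p) (pdx psi p)"

definition conformal_immersion :: "complex set \<Rightarrow> (complex \<Rightarrow> L4) \<Rightarrow> bool" where
  "conformal_immersion S psi \<longleftrightarrow> smooth_on S psi \<and> (\<forall>p\<in>S. fst (psi p) \<in> H2) \<and>
     (\<forall>p\<in>S. lam psi p > 0 \<and> lor4 (pdy psi p) (pdy psi p) = lam psi p \<and>
             lor4 (pdx psi p) (pdy psi p) = 0)"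

definition unit_normal :: "(complex \<Rightarrow> L4) \<Rightarrow> complex \<Rightarrow> L4 \<Rightarrow> bool" where
  "unit_normal psi p eta \<longleftrightarrow> lor4 eta eta = 1 \<and> lor4 eta (pdx psi p) = 0 \<and>
     lor4 eta (pdy psi p) = 0 \<and> lor3 (fst eta) (fst (psi p)) = 0"

definition regular_vertical_projection :: "complex set \<Rightarrow> (complex \<Rightarrow> L4) \<Rightarrow> bool" where
  "regular_vertical_projection S psi \<longleftrightarrow>
     (\<forall>p\<in>S. \<forall>eta. unit_normal psi p eta \<longrightarrow> snd eta \<noteq> 0)"

definition canon_normal :: "(complex \<Rightarrow> L4) \<Rightarrow> complex \<Rightarrow> L4" where
  "canon_normal psi p = (THE eta. unit_normal psi p eta \<and> snd eta > 0)"

definition angle_fun :: "(complex \<Rightarrow> L4) \<Rightarrow> complex \<Rightarrow> real" where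
  "angle_fun psi p = snd (canon_normal psi p)"

text \<open>Mean curvature w.r.t. the unit normal eta: psi_{z zbar} = (lambda H / 2) eta + (normal to H^2 x R),
  i.e. H = <psi_xx + psi_yy, eta> / (2 lambda).\<close>
definition mean_curv :: "(complex \<Rightarrow> L4) \<Rightarrow> (complex \<Rightarrow> L4) \<Rightarrow> complex \<Rightarrow> real" where
  "mean_curv psi eta p = lor4 (pdx (pdx psi) p + pdy (pdy psi) p) (eta p) / (2 * lam psi p)"

definition hyp_gauss_map :: "complex set \<Rightarrow> (complex \<Rightarrow> L4) \<Rightarrow> (complex \<Rightarrow> L3) \<Rightarrow> bool" where
  "hyp_gauss_map S psi G \<longleftrightarrow> (\<forall>p\<in>S. (G p, 1) =
       (1 / angle_fun psi p) *\<^sub>R (canon_normal psi p + (fst (psi p), 0)))"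

definition required_props ::
  "complex set \<Rightarrow> (complex \<Rightarrow> L3) \<Rightarrow> (complex \<Rightarrow> real) \<Rightarrow> complex \<Rightarrow> complex \<Rightarrow> (complex \<Rightarrow> L4) \<Rightarrow> bool" where
  "required_props S G tau z0 th0 psi \<longleftrightarrow>
     conformal_immersion S psi \<and> regular_vertical_projection S psi \<and>
     (\<forall>p\<in>S. mean_curv psi (canon_normal psi) p = 1/2) \<and>
     hyp_gauss_map S psi G \<and>
     (\<forall>p\<in>S. tau p = lam psi p * (angle_fun psi p)\<^sup>2 / 2) \<and>
     wz (\<lambda>q. complex_of_real (snd (psi q))) z0 = th0"

definition h_pde :: "complex set \<Rightarrow> (complex \<Rightarrow> complex) \<Rightarrow> (complex \<Rightarrow> real) \<Rightarrow> (complex \<Rightarrow> real) \<Rightarrow> bool" where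
  "h_pde S Q tau h \<longleftrightarrow> (let hc = (\<lambda>q. complex_of_real (h q)) in
     (\<forall>p\<in>S.
       wz (wz hc) p = wz (\<lambda>q. complex_of_real (ln (tau q))) p * wz hc p
          + Q p * complex_of_real (sqrt ((tau p + 2 * (cmod (wz hc p))\<^sup>2) / tau p)) \<and>
       wzb (wz hc) p = complex_of_real (sqrt (tau p * (tau p + 2 * (cmod (wz hc p))\<^sup>2)) / 2)))"

text \<open>Re(G_z w) for a complex number w, where G_z = (G_x - i G_y)/2.\<close>
definition re_Gz_mul :: "(complex \<Rightarrow> L3) \<Rightarrow> complex \<Rightarrow> complex \<Rightarrow> L3" where
  "re_Gz_mul G p w = (Re w / 2) *\<^sub>R pdx G p + (Im w / 2) *\<^sub>R pdy G p"

definition N_formula ::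
  "(complex \<Rightarrow> L3) \<Rightarrow> (complex \<Rightarrow> complex) \<Rightarrow> (complex \<Rightarrow> real) \<Rightarrow> (complex \<Rightarrow> real) \<Rightarrow> complex \<Rightarrow> L3" where
  "N_formula G Q tau h p = (let hc = (\<lambda>q. complex_of_real (h q)) in
     (4 / ((tau p)\<^sup>2 - 4 * (cmod (Q p))\<^sup>2)) *\<^sub>R
        re_Gz_mul G p (2 * cnj (Q p) * wz hc p + complex_of_real (tau p) * wzb hc p)
     + sqrt ((tau p + 2 * (cmod (wz hc p))\<^sup>2) / tau p) *\<^sub>R G p)"

end

theory Submission
  imports Defs "HOL-Complex_Analysis.Complex_Analysis"
begin

text \<open>Write \<open>Q = q1 + \<i> q2\<close>. On the plane orthogonal to \<open>G\<close> the Lorentz cross product with \<open>G\<close> is a complex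
  structure, and \<open>F = f1 - \<i> f2 = G\<^sub>z - \<i> \<sigma> G \<times> G\<^sub>z\<close> with \<open>\<sigma> = \<plusminus>1\<close> is isotropic. The two norms
  \<open>m\<^sub>\<sigma> = \<langle>F, F-bar\<rangle>\<close> satisfy \<open>(m\<^sub>+ - \<tau>) (m\<^sub>- - \<tau>) = 0\<close>. Both \<open>ln m\<^sub>\<sigma>\<close> (where \<open>m\<^sub>\<sigma> > 0\<close>) and \<open>ln \<tau>\<close> solve
  \<open>\<Delta> ln m = m - 4 |Q|\<^sup>2 / m\<close>, so unique continuation forces \<open>m\<^sub>\<sigma> = \<tau>\<close> on all of \<open>S\<close> for one \<open>\<sigma>\<close>; hence the frame
  \<open>F\<close> does not degenerate at the singular points of \<open>G\<close>.

  The nonlinear equations for \<open>h\<close> become linear in \<open>(h\<^sub>x, h\<^sub>y, B)\<close> with \<open>B = sqrt ((\<tau> + 2 |h\<^sub>z|\<^sup>2) / \<tau>)\<close>. This linear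
  system is flat and preserves \<open>B\<^sup>2 - 2 |h\<^sub>z|\<^sup>2 / \<tau>\<close>, so it is solvable on simply connected domains, uniquely for given
  initial data. The surface is \<open>N = B G + (h\<^sub>x f1 + h\<^sub>y f2) / \<tau>\<close>, with \<open>N\<^sub>x = h\<^sub>x G + 2 B f1\<close>,
  \<open>N\<^sub>y = h\<^sub>y G + 2 B f2\<close> and unit normal \<open>(G / B - N, 1 / B)\<close>. Conversely, for any surface as required, the tangential
  parts of \<open>N\<^sub>x\<close> and \<open>N\<^sub>y\<close> satisfy the same linear equations with respect to \<open>G\<^sub>x\<close> and \<open>G\<^sub>y\<close> as the frame; these equations
  determine the frame at regular points and, by density, everywhere.\<close>

section \<open>Calculus of partial derivatives\<close>

text \<open>The sign sigma cannot be read off pointwise. The two norms differ by twice a signed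
  Jacobian of \<open>G\<close>, so they coincide exactly at the singular points of \<open>G\<close>;
  a priori \<open>tau\<close> might follow one norm on one side of a singular curve and the other
  norm on the other side, and smoothness of \<open>tau\<close> alone would still permit a switch
  where the norms agree to infinite order. What excludes it is that \<open>ln tau\<close> itself
  solves the elliptic equation, which is clear at first only on open sets where \<open>tau\<close>
  equals one norm and then extends by density. Unique continuation comes from a frequency function
  for a first-order system of Cauchy-Riemann type.

  The linear form of the height equations serves global existence: solutions of a nonlinear
  compatible system might blow up away from \<open>z0\<close>, whereas a linear equation is solvable
  along every ray of a disc or plane, onto which \<open>S\<close> is mapped biholomorphically.
  Flatness consists of the Gauss and Codazzi equations of a spacelike surface in L^3 with Gauss map
  \<open>G\<close>: the equation for \<open>ln m\<close> and the holomorphy of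
  \<open>Q\<close>.\<close>

lemma pd_of_has_derivative:
  assumes "(f has_derivative D) (at p)"
  shows "pdx f p = D 1" "pdy f p = D \<i>"
proof -
  have 1: "((\<lambda>t. f (p + of_real t * w)) has_derivative (\<lambda>t. D (of_real t * w))) (at 0)" for w
  proof -
    have "((\<lambda>t. p + complex_of_real t * w) has_derivative (\<lambda>t. of_real t * w)) (at 0)"
      by (auto intro!: derivative_eq_intros)
    moreover have "(f has_derivative D) (at (p + of_real 0 * w))" using assms by simp
    ultimately show ?thesis
      using diff_chain_at[of "\<lambda>t. p + complex_of_real t * w" "\<lambda>t. of_real t * w" 0 f D]
      by (simp add: o_def)
  qed
  have 2: "((\<lambda>t. f (p + of_real t * w)) has_vector_derivative D w) (at 0)" for w
  proof -
    have "D (complex_of_real t * w) = t *\<^sub>R D w" for t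
      using linear_scale[OF has_derivative_linear[OF assms], of t w] by (simp add: scaleR_conv_of_real)
    then show ?thesis using 1[of w] by (simp add: has_vector_derivative_def)
  qed
  show "pdx f p = D 1" using vector_derivative_at[OF 2[of 1]] by (simp add: pdx_def)
  show "pdy f p = D \<i>" using vector_derivative_at[OF 2[of \<i>]] by (simp add: pdy_def mult.commute)
qed

lemma has_derivative_pd:
  assumes "f differentiable at p"
  shows "(f has_derivative (\<lambda>v. Re v *\<^sub>R pdx f p + Im v *\<^sub>R pdy f p)) (at p)"
proof -
  obtain D where D: "(f has_derivative D) (at p)" using assms by (auto simp: differentiable_def)
  have "D v = Re v *\<^sub>R D 1 + Im v *\<^sub>R D \<i>" for v
  proof -
    have "v = Re v *\<^sub>R 1 + Im v *\<^sub>R \<i>" by (simp add: complex_eq_iff)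
    then show ?thesis
      using has_derivative_linear[OF D] by (metis linear_add linear_scale)
  qed
  then have "D = (\<lambda>v. Re v *\<^sub>R D 1 + Im v *\<^sub>R D \<i>)" by blast
  then show ?thesis using D pd_of_has_derivative[OF D] by simp
qed

lemma has_derivative_cong_open:
  assumes "open S" "p \<in> S" "\<And>q. q \<in> S \<Longrightarrow> f q = g q"
  shows "(f has_derivative D) (at p) \<longleftrightarrow> (g has_derivative D) (at p)"
  using assms has_derivative_transform_within_open by metis

lemma pd_cong:
  assumes "open S" "p \<in> S" "\<And>q. q \<in> S \<Longrightarrow> f q = g q"
  shows "pdx f p = pdx g p" "pdy f p = pdy g p"
proof -
  have "eventually (\<lambda>t::real. f (p + of_real t * w) = g (p + of_real t * w)) (nhds 0)" for w
  proof -
    have "isCont (\<lambda>t::real. p + of_real t * w) 0" by (intro continuous_intros)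
    then have "((\<lambda>t::real. p + of_real t * w) \<longlongrightarrow> p) (nhds 0)"
      by (simp add: isCont_def tendsto_nhds_iff)
    then have "eventually (\<lambda>t::real. p + of_real t * w \<in> S) (nhds 0)"
      using assms(1,2) topological_tendstoD by blast
    then show ?thesis by eventually_elim (use assms(3) in auto)
  qed
  then have "vector_derivative (\<lambda>t::real. f (p + of_real t * w)) (at 0) =
      vector_derivative (\<lambda>t::real. g (p + of_real t * w)) (at 0)" for w
    by (intro vector_derivative_cong_eq) (auto simp: eventually_nhds_conv_at)
  from this[of 1] this[of \<i>] show "pdx f p = pdx g p" "pdy f p = pdy g p"
    by (simp_all add: pdx_def pdy_def mult.commute)
qed

section \<open>Sum, product and chain rules for partial derivatives\<close>

lemma pd_const: "pdx (\<lambda>_. c) p = 0" "pdy (\<lambda>_. c) p = 0"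
  using pd_of_has_derivative[OF has_derivative_const, of c p] by auto

lemma pd_add:
  assumes "f differentiable at p" "g differentiable at p"
  shows "pdx (\<lambda>q. f q + g q) p = pdx f p + pdx g p" "pdy (\<lambda>q. f q + g q) p = pdy f p + pdy g p"
  using pd_of_has_derivative[OF has_derivative_add[OF has_derivative_pd has_derivative_pd], OF assms] by auto

lemma pd_diff:
  assumes "f differentiable at p" "g differentiable at p"
  shows "pdx (\<lambda>q. f q - g q) p = pdx f p - pdx g p" "pdy (\<lambda>q. f q - g q) p = pdy f p - pdy g p"
  using pd_of_has_derivative[OF has_derivative_diff[OF has_derivative_pd has_derivative_pd], OF assms] by auto

lemma pd_bilinear:
  assumes "bounded_bilinear pr" "f differentiable at p" "g differentiable at p"
  shows "pdx (\<lambda>q. pr (f q) (g q)) p = pr (pdx f p) (g p) + pr (f p) (pdx g p)"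
    "pdy (\<lambda>q. pr (f q) (g q)) p = pr (pdy f p) (g p) + pr (f p) (pdy g p)"
  using pd_of_has_derivative[OF bounded_bilinear.FDERIV[OF assms(1) has_derivative_pd has_derivative_pd], OF assms(2,3)]
  by (auto simp: add.commute)

lemma pd_linear:
  assumes "bounded_linear L" "f differentiable at p"
  shows "pdx (\<lambda>q. L (f q)) p = L (pdx f p)" "pdy (\<lambda>q. L (f q)) p = L (pdy f p)"
  using pd_of_has_derivative[OF bounded_linear.has_derivative[OF assms(1) has_derivative_pd], OF assms(2)] by auto

lemma pd_Pair:
  assumes "f differentiable at p" "g differentiable at p"
  shows "pdx (\<lambda>q. (f q, g q)) p = (pdx f p, pdx g p)" "pdy (\<lambda>q. (f q, g q)) p = (pdy f p, pdy g p)"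
  using pd_of_has_derivative[OF has_derivative_Pair[OF has_derivative_pd has_derivative_pd], OF assms] by auto

lemma pd_real_comp:
  fixes f :: "complex \<Rightarrow> real"
  assumes "(\<phi> has_real_derivative d) (at (f p))" "f differentiable at p"
  shows "pdx (\<lambda>q. \<phi> (f q)) p = d * pdx f p" "pdy (\<lambda>q. \<phi> (f q)) p = d * pdy f p"
    "(\<lambda>q. \<phi> (f q)) differentiable at p"
proof -
  have "((\<lambda>q. \<phi> (f q)) has_derivative (\<lambda>v. d * (Re v *\<^sub>R pdx f p + Im v *\<^sub>R pdy f p))) (at p)"
    using has_derivative_compose[OF has_derivative_pd[OF assms(2)], of \<phi> "(*) d"] assms(1)
    by (simp add: has_field_derivative_def)
  from pd_of_has_derivative[OF this] this
  show "pdx (\<lambda>q. \<phi> (f q)) p = d * pdx f p" "pdy (\<lambda>q. \<phi> (f q)) p = d * pdy f p"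
    "(\<lambda>q. \<phi> (f q)) differentiable at p" by (auto simp: differentiable_def)
qed

text \<open>\<open>iter_pd\<close> adds derivatives on the outside, while inductions with the
  product and chain rules have to remove the innermost derivative first. \<open>Cn_on n\<close> has
  the latter form for words of length at most n.\<close>

primrec Cn_on :: "nat \<Rightarrow> complex set \<Rightarrow> (complex \<Rightarrow> 'a::real_normed_vector) \<Rightarrow> bool" where
  "Cn_on 0 S f \<longleftrightarrow> f differentiable_on S"
| "Cn_on (Suc n) S f \<longleftrightarrow> f differentiable_on S \<and> Cn_on n S (pdx f) \<and> Cn_on n S (pdy f)"

lemma iter_pd_append: "iter_pd (ds @ [d]) f = iter_pd ds (if d then pdx f else pdy f)"
  by (induction ds) auto

lemma Cn_on_iff: "Cn_on n S f \<longleftrightarrow> (\<forall>ds. length ds \<le> n \<longrightarrow> iter_pd ds f differentiable_on S)"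
proof (induction n arbitrary: f)
  case (Suc n)
  \<comment> \<open>A nonempty word is split at its last letter, which is the derivative applied
    first.\<close>
  have 1: "(\<forall>ds. length ds \<le> Suc n \<longrightarrow> P ds) \<longleftrightarrow>
    P [] \<and> (\<forall>ds. length ds \<le> n \<longrightarrow> P (ds @ [True])) \<and> (\<forall>ds. length ds \<le> n \<longrightarrow> P (ds @ [False]))"
    (is "?l \<longleftrightarrow> ?r") for P :: "bool list \<Rightarrow> bool"
  proof
    assume ?r
    then have "P ds" if "length ds \<le> Suc n" for ds
      using that by (cases ds rule: rev_cases; cases "last ds") auto
    then show ?l by blast
  qed auto
  show ?case unfolding 1 Cn_on.simps Suc.IH by (simp add: iter_pd_append)
qed auto

lemma smooth_on_iff_Cn: "smooth_on S f \<longleftrightarrow> (\<forall>n. Cn_on n S f)"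
  unfolding smooth_on_def Cn_on_iff by blast

lemma Cn_on_imp_differentiable: "Cn_on n S f \<Longrightarrow> f differentiable_on S"
  by (cases n) auto

lemma Cn_on_Suc_imp: "Cn_on (Suc n) S f \<Longrightarrow> Cn_on n S f"
  unfolding Cn_on_iff by auto

lemma smooth_on_pd: "smooth_on S f \<Longrightarrow> smooth_on S (pdx f)" "smooth_on S f \<Longrightarrow> smooth_on S (pdy f)"
proof -
  have "Cn_on (Suc n) S f \<Longrightarrow> Cn_on n S (pdx f) \<and> Cn_on n S (pdy f)" for n by simp
  then show "smooth_on S f \<Longrightarrow> smooth_on S (pdx f)" "smooth_on S f \<Longrightarrow> smooth_on S (pdy f)"
    unfolding smooth_on_iff_Cn by blast+
qed

lemma differentiable_on_cong_open:
  assumes "open S" "\<And>q. q \<in> S \<Longrightarrow> f q = g q" "f differentiable_on S"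
  shows "g differentiable_on S"
proof -
  have "g differentiable at p" if "p \<in> S" for p
    using assms that has_derivative_cong_open[OF assms(1) that, of f g]
    unfolding differentiable_on_eq_differentiable_at[OF assms(1)] differentiable_def by blast
  then show ?thesis using assms(1) by (simp add: differentiable_on_eq_differentiable_at)
qed

lemma Cn_on_cong:
  assumes "open S" "\<And>q. q \<in> S \<Longrightarrow> f q = g q" "Cn_on n S f"
  shows "Cn_on n S g"
  using assms(2,3)
proof (induction n arbitrary: f g)
  case 0 then show ?case using differentiable_on_cong_open[OF assms(1)] by auto
next
  case (Suc n)
  have "Cn_on n S (pdx g)" "Cn_on n S (pdy g)"
    using Suc.IH[of "pdx f" "pdx g"] Suc.IH[of "pdy f" "pdy g"] Suc.prems pd_cong[OF assms(1), of _ f g] by auto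
  then show ?case using differentiable_on_cong_open[OF assms(1) Suc.prems(1)] Suc.prems(2) by auto
qed

lemma smooth_on_cong:
  assumes "open S" "\<And>q. q \<in> S \<Longrightarrow> f q = g q" "smooth_on S f"
  shows "smooth_on S g"
  using assms Cn_on_cong unfolding smooth_on_iff_Cn by blast

lemma Cn_on_at: "open S \<Longrightarrow> Cn_on n S f \<Longrightarrow> p \<in> S \<Longrightarrow> f differentiable at p"
  using Cn_on_imp_differentiable differentiable_on_eq_differentiable_at by blast

lemma smooth_on_at: "smooth_on S f \<Longrightarrow> open S \<Longrightarrow> p \<in> S \<Longrightarrow> f differentiable at p"
  unfolding smooth_on_iff_Cn using Cn_on_at by blast

lemma smooth_on_continuous_on: "smooth_on S f \<Longrightarrow> continuous_on S f"
  unfolding smooth_on_iff_Cn using Cn_on_imp_differentiable differentiable_imp_continuous_on by blast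

lemma Cn_on_const: "Cn_on n S (\<lambda>_. c)"
proof (induction n arbitrary: c)
  case (Suc n)
  have "pdx (\<lambda>_. c) = (\<lambda>_. 0)" "pdy (\<lambda>_. c) = (\<lambda>_. 0)" by (auto simp: pd_const)
  then show ?case using Suc.IH by auto
qed auto

lemma Cn_on_add:
  assumes "open S" "Cn_on n S f" "Cn_on n S g"
  shows "Cn_on n S (\<lambda>q. f q + g q)"
  using assms(2,3)
proof (induction n arbitrary: f g)
  case (Suc n)
  have d: "f differentiable at q" "g differentiable at q" if "q \<in> S" for q
    using Suc.prems Cn_on_at[OF assms(1)] that by blast+
  have "Cn_on n S (pdx (\<lambda>q. f q + g q))"
    by (rule Cn_on_cong[OF assms(1) _ Suc.IH[of "pdx f" "pdx g"]]) (use Suc.prems in \<open>simp_all add: pd_add d\<close>)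
  moreover have "Cn_on n S (pdy (\<lambda>q. f q + g q))"
    by (rule Cn_on_cong[OF assms(1) _ Suc.IH[of "pdy f" "pdy g"]]) (use Suc.prems in \<open>simp_all add: pd_add d\<close>)
  ultimately show ?case using Suc.prems by (auto intro: differentiable_on_add)
qed (auto intro: differentiable_on_add)

text \<open>Stated for an arbitrary bounded bilinear product, so that multiplication, scaling,
  \<open>lor3\<close>, \<open>lcross\<close> and the application of bounded linear maps share one
  product rule.\<close>

lemma Cn_on_bilinear:
  assumes "open S" "bounded_bilinear pr" "Cn_on n S f" "Cn_on n S g"
  shows "Cn_on n S (\<lambda>q. pr (f q) (g q))"
proof -
  have diff: "(\<lambda>q. pr (f q) (g q)) differentiable_on S" if "f differentiable_on S" "g differentiable_on S" for f g
    using that bounded_bilinear.FDERIV[OF assms(2)] unfolding differentiable_on_def differentiable_def by blast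
  show ?thesis using assms(3,4)
proof (induction n arbitrary: f g)
  case 0
  then show ?case using diff by auto
next
  case (Suc n)
  note l = Cn_on_Suc_imp[OF Suc.prems(1)] Cn_on_Suc_imp[OF Suc.prems(2)]
  have d: "f differentiable at q" "g differentiable at q" if "q \<in> S" for q
    using Suc.prems Cn_on_at[OF assms(1)] that by blast+
  have "Cn_on n S (pdx (\<lambda>q. pr (f q) (g q)))"
    by (rule Cn_on_cong[OF assms(1) _ Cn_on_add[OF assms(1) Suc.IH[of "pdx f" g] Suc.IH[of f "pdx g"]]])
      (use Suc.prems l in \<open>simp_all add: pd_bilinear[OF assms(2)] d\<close>)
  moreover have "Cn_on n S (pdy (\<lambda>q. pr (f q) (g q)))"
    by (rule Cn_on_cong[OF assms(1) _ Cn_on_add[OF assms(1) Suc.IH[of "pdy f" g] Suc.IH[of f "pdy g"]]])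
      (use Suc.prems l in \<open>simp_all add: pd_bilinear[OF assms(2)] d\<close>)
  moreover have "(\<lambda>q. pr (f q) (g q)) differentiable_on S"
    using Suc.prems diff by auto
  ultimately show ?case by simp
qed
qed

lemma Cn_on_linear:
  assumes "open S" "bounded_linear L" "Cn_on n S f"
  shows "Cn_on n S (\<lambda>q. L (f q))"
proof -
  have diff: "(\<lambda>q. L (f q)) differentiable_on S" if "f differentiable_on S" for f
    using that bounded_linear.has_derivative[OF assms(2)] unfolding differentiable_on_def differentiable_def by blast
  show ?thesis using assms(3)
proof (induction n arbitrary: f)
  case 0
  then show ?case using diff by auto
next
  case (Suc n)
  have d: "f differentiable at q" if "q \<in> S" for q
    using Suc.prems Cn_on_at[OF assms(1)] that by blast
  have "Cn_on n S (pdx (\<lambda>q. L (f q)))"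
    by (rule Cn_on_cong[OF assms(1) _ Suc.IH[of "pdx f"]]) (use Suc.prems in \<open>simp_all add: pd_linear[OF assms(2)] d\<close>)
  moreover have "Cn_on n S (pdy (\<lambda>q. L (f q)))"
    by (rule Cn_on_cong[OF assms(1) _ Suc.IH[of "pdy f"]]) (use Suc.prems in \<open>simp_all add: pd_linear[OF assms(2)] d\<close>)
  ultimately show ?case using Suc.prems diff by auto
qed
qed

lemma smooth_on_const: "smooth_on S (\<lambda>_. c)"
  and smooth_on_add: "open S \<Longrightarrow> smooth_on S f \<Longrightarrow> smooth_on S g \<Longrightarrow> smooth_on S (\<lambda>q. f q + g q)"
  and smooth_on_bilinear: "open S \<Longrightarrow> bounded_bilinear pr \<Longrightarrow> smooth_on S f' \<Longrightarrow> smooth_on S g' \<Longrightarrow>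
        smooth_on S (\<lambda>q. pr (f' q) (g' q))"
  and smooth_on_linear: "open S \<Longrightarrow> bounded_linear L \<Longrightarrow> smooth_on S f' \<Longrightarrow> smooth_on S (\<lambda>q. L (f' q))"
  by (simp_all add: smooth_on_iff_Cn Cn_on_const Cn_on_add Cn_on_bilinear Cn_on_linear)

lemma smooth_on_diff:
  assumes "open S" "smooth_on S f" "smooth_on S g" shows "smooth_on S (\<lambda>q. f q - g q)"
  using smooth_on_add[OF assms(1,2) smooth_on_linear[OF assms(1) bounded_linear_minus[OF bounded_linear_ident] assms(3)]] by simp

lemma smooth_on_Pair:
  assumes "open S" "smooth_on S f" "smooth_on S g" shows "smooth_on S (\<lambda>q. (f q, g q))"
  using smooth_on_add[OF assms(1)
      smooth_on_linear[OF assms(1) bounded_linear_Pair[OF bounded_linear_ident bounded_linear_zero] assms(2)]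
      smooth_on_linear[OF assms(1) bounded_linear_Pair[OF bounded_linear_zero bounded_linear_ident] assms(3)]] by simp

text \<open>Bootstrapping: the partial derivatives of 1/f are -(1/f)^2 times those of f, so order n
  for 1/f yields order n + 1.\<close>

lemma smooth_on_inverse:
  fixes f :: "complex \<Rightarrow> real"
  assumes "open S" "smooth_on S f" "\<And>q. q \<in> S \<Longrightarrow> f q \<noteq> 0"
  shows "smooth_on S (\<lambda>q. inverse (f q))"
proof -
  have dq: "f differentiable at q" if "q \<in> S" for q using smooth_on_at assms that by blast
  have der: "(inverse has_real_derivative - (inverse (f q) * inverse (f q))) (at (f q))" if "q \<in> S" for q
    using assms(3)[OF that] by (auto intro!: derivative_eq_intros simp: power2_eq_square)
  have diff: "(\<lambda>q. inverse (f q)) differentiable_on S"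
    using pd_real_comp(3)[OF der dq] assms(1) differentiable_on_eq_differentiable_at by blast
  have "Cn_on n S (\<lambda>q. inverse (f q))" for n
  proof (induction n)
    case (Suc n)
    have mm: "Cn_on n S (\<lambda>q. - (inverse (f q) * inverse (f q)))"
      using Cn_on_linear[OF assms(1) bounded_linear_minus[OF bounded_linear_ident]
        Cn_on_bilinear[OF assms(1) bounded_bilinear_mult Suc Suc]] by simp
    have s: "Cn_on n S (pdx f)" "Cn_on n S (pdy f)"
      using smooth_on_pd[OF assms(2)] by (auto simp: smooth_on_iff_Cn)
    have "Cn_on n S (pdx (\<lambda>q. inverse (f q)))"
      by (rule Cn_on_cong[OF assms(1) _ Cn_on_bilinear[OF assms(1) bounded_bilinear_mult mm s(1)]])
        (use pd_real_comp[OF der dq] in auto)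
    moreover have "Cn_on n S (pdy (\<lambda>q. inverse (f q)))"
      by (rule Cn_on_cong[OF assms(1) _ Cn_on_bilinear[OF assms(1) bounded_bilinear_mult mm s(2)]])
        (use pd_real_comp[OF der dq] in auto)
    ultimately show ?case using diff by simp
  qed (simp add: diff)
  then show ?thesis by (simp add: smooth_on_iff_Cn)
qed

lemma smooth_on_if_pd:
  assumes "f differentiable_on S" "smooth_on S (pdx f)" "smooth_on S (pdy f)"
  shows "smooth_on S f"
  unfolding smooth_on_iff_Cn
proof
  fix n show "Cn_on n S f" using assms by (cases n) (auto simp: smooth_on_iff_Cn)
qed

lemma pd_ln:
  fixes f :: "complex \<Rightarrow> real"
  assumes "f differentiable at p" "f p > 0"
  shows "pdx (\<lambda>q. ln (f q)) p = pdx f p / f p" "pdy (\<lambda>q. ln (f q)) p = pdy f p / f p"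
    "(\<lambda>q. ln (f q)) differentiable at p"
  using pd_real_comp[OF DERIV_ln_divide[OF assms(2)] assms(1)] by auto

lemma smooth_on_mult:
  fixes f g :: "complex \<Rightarrow> real"
  assumes "open S" "smooth_on S f" "smooth_on S g"
  shows "smooth_on S (\<lambda>q. f q * g q)"
  by (rule smooth_on_bilinear[OF assms(1) bounded_bilinear_mult assms(2,3)])

lemma smooth_on_divide:
  fixes f g :: "complex \<Rightarrow> real"
  assumes "open S" "smooth_on S f" "smooth_on S g" "\<And>q. q \<in> S \<Longrightarrow> g q \<noteq> 0"
  shows "smooth_on S (\<lambda>q. f q / g q)"
  unfolding divide_inverse using assms by (intro smooth_on_mult smooth_on_inverse)

lemma smooth_on_ln:
  fixes f :: "complex \<Rightarrow> real"
  assumes "open S" "smooth_on S f" "\<And>q. q \<in> S \<Longrightarrow> f q > 0"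
  shows "smooth_on S (\<lambda>q. ln (f q))"
proof (rule smooth_on_if_pd)
  have d: "f differentiable at q" if "q \<in> S" for q using smooth_on_at assms that by blast
  have nz: "f q \<noteq> 0" if "q \<in> S" for q using assms(3)[OF that] by simp
  show "(\<lambda>q. ln (f q)) differentiable_on S"
    using pd_ln(3)[OF d] assms by (simp add: differentiable_on_eq_differentiable_at)
  show "smooth_on S (pdx (\<lambda>q. ln (f q)))"
    by (rule smooth_on_cong[OF assms(1) _ smooth_on_divide[OF assms(1) smooth_on_pd(1)[OF assms(2)] assms(2)]])
      (use assms(3) nz in \<open>auto simp: pd_ln[OF d]\<close>)
  show "smooth_on S (pdy (\<lambda>q. ln (f q)))"
    by (rule smooth_on_cong[OF assms(1) _ smooth_on_divide[OF assms(1) smooth_on_pd(2)[OF assms(2)] assms(2)]])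
      (use assms(3) nz in \<open>auto simp: pd_ln[OF d]\<close>)
qed

lemma smooth_on_subset: "smooth_on S f \<Longrightarrow> T \<subseteq> S \<Longrightarrow> smooth_on T f"
  unfolding smooth_on_def using differentiable_on_subset by blast

text \<open>Write \<open>f\<close> as the integral of \<open>f\<^sub>y\<close> and differentiate under the integral sign.\<close>
lemma pd_commute:
  fixes f :: "complex \<Rightarrow> 'a::euclidean_space"
  assumes "open S" "smooth_on S f" "p \<in> S"
  shows "pdx (pdy f) p = pdy (pdx f) p"
proof -
  obtain e where e: "e > 0" "cball p e \<subseteq> S" using assms open_contains_cball by metis
  define r where "r = e / 2"
  have r: "r > 0" using e by (simp add: r_def)
  let ?w = "\<lambda>x y. p + Complex x y"
  have inS: "?w x y \<in> S" if "x \<in> {-r..r}" "y \<in> {-r..r}" for x y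
  proof -
    have "cmod (Complex x y) \<le> \<bar>x\<bar> + \<bar>y\<bar>" using cmod_le[of "Complex x y"] by simp
    also have "\<dots> \<le> e" using that by (auto simp: r_def)
    finally have "?w x y \<in> cball p e" by (simp add: dist_norm)
    then show ?thesis using e by blast
  qed
  have dx: "((\<lambda>x. g (?w x y)) has_vector_derivative pdx g (?w x y)) (at x)"
    and dy: "((\<lambda>y. g (?w x y)) has_vector_derivative pdy g (?w x y)) (at y)"
    if "smooth_on S g" "x \<in> {-r..r}" "y \<in> {-r..r}" for x y and g :: "complex \<Rightarrow> 'a"
  proof -
    have g: "(g has_derivative (\<lambda>v. Re v *\<^sub>R pdx g (?w x y) + Im v *\<^sub>R pdy g (?w x y))) (at (?w x y))"
      by (rule has_derivative_pd[OF smooth_on_at[OF that(1) assms(1) inS[OF that(2,3)]]])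
    have 1: "((\<lambda>x. ?w x y) has_derivative (\<lambda>t. of_real t)) (at x)"
      unfolding Complex_eq by (auto intro!: derivative_eq_intros)
    have 2: "((\<lambda>y. ?w x y) has_derivative (\<lambda>t. \<i> * of_real t)) (at y)"
      unfolding Complex_eq by (auto intro!: derivative_eq_intros)
    show "((\<lambda>x. g (?w x y)) has_vector_derivative pdx g (?w x y)) (at x)"
      using diff_chain_at[OF 1 g] by (simp add: o_def has_vector_derivative_def)
    show "((\<lambda>y. g (?w x y)) has_vector_derivative pdy g (?w x y)) (at y)"
      using diff_chain_at[OF 2 g] by (simp add: o_def has_vector_derivative_def)
  qed
  have ct: "continuous_on {-r..r} (\<lambda>y. g (?w x y))" if "smooth_on S g" "x \<in> {-r..r}" for x and g :: "complex \<Rightarrow> 'a"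
    using dy[OF that] has_vector_derivative_continuous continuous_at_imp_continuous_on by blast
  note s = smooth_on_pd[OF assms(2)]
  have ct2: "continuous_on ({-r..r} \<times> cbox (-r) r) (\<lambda>(x, t). pdx (pdy f) (?w x t))"
    unfolding split_beta Complex_eq
    by (rule continuous_on_compose2[OF smooth_on_continuous_on[OF smooth_on_pd(1)[OF s(2)]]])
      (auto intro!: continuous_intros simp: Complex_eq[symmetric] intro: inS)
  have key: "f (?w x y) - f (?w x (-r)) = integral {-r..y} (\<lambda>t. pdy f (?w x t))"
    if "x \<in> {-r..r}" "y \<in> {-r..r}" for x y
    by (rule sym, rule integral_unique, rule fundamental_theorem_of_calculus)
      (use that dy[OF assms(2)] in \<open>auto intro: has_vector_derivative_at_within\<close>)
  have dxint: "((\<lambda>x. integral {-r..y} (\<lambda>t. pdy f (?w x t))) has_vector_derivative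
      integral {-r..y} (\<lambda>t. pdx (pdy f) (?w 0 t))) (at 0)" if y: "y \<in> {-r..r}" for y
  proof -
    have "((\<lambda>x. integral (cbox (-r) y) (\<lambda>t. pdy f (?w x t))) has_vector_derivative
      integral (cbox (-r) y) (\<lambda>t. pdx (pdy f) (?w 0 t))) (at 0 within {-r..r})"
    proof (rule leibniz_rule_vector_derivative)
      show "continuous_on ({-r..r} \<times> cbox (-r) y) (\<lambda>(x, t). pdx (pdy f) (?w x t))"
        by (rule continuous_on_subset[OF ct2]) (use y in auto)
      show "(\<lambda>t. pdy f (?w x t)) integrable_on cbox (-r) y" if "x \<in> {-r..r}" for x
        by (intro integrable_continuous continuous_on_subset[OF ct[OF s(2) that]]) (use y in auto)
    qed (use r y dx[OF s(2)] in \<open>auto intro: has_vector_derivative_at_within\<close>)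
    moreover have "at 0 within {-r..r} = at (0::real)" by (rule at_within_interior) (use r in auto)
    ultimately show ?thesis by simp
  qed
  have eq: "pdx f (?w 0 y) - pdx f (?w 0 (-r)) = integral {-r..y} (\<lambda>t. pdx (pdy f) (?w 0 t))"
    if y: "y \<in> {-r..r}" for y
  proof -
    have "((\<lambda>x. f (?w x y) - f (?w x (-r))) has_vector_derivative pdx f (?w 0 y) - pdx f (?w 0 (-r))) (at 0)"
      by (intro has_vector_derivative_diff dx[OF assms(2)]) (use r y in auto)
    moreover have "((\<lambda>x. f (?w x y) - f (?w x (-r))) has_vector_derivative
        integral {-r..y} (\<lambda>t. pdx (pdy f) (?w 0 t))) (at 0)"
      by (rule has_vector_derivative_transform_within[OF dxint[OF y], of r])
        (use r y in \<open>auto simp: dist_norm intro!: key[symmetric]\<close>)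
    ultimately show ?thesis using vector_derivative_unique_at by blast
  qed
  have "((\<lambda>y. integral {-r..y} (\<lambda>t. pdx (pdy f) (?w 0 t))) has_vector_derivative pdx (pdy f) (?w 0 0))
     (at 0 within {-r..r})"
    by (rule integral_has_vector_derivative[OF ct[OF smooth_on_pd(1)[OF s(2)]]]) (use r in auto)
  then have "((\<lambda>y. pdx f (?w 0 y) - pdx f (?w 0 (-r))) has_vector_derivative pdx (pdy f) (?w 0 0))
     (at 0 within {-r..r})"
    by (rule has_vector_derivative_transform[rotated 2]) (use r eq in auto)
  moreover have "at 0 within {-r..r} = at (0::real)" by (rule at_within_interior) (use r in auto)
  ultimately have "((\<lambda>y. pdx f (?w 0 y) - pdx f (?w 0 (-r))) has_vector_derivative pdx (pdy f) (?w 0 0)) (at 0)"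
    by simp
  moreover have "((\<lambda>y. pdx f (?w 0 y) - pdx f (?w 0 (-r))) has_vector_derivative pdy (pdx f) (?w 0 0) - 0) (at 0)"
    by (intro has_vector_derivative_diff dy[OF s(1)] has_vector_derivative_const) (use r in auto)
  ultimately have "pdx (pdy f) (?w 0 0) = pdy (pdx f) (?w 0 0)"
    using vector_derivative_unique_at by (metis diff_zero)
  moreover have "?w 0 0 = p" by (simp add: Complex_eq)
  ultimately show ?thesis by simp
qed

section \<open>Flat linear systems on simply connected domains\<close>

text \<open>The weighted energy \<open>exp (- k * t) * (D t \<bullet> D t + e\<^sup>2)\<close> does
  not increase: Cauchy-Schwarz and 2 |D| e \<le> |D|^2 + e^2 control its derivative, which is where
  k = 2 C + 1 comes from. Working with squares avoids differentiating the norm where D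
  vanishes.\<close>

lemma gronwall:
  fixes D :: "real \<Rightarrow> 'a::real_inner"
  assumes der: "\<And>t. t \<in> {0..1} \<Longrightarrow> (D has_vector_derivative D' t) (at t within {0..1})"
    and bd: "\<And>t. t \<in> {0..1} \<Longrightarrow> norm (D' t) \<le> C * norm (D t) + e"
    and "C \<ge> 0" "e \<ge> 0" "D 0 = 0" and t: "t \<in> {0..1}"
  shows "norm (D t) \<le> exp (2 * C + 1) * e"
proof -
  define k where "k = 2 * C + 1"
  have k: "k \<ge> 1" using assms by (simp add: k_def)
  let ?g = "\<lambda>t. exp (- k * t) * (D t \<bullet> D t + e\<^sup>2)"
  let ?g' = "\<lambda>t. exp (- k * t) * (2 * (D t \<bullet> D' t) - k * (D t \<bullet> D t + e\<^sup>2))"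
  have "(?g has_real_derivative ?g' s) (at s within {0..1})" if "s \<in> {0..1}" for s
  proof -
    have "((\<lambda>s. D s \<bullet> D s) has_vector_derivative D s \<bullet> D' s + D' s \<bullet> D s) (at s within {0..1})"
      using bounded_bilinear.has_vector_derivative[OF bounded_bilinear_inner der[OF that] der[OF that]] .
    then have "((\<lambda>s. D s \<bullet> D s) has_real_derivative 2 * (D s \<bullet> D' s)) (at s within {0..1})"
      by (simp add: has_real_derivative_iff_has_vector_derivative inner_commute)
    then show ?thesis by (auto intro!: derivative_eq_intros simp: algebra_simps)
  qed
  moreover have "?g' s \<le> 0" if "s \<in> {0..1}" for s
  proof -
    have "D s \<bullet> D' s \<le> norm (D s) * norm (D' s)" by (rule norm_cauchy_schwarz)
    also have "\<dots> \<le> norm (D s) * (C * norm (D s) + e)"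
      using bd[OF that] by (intro mult_left_mono) auto
    finally have "2 * (D s \<bullet> D' s) \<le> 2 * C * (norm (D s))\<^sup>2 + 2 * norm (D s) * e"
      by (simp add: algebra_simps power2_eq_square)
    also have "2 * norm (D s) * e \<le> (norm (D s))\<^sup>2 + e\<^sup>2" by (rule sum_squares_bound)
    also have "2 * C * (norm (D s))\<^sup>2 + ((norm (D s))\<^sup>2 + e\<^sup>2) \<le> k * ((norm (D s))\<^sup>2 + e\<^sup>2)"
      using assms by (simp add: k_def algebra_simps)
    finally have "2 * (D s \<bullet> D' s) - k * (D s \<bullet> D s + e\<^sup>2) \<le> 0" by (simp add: power2_norm_eq_inner)
    then show ?thesis by (simp add: mult_nonneg_nonpos)
  qed
  ultimately have der': "\<And>s. s \<in> {0..1} \<Longrightarrow> (?g has_real_derivative ?g' s) (at s within {0..1})"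
    and neg: "\<And>s. s \<in> {0..1} \<Longrightarrow> ?g' s \<le> 0" by blast+
  have "?g t \<le> ?g 0"
  proof (rule DERIV_nonpos_imp_decreasing_open[where f="?g" and a=0 and b=t])
    show "continuous_on {0..t} ?g"
      using der' t by (intro continuous_on_subset[OF DERIV_continuous_on, of "{0..1}"]) auto
    fix s assume s: "0 < s" "s < t"
    then have "at s within {0..1} = at s" using t by (intro at_within_interior) auto
    then show "\<exists>y. (?g has_real_derivative y) (at s) \<and> y \<le> 0"
      using der'[of s] neg[of s] s t by auto
  qed (use t in auto)
  then have "exp (- k * t) * ((norm (D t))\<^sup>2 + e\<^sup>2) \<le> e\<^sup>2" using assms by (simp add: power2_norm_eq_inner)
  then have "exp (k * t) * (exp (- k * t) * ((norm (D t))\<^sup>2 + e\<^sup>2)) \<le> exp (k * t) * e\<^sup>2"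
    by (intro mult_left_mono) auto
  then have "(norm (D t))\<^sup>2 \<le> exp (k * t) * e\<^sup>2"
    by (simp add: mult.assoc[symmetric] exp_add[symmetric]) (smt (verit) zero_le_power2)
  \<comment> \<open>A crude bound from t \<le> 2: the right-hand side becomes a perfect square, so
    the root can be taken directly.\<close>
  also have "\<dots> \<le> (exp k)\<^sup>2 * e\<^sup>2"
  proof (rule mult_right_mono)
    have "k * t \<le> k * 2" using t k by (intro mult_left_mono) auto
    then show "exp (k * t) \<le> (exp k)\<^sup>2" by (simp add: exp_double[symmetric] mult.commute)
  qed auto
  finally have "(norm (D t))\<^sup>2 \<le> (exp k * e)\<^sup>2" by (simp add: power_mult_distrib)
  moreover have "0 \<le> exp k * e" using \<open>e \<ge> 0\<close> by simp
  ultimately have "norm (D t) \<le> exp k * e" by (rule power2_le_imp_le)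
  then show ?thesis unfolding k_def .
qed

text \<open>These are the terms of a series, not the successive approximations: after the constant
  term \<open>u\<close>, each is the difference of two consecutive Picard iterates, and the solution
  is their sum.\<close>

primrec picard :: "(real \<Rightarrow> 'a \<Rightarrow>\<^sub>L 'a) \<Rightarrow> 'a::banach \<Rightarrow> nat \<Rightarrow> real \<Rightarrow> 'a" where
  "picard a u 0 = (\<lambda>t. u)"
| "picard a u (Suc n) = (\<lambda>t. integral {0..t} (\<lambda>s. a s (picard a u n s)))"

text \<open>Linearity gives the factorial bound \<open>bd\<close> on all of [0,1], so the series
  converges without any restriction to short times.\<close>

lemma linear_ode_exists:
  fixes a :: "real \<Rightarrow> 'a::banach \<Rightarrow>\<^sub>L 'a"
  assumes cont: "continuous_on {0..1} a"
  shows "\<exists>y. y 0 = u \<and> (\<forall>t\<in>{0..1}. (y has_vector_derivative a t (y t)) (at t within {0..1}))"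
proof -
  let ?Y = "picard a u"
  obtain M where M: "M > 0" "\<And>t. t \<in> {0..1} \<Longrightarrow> norm (a t) \<le> M"
    using compact_imp_bounded[OF compact_continuous_image[OF cont compact_Icc]]
    by (auto simp: bounded_pos)
  have Yc: "continuous_on {0..1} (?Y n)" for n
  proof (induction n)
    case (Suc n)
    have "(\<lambda>s. a s (?Y n s)) integrable_on {0..1}"
      by (intro integrable_continuous_real continuous_intros cont Suc)
    then show ?case by (simp add: indefinite_integral_continuous_1)
  qed auto
  have aYc: "continuous_on {0..1} (\<lambda>s. a s (?Y n s))" for n
    by (intro continuous_intros cont Yc)
  have Yd: "(?Y (Suc n) has_vector_derivative a t (?Y n t)) (at t within {0..1})" if "t \<in> {0..1}" for n t
    using integral_has_vector_derivative[OF aYc that] by simp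
  have bd: "norm (?Y n t) \<le> norm u * (M * t) ^ n / fact n" if "t \<in> {0..1}" for n t
    using that
  proof (induction n arbitrary: t)
    case (Suc n)
    let ?F = "\<lambda>s. norm u * (M * s) ^ Suc n / fact (Suc n)"
    let ?f = "\<lambda>s. M * (norm u * (M * s) ^ n / fact n)"
    have ftc: "(?f has_integral (?F t - ?F 0)) {0..t}"
    proof (rule fundamental_theorem_of_calculus)
      fix x assume "x \<in> {0..t}"
      have f: "fact (Suc n) = (1 + real n) * fact n" by simp
      have "(?F has_real_derivative (norm u * (real (Suc n) * (M * x) ^ n * M) / fact (Suc n))) (at x within {0..t})"
        by (rule derivative_eq_intros refl | simp)+
      moreover have "norm u * (real (Suc n) * (M * x) ^ n * M) / fact (Suc n) = ?f x"
        unfolding f by (simp add: divide_simps del: of_nat_Suc)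
      ultimately show "(?F has_vector_derivative ?f x) (at x within {0..t})"
        by (simp add: has_real_derivative_iff_has_vector_derivative del: power_Suc fact_Suc)
    qed (use Suc in auto)
    have "norm (?Y (Suc n) t) \<le> integral {0..t} ?f"
      unfolding picard.simps
    proof (rule integral_norm_bound_integral)
      show "(\<lambda>s. a s (?Y n s)) integrable_on {0..t}"
        by (rule integrable_continuous_real[OF continuous_on_subset[OF aYc]]) (use Suc in auto)
      show "?f integrable_on {0..t}" using ftc by blast
      fix s assume s: "s \<in> {0..t}"
      then have s1: "s \<in> {0..1}" using Suc by auto
      have "norm (a s (?Y n s)) \<le> norm (a s) * norm (?Y n s)" by (rule norm_blinfun)
      also have "\<dots> \<le> M * (norm u * (M * s) ^ n / fact n)"
        using M Suc.IH[OF s1] s1 by (intro mult_mono) auto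
      finally show "norm (a s (?Y n s)) \<le> ?f s" .
    qed
    also have "\<dots> = ?F t" using integral_unique[OF ftc] by simp
    finally show ?case .
  qed simp
  have bd1: "norm (?Y n t) \<le> norm u * M ^ n / fact n" if "t \<in> {0..1}" for n t
  proof -
    have "(M * t) ^ n \<le> M ^ n" using M that by (intro power_mono) auto
    then have "norm u * (M * t) ^ n / fact n \<le> norm u * M ^ n / fact n"
      by (intro divide_right_mono mult_left_mono) auto
    then show ?thesis using bd[OF that] order_trans by blast
  qed
  have sumM: "summable (\<lambda>n. norm u * M ^ n / fact n)"
    using summable_mult[OF summable_exp[of M], of "norm u"] by (simp add: field_simps)
  define y where "y t = (\<Sum>n. ?Y n t)" for t
  have ul: "uniform_limit {0..1} (\<lambda>n t. \<Sum>i<n. ?Y i t) y sequentially"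
    unfolding y_def by (rule Weierstrass_m_test[OF bd1 sumM])
  have Ys: "(\<lambda>n. ?Y n t) sums y t" if "t \<in> {0..1}" for t
    using tendsto_uniform_limitI[OF ul that] by (simp add: sums_def)
  have "\<exists>g. \<forall>x\<in>{0..1}. (\<lambda>n. ?Y n x) sums (g x) \<and>
    (g has_derivative (\<lambda>h. h *\<^sub>R a x (y x))) (at x within {0..1})"
  proof (rule has_derivative_series)
    show "convex {0..1::real}" by simp
    show "(?Y n has_derivative (\<lambda>h. h *\<^sub>R (case n of 0 \<Rightarrow> 0 | Suc m \<Rightarrow> a x (?Y m x)))) (at x within {0..1})"
      if "x \<in> {0..1}" for n x
      using Yd[OF that] by (cases n) (auto simp: has_vector_derivative_def)
    show "(\<lambda>n. ?Y n 0) sums y 0" "0 \<in> {0..1::real}" using Ys by auto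
    fix e :: real assume e: "e > 0"
    have "\<forall>\<^sub>F n in sequentially. \<forall>x\<in>{0..1}. dist (\<Sum>i<n. ?Y i x) (y x) < e / M"
      using ul e M by (simp add: uniform_limit_iff)
    \<comment> \<open>The constant term has derivative 0, so the first n + 1 derived terms add up to
      \<open>a x\<close> applied to the first n terms; hence the shift by one, undone at the end.
      The accuracy e / M absorbs the bound M on \<open>a\<close>.\<close>
    then have "\<forall>\<^sub>F n in sequentially. \<forall>x\<in>{0..1}. \<forall>h. norm ((\<Sum>i<Suc n. h *\<^sub>R
       (case i of 0 \<Rightarrow> 0 | Suc m \<Rightarrow> a x (?Y m x))) - h *\<^sub>R a x (y x)) \<le> e * norm h"
    proof eventually_elim
      case (elim n)
      show ?case
      proof (intro ballI allI)
        fix x h :: real assume x: "x \<in> {0..1}"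
        have "(\<Sum>i<Suc n. h *\<^sub>R (case i of 0 \<Rightarrow> 0 | Suc m \<Rightarrow> a x (?Y m x))) - h *\<^sub>R a x (y x)
          = h *\<^sub>R a x ((\<Sum>i<n. ?Y i x) - y x)"
          unfolding sum.lessThan_Suc_shift
          by (simp add: blinfun.sum_right blinfun.diff_right scaleR_sum_right scaleR_diff_right)
        also have "norm \<dots> \<le> \<bar>h\<bar> * (norm (a x) * norm ((\<Sum>i<n. ?Y i x) - y x))"
          by (simp add: mult_left_mono norm_blinfun)
        also have "\<dots> \<le> \<bar>h\<bar> * (M * (e / M))"
          using M x elim by (intro mult_left_mono mult_mono) (auto simp: dist_norm less_imp_le)
        finally show "norm ((\<Sum>i<Suc n. h *\<^sub>R (case i of 0 \<Rightarrow> 0 | Suc m \<Rightarrow> a x (?Y m x)))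
          - h *\<^sub>R a x (y x)) \<le> e * norm h" using M by (simp add: mult.commute)
      qed
    qed
    then show "\<forall>\<^sub>F n in sequentially. \<forall>x\<in>{0..1}. \<forall>h. norm ((\<Sum>i<n. h *\<^sub>R
       (case i of 0 \<Rightarrow> 0 | Suc m \<Rightarrow> a x (?Y m x))) - h *\<^sub>R a x (y x)) \<le> e * norm h"
      using eventually_sequentially_Suc[where P="\<lambda>n. \<forall>x\<in>{0..1}. \<forall>h. norm ((\<Sum>i<n. h *\<^sub>R
       (case i of 0 \<Rightarrow> 0 | Suc m \<Rightarrow> a x (?Y m x))) - h *\<^sub>R a x (y x)) \<le> e * norm h"] by blast
  qed
  then obtain g where g: "\<And>x. x \<in> {0..1} \<Longrightarrow> (\<lambda>n. ?Y n x) sums (g x)"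
    "\<And>x. x \<in> {0..1} \<Longrightarrow> (g has_derivative (\<lambda>h. h *\<^sub>R a x (y x))) (at x within {0..1})" by blast
  have gy: "g x = y x" if "x \<in> {0..1}" for x using g(1)[OF that] Ys[OF that] sums_unique2 by blast
  have "(\<lambda>n. ?Y n 0) sums u"
  proof -
    have "?Y n 0 = (if n = 0 then u else 0)" for n by (cases n) auto
    then show ?thesis using sums_single[of 0 "\<lambda>_. u"] by simp
  qed
  then have "g 0 = u" using g(1)[of 0] sums_unique2 by fastforce
  then show ?thesis using g(2) gy by (intro exI[of _ g]) (auto simp: has_vector_derivative_def)
qed

section \<open>Flat connections: existence on convex and on simply connected domains\<close>

lemma connected_clopen_all:
  assumes "connected S" "z0 \<in> S" "P z0" "open {p\<in>S. P p}" "open {p\<in>S. \<not> P p}" "p \<in> S"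
  shows "P p"
  using connectedD[OF assms(1,4,5)] assms(2,3,6) by auto

lemma linear_complex_expand:
  fixes f :: "complex \<Rightarrow> 'a::real_normed_vector"
  assumes "linear f"
  shows "f v = Re v *\<^sub>R f 1 + Im v *\<^sub>R f \<i>"
proof -
  have "v = Re v *\<^sub>R 1 + Im v *\<^sub>R \<i>" by (simp add: complex_eq_iff)
  then show ?thesis using linear_add[OF assms] linear_scale[OF assms] by metis
qed

lemma linear_complex_bound:
  fixes f :: "complex \<Rightarrow> 'a::real_normed_vector"
  assumes "linear f"
  shows "norm (f v) \<le> (norm (f 1) + norm (f \<i>)) * norm v"
proof -
  have "norm (f v) \<le> \<bar>Re v\<bar> * norm (f 1) + \<bar>Im v\<bar> * norm (f \<i>)"
    unfolding linear_complex_expand[OF assms, of v] by (rule norm_triangle_le) simp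
  also have "\<dots> \<le> norm v * norm (f 1) + norm v * norm (f \<i>)"
    by (intro add_mono mult_right_mono abs_Re_le_cmod abs_Im_le_cmod) auto
  finally show ?thesis by (simp add: algebra_simps)
qed

text \<open>Solve along the rays through \<open>w0\<close>. For neighbouring end points \<open>p\<close> and \<open>q = p + \<delta>\<close>, flatness makes
  the deviation \<open>y\<^sub>q - y\<^sub>p - W(t \<delta>) y\<^sub>p\<close> satisfy a linear differential equation with an inhomogeneity
  of order \<open>o(\<delta>)\<close>, so Gronwall gives the derivative without any smooth dependence theorem.\<close>
lemma flat_system_convex:
  fixes W :: "complex \<Rightarrow> complex \<Rightarrow> 'a::{real_inner, banach} \<Rightarrow>\<^sub>L 'a"
  assumes T: "open T" "convex T" "w0 \<in> T"
    and linW: "\<And>p. p \<in> T \<Longrightarrow> linear (W p)"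
    and derW: "\<And>p v. p \<in> T \<Longrightarrow> ((\<lambda>p. W p v) has_derivative (\<lambda>x. W' p x v)) (at p)"
    and contW': "\<And>x v. continuous_on T (\<lambda>p. W' p x v)"
    and flat: "\<And>p x v. p \<in> T \<Longrightarrow> W' p x v + (W p v o\<^sub>L W p x) = W' p v x + (W p x o\<^sub>L W p v)"
  shows "\<exists>u. u w0 = u0 \<and> (\<forall>p\<in>T. (u has_derivative (\<lambda>v. W p v (u p))) (at p))"
proof -
  define g where "g p t = w0 + complex_of_real t * (p - w0)" for p t
  have gT: "g p t \<in> T" if "p \<in> T" "t \<in> {0..1}" for p t
  proof -
    have "g p t = (1 - t) *\<^sub>R w0 + t *\<^sub>R p" by (simp add: g_def scaleR_conv_of_real algebra_simps)
    then show ?thesis using convexD_alt[OF T(2,3) that(1)] that(2) by auto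
  qed
  have contW: "continuous_on T (\<lambda>p. W p v)" for v
  proof (rule continuous_at_imp_continuous_on, rule ballI)
    fix p assume "p \<in> T"
    then show "isCont (\<lambda>p. W p v) p" by (rule has_derivative_continuous[OF derW])
  qed
  have gc: "continuous_on {0..1} (g p)" for p unfolding g_def by (intro continuous_intros)
  have "\<exists>y. y 0 = u0 \<and> (\<forall>t\<in>{0..1}. (y has_vector_derivative W (g p t) (p - w0) (y t)) (at t within {0..1}))"
    if "p \<in> T" for p
  proof (rule linear_ode_exists)
    show "continuous_on {0..1} (\<lambda>t. W (g p t) (p - w0))"
      using continuous_on_compose2[OF contW[of "p - w0"] gc[of p]] gT[OF that] by blast
  qed
  then obtain y where y0: "\<And>p. p \<in> T \<Longrightarrow> y p 0 = u0" and
    yd: "\<And>p t. p \<in> T \<Longrightarrow> t \<in> {0..1} \<Longrightarrow>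
      (y p has_vector_derivative W (g p t) (p - w0) (y p t)) (at t within {0..1})"
    by metis
  define u where "u p = y p 1" for p
  have "u w0 = u0"
  proof -
    \<comment> \<open>The ray to \<open>w0\<close> itself is constant, so Gronwall applies with C =
      e = 0.\<close>
    have "norm (y w0 1 - u0) \<le> exp (2 * 0 + 1) * 0"
    proof (rule gronwall[where D="\<lambda>t. y w0 t - u0" and D'="\<lambda>t. 0"])
      show "((\<lambda>t. y w0 t - u0) has_vector_derivative 0) (at t within {0..1})" if "t \<in> {0..1}" for t
        using has_vector_derivative_diff[OF yd[OF T(3) that] has_vector_derivative_const[of u0]]
          linear_0[OF linW[OF gT[OF T(3) that]]] by simp
    qed (use y0 T in auto)
    then show ?thesis by (simp add: u_def)
  qed
  moreover have "(u has_derivative (\<lambda>v. W p v (u p))) (at p)" if p: "p \<in> T" for p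
  proof -
    obtain r where r: "r > 0" "cball p r \<subseteq> T" using T(1) p open_contains_cball by metis
    \<comment> \<open>K contains every ray from \<open>w0\<close> to an end point near p; its
      compactness makes the bounds M, L and the linearisation estimate uniform along all these
      rays.\<close>
    define K where "K = convex hull (insert w0 (cball p r))"
    have K: "compact K" "convex K" "K \<subseteq> T" unfolding K_def
      using r T by (auto intro!: compact_convex_hull) (metis hull_minimal insert_subset subsetD)
    have gK: "g q t \<in> K" if "q \<in> cball p r" "t \<in> {0..1}" for q t
    proof -
      have "w0 \<in> K" "q \<in> K" using that unfolding K_def by (auto intro: hull_inc)
      moreover have "g q t = (1 - t) *\<^sub>R w0 + t *\<^sub>R q" by (simp add: g_def scaleR_conv_of_real algebra_simps)
      ultimately show ?thesis using convexD_alt[OF K(2)] that by auto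
    qed
    have bdK: "\<exists>M\<ge>0. \<forall>x\<in>K. norm (f x) \<le> M" if "continuous_on T f" for f :: "complex \<Rightarrow> 'a \<Rightarrow>\<^sub>L 'a"
      using compact_imp_bounded[OF compact_continuous_image[OF continuous_on_subset[OF that K(3)] K(1)]]
      by (auto simp: bounded_pos intro: less_imp_le)
    have WK: "\<exists>M\<ge>0. \<forall>x\<in>K. \<forall>v. norm (W x v) \<le> M * norm v"
    proof -
      obtain M1 M2 where M: "M1 \<ge> 0" "M2 \<ge> 0" "\<forall>x\<in>K. norm (W x 1) \<le> M1" "\<forall>x\<in>K. norm (W x \<i>) \<le> M2"
        using bdK[OF contW] by metis
      have "norm (W x v) \<le> (M1 + M2) * norm v" if "x \<in> K" for x v
        using linear_complex_bound[OF linW, of x v] M that K(3)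
        by (meson add_mono mult_right_mono norm_ge_zero order_trans subsetD)
      then show ?thesis using M(1,2) by (intro exI[of _ "M1 + M2"]) auto
    qed
    then obtain M where M: "M \<ge> 0" "\<And>x v. x \<in> K \<Longrightarrow> norm (W x v) \<le> M * norm v" by blast
    have linW': "linear (\<lambda>x. W' q x v)" if "q \<in> T" for q v
      using has_derivative_linear[OF derW[OF that]] .
    have lip1: "\<exists>L\<ge>0. \<forall>x\<in>K. \<forall>x'\<in>K. norm (W x v - W x' v) \<le> L * norm (x - x')" for v
    proof -
      obtain M1 M2 where M': "M1 \<ge> 0" "M2 \<ge> 0" "\<forall>x\<in>K. norm (W' x 1 v) \<le> M1" "\<forall>x\<in>K. norm (W' x \<i> v) \<le> M2"
        using bdK[OF contW'] by metis
      have b: "norm (W' x h v) \<le> (M1 + M2) * norm h" if "x \<in> K" for x h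
        using linear_complex_bound[OF linW', of x h v] M' that K(3)
        by (meson add_mono mult_right_mono norm_ge_zero order_trans subsetD)
      have "norm (W x v - W x' v) \<le> (M1 + M2) * norm (x - x')" if "x \<in> K" "x' \<in> K" for x x'
        by (rule differentiable_bound[OF K(2), where f'="\<lambda>q x. W' q x v"])
          (use derW K(3) that b M' in \<open>auto intro!: onorm_bound intro: has_derivative_at_withinI\<close>)
      then show ?thesis using M' by (intro exI[of _ "M1 + M2"]) auto
    qed
    have "\<exists>L\<ge>0. \<forall>x\<in>K. \<forall>x'\<in>K. \<forall>v. norm (W x v - W x' v) \<le> L * norm (x - x') * norm v"
    proof -
      obtain L1 L2 where L: "L1 \<ge> 0" "L2 \<ge> 0" "\<forall>x\<in>K. \<forall>x'\<in>K. norm (W x 1 - W x' 1) \<le> L1 * norm (x - x')"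
        "\<forall>x\<in>K. \<forall>x'\<in>K. norm (W x \<i> - W x' \<i>) \<le> L2 * norm (x - x')"
        using lip1 by metis
      have "norm (W x v - W x' v) \<le> (L1 + L2) * norm (x - x') * norm v" if x: "x \<in> K" "x' \<in> K" for x x' v
      proof -
        have "linear (\<lambda>v. W x v - W x' v)" using linW x K(3) by (intro linear_compose_sub) auto
        from linear_complex_bound[OF this, of v]
        have "norm (W x v - W x' v) \<le> (norm (W x 1 - W x' 1) + norm (W x \<i> - W x' \<i>)) * norm v" .
        also have "\<dots> \<le> (L1 * norm (x - x') + L2 * norm (x - x')) * norm v"
          using L x by (intro mult_right_mono add_mono) auto
        finally show ?thesis by (simp add: algebra_simps)
      qed
      then show ?thesis using L by (intro exI[of _ "L1 + L2"]) auto
    qed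
    then obtain L where L: "L \<ge> 0" "\<And>x x' v. x \<in> K \<Longrightarrow> x' \<in> K \<Longrightarrow> norm (W x v - W x' v) \<le> L * norm (x - x') * norm v"
      by blast
    \<comment> \<open>Uniform continuity of W' on K makes the first-order Taylor remainder small
      uniformly in the base point.\<close>
    have lin1: "\<exists>d>0. \<forall>x\<in>K. \<forall>x'\<in>K. norm (x - x') < d \<longrightarrow>
       norm (W x v - W x' v - W' x' (x - x') v) \<le> e * norm (x - x')" if e: "e > 0" for e v
    proof -
      have "uniformly_continuous_on K (\<lambda>p. W' p h v)" for h
        by (rule compact_uniformly_continuous[OF continuous_on_subset[OF contW' K(3)] K(1)])
      then obtain d1 d2 where d: "d1 > 0" "d2 > 0"
        "\<And>x x'. x \<in> K \<Longrightarrow> x' \<in> K \<Longrightarrow> norm (x - x') < d1 \<Longrightarrow> norm (W' x 1 v - W' x' 1 v) < e / 2"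
        "\<And>x x'. x \<in> K \<Longrightarrow> x' \<in> K \<Longrightarrow> norm (x - x') < d2 \<Longrightarrow> norm (W' x \<i> v - W' x' \<i> v) < e / 2"
        using e unfolding uniformly_continuous_on_def dist_norm by (metis half_gt_zero)
      have "norm (W x v - W x' v - W' x' (x - x') v) \<le> norm (x - x') * e"
        if x: "x \<in> K" "x' \<in> K" and xd: "norm (x - x') < min d1 d2" for x x'
      proof (rule differentiable_bound_linearization[where f="\<lambda>p. W p v" and f'="\<lambda>q x. W' q x v"
            and S="closed_segment x' x"])
        have seg: "closed_segment x' x \<subseteq> K" using K(2) x by (simp add: closed_segment_subset)
        show "x' + t *\<^sub>R (x - x') \<in> closed_segment x' x" if "t \<in> {0..1}" for t
          using that by (auto simp: in_segment algebra_simps intro!: exI[of _ t])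
        show "x' \<in> closed_segment x' x" by simp
        fix z assume z: "z \<in> closed_segment x' x"
        then have zK: "z \<in> K" using seg by blast
        then show "((\<lambda>p. W p v) has_derivative (\<lambda>x. W' z x v)) (at z within closed_segment x' x)"
          using derW K(3) by (auto intro: has_derivative_at_withinI)
        have nz: "norm (z - x') < d1" "norm (z - x') < d2"
          using segment_bound(1)[OF z] xd by (simp_all add: norm_minus_commute)
        have "linear (\<lambda>h. W' z h v - W' x' h v)"
          using linW' zK x K(3) by (intro linear_compose_sub) auto
        from linear_complex_bound[OF this] d(3)[OF zK x(2) nz(1)] d(4)[OF zK x(2) nz(2)]
        have "norm (W' z h v - W' x' h v) \<le> e * norm h" for h
          by (smt (verit) mult_right_mono norm_ge_zero field_sum_of_halves)
        then show "onorm ((\<lambda>h. W' z h v) - (\<lambda>h. W' x' h v)) \<le> e" using e by (intro onorm_bound) auto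
      qed
      then show ?thesis using d by (intro exI[of _ "min d1 d2"]) (auto simp: mult.commute)
    qed
    define a where "a = p - w0"
    have "continuous_on {0..1} (y p)"
      using yd[OF p] has_vector_derivative_continuous continuous_on_eq_continuous_within by blast
    then obtain Y where Y: "Y > 0" "\<And>t. t \<in> {0..1} \<Longrightarrow> norm (y p t) \<le> Y"
      using compact_imp_bounded[OF compact_continuous_image[of "{0..1}" "y p"]] by (auto simp: bounded_pos)
    define R where "R = norm a + r"
    have R: "norm a \<le> R" "R \<ge> 0" using r by (auto simp: R_def)
    define E where "E = exp (2 * (M * R) + 1)"
    have E: "E \<ge> 0" by (simp add: E_def)
    define c where "c = E * ((M + L * R) * Y)"
    have c: "c \<ge> 0" using E M(1) L(1) R(2) Y(1) by (simp add: c_def)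
    have gd: "norm (g q t - g p t) \<le> norm (q - p)" "g q t - g p t = of_real t * (q - p)"
      if "t \<in> {0..1}" for q t
    proof -
      show 1: "g q t - g p t = of_real t * (q - p)" by (simp add: g_def algebra_simps)
      show "norm (g q t - g p t) \<le> norm (q - p)" unfolding 1 norm_mult using that by (simp add: mult_left_le_one_le)
    qed
    have qR: "norm (q - w0) \<le> R" if "q \<in> cball p r" for q
      using norm_triangle_ineq[of a "q - p"] that by (simp add: a_def R_def dist_norm norm_minus_commute)
    \<comment> \<open>A first Lipschitz estimate in the end point. In \<open>step2\<close> it turns
      each product of a coefficient increment, or of \<open>A t d\<close>, with an increment of y
      into a term of order |q - p|^2.\<close>
    have step1: "norm (y q t - y p t) \<le> c * norm (q - p)" if q: "q \<in> cball p r" and t: "t \<in> {0..1}" for q t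
    proof -
      let ?D' = "\<lambda>t. W (g q t) (q - w0) (y q t) - W (g p t) (p - w0) (y p t)"
      have qT: "q \<in> T" using q r by auto
      have "norm (y q t - y p t) \<le> exp (2 * (M * R) + 1) * ((M + L * R) * Y * norm (q - p))"
      proof (rule gronwall[where D="\<lambda>t. y q t - y p t" and D'="?D'", OF _ _ _ _ _ t])
        show "((\<lambda>t. y q t - y p t) has_vector_derivative ?D' s) (at s within {0..1})" if "s \<in> {0..1}" for s
          by (intro has_vector_derivative_diff yd p qT that)
        fix s :: real assume s: "s \<in> {0..1}"
        have K1: "g q s \<in> K" "g p s \<in> K" using gK s q r by auto
        have "W (g q s) (q - w0) = W (g q s) (p - w0) + W (g q s) (q - p)"
          using linear_add[OF linW, of "g q s" "p - w0" "q - p"] K1 K(3) by auto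
        then have "?D' s = W (g q s) (q - w0) (y q s - y p s) +
          (W (g q s) (q - p) + (W (g q s) (p - w0) - W (g p s) (p - w0))) (y p s)"
          by (simp add: blinfun.diff_right blinfun.diff_left blinfun.add_left)
        also have "norm \<dots> \<le> norm (W (g q s) (q - w0)) * norm (y q s - y p s) +
           norm (W (g q s) (q - p) + (W (g q s) (p - w0) - W (g p s) (p - w0))) * norm (y p s)"
          by (intro norm_triangle_le add_mono norm_blinfun)
        also have "\<dots> \<le> (M * R) * norm (y q s - y p s) + (M * norm (q - p) + L * norm (q - p) * R) * Y"
        proof (intro add_mono mult_mono)
          show "norm (W (g q s) (q - w0)) \<le> M * R"
            using M(2)[OF K1(1), of "q - w0"] mult_left_mono[OF qR[OF q] M(1)] by linarith
          have "norm (W (g q s) (p - w0) - W (g p s) (p - w0)) \<le> L * norm (g q s - g p s) * norm (p - w0)"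
            by (rule L(2)[OF K1])
          also have "\<dots> \<le> L * norm (q - p) * R"
            using gd(1)[OF s, of q] L(1) R by (intro mult_mono) (auto simp: a_def)
          finally show "norm (W (g q s) (q - p) + (W (g q s) (p - w0) - W (g p s) (p - w0)))
            \<le> M * norm (q - p) + L * norm (q - p) * R"
            using M(2)[OF K1(1), of "q - p"] by (intro norm_triangle_le add_mono)
        qed (use Y s M R L in auto)
        finally show "norm (?D' s) \<le> M * R * norm (y q s - y p s) + (M + L * R) * Y * norm (q - p)"
          by (simp add: algebra_simps)
      qed (use M L R Y y0 p qT in auto)
      then show ?thesis by (simp add: c_def E_def mult.assoc)
    qed
    define b where "b = L * R * c + L * (Y + c * r) + M * c"
    have b: "b \<ge> 0" using c M(1) L(1) R(2) Y(1) r by (simp add: b_def)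
    have step2: "norm (u q - u p - W p (q - p) (u p)) \<le> E * ((e * Y + b * norm (q - p)) * norm (q - p))"
      if q: "q \<in> cball p r" and e: "e \<ge> 0"
        and lin: "\<And>x x'. x \<in> K \<Longrightarrow> x' \<in> K \<Longrightarrow> norm (x - x') \<le> norm (q - p) \<Longrightarrow>
           norm (W x a - W x' a - W' x' (x - x') a) \<le> e * norm (x - x')" for q e
    proof -
      have qT: "q \<in> T" using q r by auto
      define d where "d = q - p"
      define A where "A t = W (g p t)" for t
      \<comment> \<open>Moving the end point by d moves the point at time t by t d; flatness
        suggests \<open>t *\<^sub>R A t d (y p t)\<close> as the first-order change of the solution
        there.\<close>
      define D where "D t = y q t - y p t - t *\<^sub>R A t d (y p t)" for t
      define D' where "D' t = W (g q t) (q - w0) (y q t) - A t a (y p t)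
        - (A t d (y p t) + t *\<^sub>R (W' (g p t) a d (y p t) + A t d (A t a (y p t))))" for t
      have "norm (D 1) \<le> exp (2 * (M * R) + 1) * ((e * Y + b * norm d) * norm d)"
      proof (rule gronwall[where D="D" and D'="D'"])
        fix t :: real assume t: "t \<in> {0..1}"
        have K1: "g q t \<in> K" "g p t \<in> K" using gK t q r by auto
        have gpT: "g p t \<in> T" "g q t \<in> T" using K1 K(3) by auto
        have gder: "(g p has_derivative (\<lambda>h. of_real h * a)) (at t within {0..1})"
          unfolding g_def a_def by (auto intro!: derivative_eq_intros)
        have Ader: "((\<lambda>t. A t d) has_vector_derivative W' (g p t) a d) (at t within {0..1})"
        proof -
          have "((\<lambda>t. W (g p t) d) has_derivative (\<lambda>h. W' (g p t) (of_real h * a) d)) (at t within {0..1})"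
            using has_derivative_compose[OF gder derW[OF gpT(1), of d]] .
          moreover have "W' (g p t) (of_real h * a) d = h *\<^sub>R W' (g p t) a d" for h
            using linear_scale[OF linW'[OF gpT(1)], of h a d] by (simp add: scaleR_conv_of_real)
          ultimately show ?thesis by (simp add: has_vector_derivative_def A_def)
        qed
        have "((\<lambda>t. A t d (y p t)) has_vector_derivative A t d (W (g p t) (p - w0) (y p t)) + W' (g p t) a d (y p t))
          (at t within {0..1})"
          by (rule bounded_bilinear.has_vector_derivative[OF bounded_bilinear_blinfun_apply Ader yd[OF p t]])
        from has_vector_derivative_diff[OF has_vector_derivative_diff[OF yd[OF qT t] yd[OF p t]]
            bounded_bilinear.has_vector_derivative[OF bounded_bilinear_scaleR has_vector_derivative_id this]]
        show "(D has_vector_derivative D' t) (at t within {0..1})"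
          unfolding D_def D'_def A_def a_def
          by (rule has_vector_derivative_eq_rhs) (simp add: algebra_simps)
        define F where "F = W (g q t)"
        have lA: "linear (A t)" "linear F" using linW gpT by (auto simp: A_def F_def)
        have W't: "W' (g p t) (g q t - g p t) a = t *\<^sub>R W' (g p t) d a"
          using linear_scale[OF linW'[OF gpT(1)], of t d a] gd(2)[OF t, of q] by (simp add: scaleR_conv_of_real d_def)
        \<comment> \<open>Flatness enters here: it exchanges the directions a and d, so that W is
          differentiated along d, the direction in which the ray to q departs from the ray to
          p.\<close>
        have fl: "W' (g p t) a d (y p t) + A t d (A t a (y p t)) = W' (g p t) d a (y p t) + A t a (A t d (y p t))"
          using arg_cong[OF flat[OF gpT(1), of a d], of "\<lambda>B. blinfun_apply B (y p t)"]
          by (simp add: blinfun.add_left A_def)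
        have qw: "F (q - w0) = F a + F d"
          using linear_add[OF lA(2), of a d] by (simp add: a_def d_def)
        \<comment> \<open>After the exchange the first-order terms cancel. Besides
          \<open>A t a (D t)\<close> there remain a Taylor remainder and terms with two factors of
          order |q - p|.\<close>
        have D't: "D' t = A t a (D t) + (F a - A t a - W' (g p t) (g q t - g p t) a) (y p t)
           + (F a - A t a) (y q t - y p t) + (F d - A t d) (y q t) + A t d (y q t - y p t)"
          unfolding D'_def fl W't D_def F_def[symmetric] qw
          by (simp add: blinfun.bilinear_simps algebra_simps)
        have "norm (D' t) \<le> norm (A t a) * norm (D t) + norm (F a - A t a - W' (g p t) (g q t - g p t) a) * norm (y p t)
           + norm (F a - A t a) * norm (y q t - y p t) + norm (F d - A t d) * norm (y q t) + norm (A t d) * norm (y q t - y p t)"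
          unfolding D't by (intro norm_triangle_le add_mono norm_blinfun)
        also have "\<dots> \<le> (M * R) * norm (D t) + (e * norm d) * Y + (L * norm d * R) * (c * norm d)
           + (L * norm d * norm d) * (Y + c * r) + (M * norm d) * (c * norm d)"
        proof -
          have gd': "norm (g q t - g p t) \<le> norm d" using gd(1)[OF t, of q] by (simp add: d_def)
          have "norm (A t a) \<le> M * norm a" unfolding A_def by (rule M(2)[OF K1(2)])
          also have "\<dots> \<le> M * R" by (rule mult_left_mono[OF R(1) M(1)])
          finally have b1: "norm (A t a) \<le> M * R" .
          have "norm (F a - A t a - W' (g p t) (g q t - g p t) a) \<le> e * norm (g q t - g p t)"
            unfolding F_def A_def by (rule lin[OF K1]) (rule gd(1)[OF t])
          also have "\<dots> \<le> e * norm d" using gd' e by (rule mult_left_mono)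
          finally have b2: "norm (F a - A t a - W' (g p t) (g q t - g p t) a) \<le> e * norm d" .
          have "norm (F a - A t a) \<le> L * norm (g q t - g p t) * norm a"
            unfolding F_def A_def by (rule L(2)[OF K1])
          also have "\<dots> \<le> L * norm d * R"
            by (rule mult_mono[OF mult_left_mono[OF gd' L(1)] R(1)]) (use L(1) in auto)
          finally have b3: "norm (F a - A t a) \<le> L * norm d * R" .
          have "norm (F d - A t d) \<le> L * norm (g q t - g p t) * norm d"
            unfolding F_def A_def by (rule L(2)[OF K1])
          also have "\<dots> \<le> L * norm d * norm d"
            by (rule mult_right_mono[OF mult_left_mono[OF gd' L(1)]]) auto
          finally have b4: "norm (F d - A t d) \<le> L * norm d * norm d" .
          have b5: "norm (A t d) \<le> M * norm d" unfolding A_def by (rule M(2)[OF K1(2)])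
          have y1: "norm (y q t - y p t) \<le> c * norm d" using step1[OF q t] by (simp add: d_def)
          have "norm d \<le> r" using q by (simp add: d_def dist_norm norm_minus_commute)
          then have "c * norm d \<le> c * r" using c by (rule mult_left_mono)
          then have y2: "norm (y q t) \<le> Y + c * r"
            using y1 Y(2)[OF t] norm_triangle_sub[of "y q t" "y p t"] by linarith
          have nn: "0 \<le> e * norm d" "0 \<le> L * norm d * R" "0 \<le> L * norm d * norm d" "0 \<le> M * norm d"
            using e L(1) R(2) M(1) by simp_all
          have "norm (A t a) * norm (D t) \<le> (M * R) * norm (D t)"
            by (rule mult_right_mono[OF b1]) simp
          moreover have "norm (F a - A t a - W' (g p t) (g q t - g p t) a) * norm (y p t) \<le> (e * norm d) * Y"
            by (rule mult_mono[OF b2 Y(2)[OF t] nn(1)]) simp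
          moreover have "norm (F a - A t a) * norm (y q t - y p t) \<le> (L * norm d * R) * (c * norm d)"
            by (rule mult_mono[OF b3 y1 nn(2)]) simp
          moreover have "norm (F d - A t d) * norm (y q t) \<le> (L * norm d * norm d) * (Y + c * r)"
            by (rule mult_mono[OF b4 y2 nn(3)]) simp
          moreover have "norm (A t d) * norm (y q t - y p t) \<le> (M * norm d) * (c * norm d)"
            by (rule mult_mono[OF b5 y1 nn(4)]) simp
          ultimately show ?thesis by (intro add_mono)
        qed
        also have "\<dots> = (M * R) * norm (D t) + (e * Y + b * norm d) * norm d"
          by (simp add: b_def algebra_simps)
        finally show "norm (D' t) \<le> M * R * norm (D t) + (e * Y + b * norm d) * norm d" .
      next
        show "D 0 = 0" using y0 p qT by (simp add: D_def)
      qed (use M R e Y b in auto)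
      moreover have "D 1 = u q - u p - W p (q - p) (u p)"
        by (simp add: D_def u_def A_def d_def g_def)
      ultimately show ?thesis by (simp add: E_def d_def)
    qed
    show ?thesis
      unfolding has_derivative_at_alt
    proof (intro conjI allI impI)
      have "linear (\<lambda>v. W p v (u p))" using linW[OF p]
        by (auto simp: linear_iff blinfun.bilinear_simps)
      then show "bounded_linear (\<lambda>v. W p v (u p))" by (simp add: linear_conv_bounded_linear)
      fix \<epsilon> :: real assume eps: "\<epsilon> > 0"
      have E0: "E > 0" by (simp add: E_def)
      \<comment> \<open>One half of epsilon pays for the Taylor remainder; the second bound in
        \<open>d'\<close> lets the quadratic term cost the other half, with b + 1 in place of b to
        allow b = 0.\<close>
      define e where "e = \<epsilon> / (2 * E * Y)"
      have e: "e > 0" using eps E0 Y by (simp add: e_def)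
      obtain d where d: "d > 0" "\<And>x x'. x \<in> K \<Longrightarrow> x' \<in> K \<Longrightarrow> norm (x - x') < d \<Longrightarrow>
        norm (W x a - W x' a - W' x' (x - x') a) \<le> e * norm (x - x')"
        using lin1[OF e, of a] by blast
      define d' where "d' = min (min d r) (\<epsilon> / (2 * E * (b + 1)))"
      have d': "d' > 0" using d r eps E0 b by (simp add: d'_def)
      have "norm (u q - u p - W p (q - p) (u p)) \<le> \<epsilon> * norm (q - p)" if q: "norm (q - p) < d'" for q
      proof -
        have "norm (u q - u p - W p (q - p) (u p)) \<le> E * ((e * Y + b * norm (q - p)) * norm (q - p))"
          by (rule step2) (use q d e in \<open>auto simp: d'_def dist_norm norm_minus_commute\<close>)
        also have "\<dots> = (E * e * Y + E * (b * norm (q - p))) * norm (q - p)" by (simp add: algebra_simps)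
        also have "\<dots> \<le> (\<epsilon> / 2 + \<epsilon> / 2) * norm (q - p)"
        proof (intro mult_right_mono add_mono)
          show "E * e * Y \<le> \<epsilon> / 2" using E0 Y by (simp add: e_def)
          have "b * norm (q - p) \<le> (b + 1) * (\<epsilon> / (2 * E * (b + 1)))"
            using q b by (intro mult_mono) (auto simp: d'_def)
          also have "\<dots> = \<epsilon> / (2 * E)"
          proof -
            have "k * (\<epsilon> / (2 * E * k)) = \<epsilon> / (2 * E)" if "k > 0" for k using that by simp
            then show ?thesis using b by simp
          qed
          finally have "E * (b * norm (q - p)) \<le> E * (\<epsilon> / (2 * E))" using E by (rule mult_left_mono)
          then show "E * (b * norm (q - p)) \<le> \<epsilon> / 2" using E0 by simp
        qed auto
        finally show ?thesis by simp
      qed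
      then show "\<exists>d>0. \<forall>q. norm (q - p) < d \<longrightarrow> norm (u q - u p - W p (q - p) (u p)) \<le> \<epsilon> * norm (q - p)"
        using d' by blast
    qed
  qed
  ultimately show ?thesis by blast
qed

text \<open>By the Riemann mapping theorem S is the plane or biholomorphic to a disc. A flat
  connection pulls back to a flat connection under the inverse map, so the convex case applies there
  and its solution is carried back.\<close>

lemma flat_system_simply_connected:
  fixes A B :: "complex \<Rightarrow> 'a::{real_inner, banach} \<Rightarrow>\<^sub>L 'a"
  assumes S: "open S" "simply_connected S" "z0 \<in> S"
    and AB: "smooth_on S A" "smooth_on S B"
    and flat: "\<And>p. p \<in> S \<Longrightarrow> pdy A p + (A p o\<^sub>L B p) = pdx B p + (B p o\<^sub>L A p)"
  shows "\<exists>u. u z0 = u0 \<and> (\<forall>p\<in>S. (u has_derivative (\<lambda>v. Re v *\<^sub>R A p (u p) + Im v *\<^sub>R B p (u p))) (at p))"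
proof -
  obtain T f g where T: "open T" "convex T" and f: "f holomorphic_on S" and g: "g holomorphic_on T"
    and fg: "\<And>z. z \<in> S \<Longrightarrow> f z \<in> T" "\<And>z. z \<in> S \<Longrightarrow> g (f z) = z" "\<And>w. w \<in> T \<Longrightarrow> g w \<in> S"
      "\<And>w. w \<in> T \<Longrightarrow> f (g w) = w"
  proof (cases "S = UNIV")
    case True
    then show thesis by (intro that[of UNIV "\<lambda>z. z" "\<lambda>z. z"]) auto
  next
    case False
    then show thesis
      using S simply_connected_eq_biholomorphic_to_disc[OF S(1)] that[of "ball 0 1"] by blast
  qed
  define W where "W p v = Re v *\<^sub>R A p + Im v *\<^sub>R B p" for p v
  define W' where "W' p x v = Re v *\<^sub>R (Re x *\<^sub>R pdx A p + Im x *\<^sub>R pdy A p)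
      + Im v *\<^sub>R (Re x *\<^sub>R pdx B p + Im x *\<^sub>R pdy B p)" for p x v
  have flatW: "W' p x v + (W p v o\<^sub>L W p x) = W' p v x + (W p x o\<^sub>L W p v)" if "p \<in> S" for p x v
  proof -
    have "W' p x v + (W p v o\<^sub>L W p x) - (W' p v x + (W p x o\<^sub>L W p v)) =
      (Re v * Im x - Im v * Re x) *\<^sub>R (pdy A p + (A p o\<^sub>L B p) - (pdx B p + (B p o\<^sub>L A p)))"
      unfolding W_def W'_def
      by (rule blinfun_eqI) (simp add: blinfun.bilinear_simps algebra_simps)
    then show ?thesis using flat[OF that] by simp
  qed
  define g1 g2 where "g1 = deriv g" and "g2 = deriv g1"
  have g1h: "g1 holomorphic_on T" and g2h: "g2 holomorphic_on T"
    using g T by (auto simp: g1_def g2_def intro!: holomorphic_deriv)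
  have g1d: "(g has_field_derivative g1 w) (at w)" "(g1 has_field_derivative g2 w) (at w)" if "w \<in> T" for w
    using holomorphic_derivI[OF g T(1) that] holomorphic_derivI[OF g1h T(1) that] by (auto simp: g1_def g2_def)
  define V where "V w v = W (g w) (g1 w * v)" for w v
  \<comment> \<open>The term with \<open>g2\<close> is symmetric in x and v, so it cancels in the
    flatness condition.\<close>
  define V' where "V' w x v = W' (g w) (g1 w * x) (g1 w * v) + W (g w) (g2 w * x * v)" for w x v
  have "\<exists>u. u (f z0) = u0 \<and> (\<forall>w\<in>T. (u has_derivative (\<lambda>v. V w v (u w))) (at w))"
  proof (rule flat_system_convex[OF T fg(1)[OF S(3)], where W'=V'])
    show "linear (V w)" if "w \<in> T" for w
      unfolding V_def W_def by (auto simp: linear_iff algebra_simps scaleR_conv_of_real)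
    show "V' w x v + (V w v o\<^sub>L V w x) = V' w v x + (V w x o\<^sub>L V w v)" if "w \<in> T" for w x v
      using flatW[OF fg(3)[OF that], of "g1 w * x" "g1 w * v"] unfolding V'_def V_def
      by (simp add: algebra_simps)
    fix v
    show "((\<lambda>w. V w v) has_derivative (\<lambda>x. V' w x v)) (at w)" if w: "w \<in> T" for w
    proof -
      have gd: "(g has_derivative (\<lambda>x. g1 w * x)) (at w)"
        using g1d(1)[OF w] by (simp add: has_field_derivative_def)
      have cd: "((\<lambda>w. g1 w * v) has_derivative (\<lambda>x. g2 w * x * v)) (at w)"
        using has_derivative_mult_left[OF g1d(2)[OF w, unfolded has_field_derivative_def]] .
      have comp: "((\<lambda>w. C (g w)) has_derivative (\<lambda>x. Re (g1 w * x) *\<^sub>R pdx C (g w) + Im (g1 w * x) *\<^sub>R pdy C (g w))) (at w)"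
        if "smooth_on S C" for C :: "complex \<Rightarrow> 'a \<Rightarrow>\<^sub>L 'a"
        using has_derivative_compose[OF gd has_derivative_pd[OF smooth_on_at[OF that S(1) fg(3)[OF w]]]] .
      show ?thesis
        unfolding V_def V'_def W_def W'_def
        by (rule has_derivative_eq_rhs, (rule derivative_intros cd comp AB)+)
          (auto simp: algebra_simps)
    qed
    fix x
    have co: "continuous_on T (\<lambda>w. C (g w))" if "smooth_on S C" for C :: "complex \<Rightarrow> 'a \<Rightarrow>\<^sub>L 'a"
      using continuous_on_compose2[OF smooth_on_continuous_on[OF that] holomorphic_on_imp_continuous_on[OF g]] fg by blast
    show "continuous_on T (\<lambda>w. V' w x v)"
      unfolding V'_def W_def W'_def
      by (intro continuous_intros co smooth_on_pd AB holomorphic_on_imp_continuous_on g1h g2h)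
  qed
  then obtain u where u: "u (f z0) = u0" "\<And>w. w \<in> T \<Longrightarrow> (u has_derivative (\<lambda>v. V w v (u w))) (at w)" by blast
  have "((\<lambda>p. u (f p)) has_derivative (\<lambda>v. Re v *\<^sub>R A p (u (f p)) + Im v *\<^sub>R B p (u (f p)))) (at p)"
    if p: "p \<in> S" for p
  proof -
    have fd: "(f has_field_derivative deriv f p) (at p)" using holomorphic_derivI[OF f S(1) p] .
    have gd: "(g has_field_derivative g1 (f p)) (at (f p))" using g1d fg(1)[OF p] by blast
    have "((\<lambda>z. g (f z)) has_field_derivative g1 (f p) * deriv f p) (at p)"
      using DERIV_chain2[OF gd fd] .
    moreover have "((\<lambda>z. g (f z)) has_field_derivative 1) (at p)"
      by (rule DERIV_cong_ev[THEN iffD2, OF refl _ refl DERIV_ident])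
        (use S(1) p fg(2) in \<open>auto simp: eventually_nhds\<close>)
    \<comment> \<open>Inverse maps have reciprocal derivatives, so pulling back along g and then
      along f returns the original connection.\<close>
    ultimately have one: "g1 (f p) * deriv f p = 1" using DERIV_unique by blast
    have "((\<lambda>p. u (f p)) has_derivative (\<lambda>v. V (f p) (deriv f p * v) (u (f p)))) (at p)"
      using has_derivative_compose[OF fd[unfolded has_field_derivative_def] u(2)[OF fg(1)[OF p]]] .
    moreover have "V (f p) (deriv f p * v) = W p v" for v
      using one fg(2)[OF p] by (simp add: V_def mult.assoc[symmetric])
    ultimately show ?thesis by (simp add: W_def blinfun.bilinear_simps)
  qed
  then show ?thesis using u(1) by (intro exI[of _ "\<lambda>p. u (f p)"]) auto
qed

text \<open>The zero set is closed in S by continuity, and open because Gronwall with e = 0 along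
  the radii of a small ball propagates a zero at the centre.\<close>

lemma linear_system_unique:
  fixes A B :: "complex \<Rightarrow> 'a::{real_inner} \<Rightarrow>\<^sub>L 'a"
  assumes S: "open S" "connected S" "z0 \<in> S"
    and AB: "continuous_on S A" "continuous_on S B"
    and der: "\<And>p. p \<in> S \<Longrightarrow> (u has_derivative (\<lambda>v. Re v *\<^sub>R A p (u p) + Im v *\<^sub>R B p (u p))) (at p)"
    and "u z0 = 0" "p \<in> S"
  shows "u p = 0"
proof (rule connected_clopen_all[where P="\<lambda>p. u p = 0", OF S(2,3) assms(7) _ _ assms(8)])
  have cu: "continuous_on S u"
  proof (rule continuous_at_imp_continuous_on, rule ballI)
    fix p assume "p \<in> S"
    then show "isCont u p" by (rule has_derivative_continuous[OF der])
  qed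
  have "open (S \<inter> u -` (- {0}))" using cu S(1) by (intro continuous_open_preimage) auto
  then show "open {p \<in> S. u p \<noteq> 0}" by (simp add: vimage_def Int_def)
  show "open {p \<in> S. u p = 0}"
    unfolding open_contains_ball
  proof
    fix p assume "p \<in> {p \<in> S. u p = 0}"
    then have p: "p \<in> S" "u p = 0" by auto
    obtain r where r: "r > 0" "cball p r \<subseteq> S" using S(1) p(1) open_contains_cball by metis
    have bd: "\<exists>M\<ge>0. \<forall>x\<in>cball p r. norm (f x) \<le> M" if "continuous_on S f" for f :: "complex \<Rightarrow> 'a \<Rightarrow>\<^sub>L 'a"
      using compact_imp_bounded[OF compact_continuous_image[OF continuous_on_subset[OF that r(2)] compact_cball]]
      by (auto simp: bounded_pos intro: less_imp_le)
    obtain M1 where M1: "M1 \<ge> 0" "\<forall>x\<in>cball p r. norm (A x) \<le> M1" using bd[OF AB(1)] by blast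
    obtain M2 where M2: "M2 \<ge> 0" "\<forall>x\<in>cball p r. norm (B x) \<le> M2" using bd[OF AB(2)] by blast
    note M = M1(1) M2(1) M1(2) M2(2)
    have "u q = 0" if q: "q \<in> ball p r" for q
    proof -
      define d where "d = q - p"
      let ?g = "\<lambda>t. p + complex_of_real t * d"
      let ?D' = "\<lambda>t. Re d *\<^sub>R A (?g t) (u (?g t)) + Im d *\<^sub>R B (?g t) (u (?g t))"
      have "norm (u (?g 1)) \<le> exp (2 * (norm d * (M1 + M2)) + 1) * 0"
      proof (rule gronwall[where D="\<lambda>t. u (?g t)" and D'="?D'"])
        fix t :: real assume t: "t \<in> {0..1}"
        have "norm (complex_of_real t * d) = t * norm d" using t by (simp add: norm_mult)
        also have "\<dots> \<le> 1 * norm d" using t by (intro mult_right_mono) auto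
        also have "\<dots> \<le> r" using q by (simp add: d_def dist_norm norm_minus_commute)
        finally have "norm (complex_of_real t * d) \<le> r" .
        then have gt: "?g t \<in> cball p r" by (simp add: dist_norm)
        have "(?g has_derivative (\<lambda>h. of_real h * d)) (at t within {0..1})"
          by (auto intro!: derivative_eq_intros)
        then have "((\<lambda>t. u (?g t)) has_derivative (\<lambda>h. Re (of_real h * d) *\<^sub>R A (?g t) (u (?g t))
            + Im (of_real h * d) *\<^sub>R B (?g t) (u (?g t)))) (at t within {0..1})"
          by (rule has_derivative_compose[OF _ der]) (use gt r in blast)
        then show "((\<lambda>t. u (?g t)) has_vector_derivative ?D' t) (at t within {0..1})"
          by (simp add: has_vector_derivative_def scaleR_add_right)
        have nA: "norm (A (?g t) (u (?g t))) \<le> M1 * norm (u (?g t))"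
          by (rule order_trans[OF norm_blinfun mult_right_mono]) (use M gt in auto)
        have nB: "norm (B (?g t) (u (?g t))) \<le> M2 * norm (u (?g t))"
          by (rule order_trans[OF norm_blinfun mult_right_mono]) (use M gt in auto)
        have "norm (?D' t) \<le> \<bar>Re d\<bar> * norm (A (?g t) (u (?g t))) + \<bar>Im d\<bar> * norm (B (?g t) (u (?g t)))"
          by (rule norm_triangle_le) simp
        also have "\<dots> \<le> norm d * (M1 * norm (u (?g t))) + norm d * (M2 * norm (u (?g t)))"
          by (rule add_mono; rule mult_mono) (use nA nB abs_Re_le_cmod abs_Im_le_cmod in auto)
        finally show "norm (?D' t) \<le> norm d * (M1 + M2) * norm (u (?g t)) + 0" by (simp add: algebra_simps)
      qed (use M p in auto)
      then show ?thesis by (simp add: d_def)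
    qed
    then show "\<exists>e>0. ball p e \<subseteq> {p \<in> S. u p = 0}"
      using r by (intro exI[of _ r]) (auto simp: subset_iff)
  qed
qed

section \<open>Unique continuation\<close>

text \<open>The frequency \<open>D / H\<close>, with \<open>D = \<integral> \<langle>- J u\<^sub>t, u\<rangle>\<close>, is almost nondecreasing in \<open>s\<close>; hence it is bounded above
  as \<open>s\<close> decreases and \<open>H\<close> cannot reach \<open>0\<close> unless it vanishes identically.\<close>
lemma frequency_vanishing:
  fixes u us ut ust :: "real \<Rightarrow> real \<Rightarrow> 'a::real_inner" and J :: "'a \<Rightarrow> 'a"
  defines "\<Theta> \<equiv> {0..2*pi}"
  assumes s12: "s1 \<le> s2"
    and c: "continuous_on ({s1..s2} \<times> \<Theta>) (\<lambda>x. u (fst x) (snd x))"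
      "continuous_on ({s1..s2} \<times> \<Theta>) (\<lambda>x. us (fst x) (snd x))"
      "continuous_on ({s1..s2} \<times> \<Theta>) (\<lambda>x. ut (fst x) (snd x))"
      "continuous_on ({s1..s2} \<times> \<Theta>) (\<lambda>x. ust (fst x) (snd x))"
    and du: "\<And>s t. s \<in> {s1..s2} \<Longrightarrow> t \<in> \<Theta> \<Longrightarrow> ((\<lambda>s. u s t) has_vector_derivative us s t) (at s within {s1..s2})"
    and dt: "\<And>s t. s \<in> {s1..s2} \<Longrightarrow> t \<in> \<Theta> \<Longrightarrow> ((\<lambda>t. u s t) has_vector_derivative ut s t) (at t within \<Theta>)"
    and dst: "\<And>s t. s \<in> {s1..s2} \<Longrightarrow> t \<in> \<Theta> \<Longrightarrow> ((\<lambda>s. ut s t) has_vector_derivative ust s t) (at s within {s1..s2})"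
    and dts: "\<And>s t. s \<in> {s1..s2} \<Longrightarrow> t \<in> \<Theta> \<Longrightarrow> ((\<lambda>t. us s t) has_vector_derivative ust s t) (at t within \<Theta>)"
    and per: "\<And>s. s \<in> {s1..s2} \<Longrightarrow> u s 0 = u s (2*pi)" "\<And>s. s \<in> {s1..s2} \<Longrightarrow> us s 0 = us s (2*pi)"
    and J: "bounded_linear J" "\<And>x y. J x \<bullet> y = - (x \<bullet> J y)"
    and K: "K \<ge> 0" "\<And>s t. s \<in> {s1..s2} \<Longrightarrow> t \<in> \<Theta> \<Longrightarrow> norm (us s t + J (ut s t)) \<le> K * norm (u s t)"
    and H1: "integral \<Theta> (\<lambda>t. u s1 t \<bullet> u s1 t) = 0"
  shows "integral \<Theta> (\<lambda>t. u s2 t \<bullet> u s2 t) = 0"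
proof -
  let ?I = "{s1..s2}"
  define L where "L s t = - J (ut s t)" for s t
  define Ls where "Ls s t = - J (ust s t)" for s t
  define H where "H s = integral \<Theta> (\<lambda>t. u s t \<bullet> u s t)" for s
  define D where "D s = integral \<Theta> (\<lambda>t. L s t \<bullet> u s t)" for s
  define a where "a s = integral \<Theta> (\<lambda>t. L s t \<bullet> us s t)" for s
  define b where "b s = integral \<Theta> (\<lambda>t. us s t \<bullet> u s t)" for s
  have cL: "continuous_on (?I \<times> \<Theta>) (\<lambda>x. L (fst x) (snd x))" "continuous_on (?I \<times> \<Theta>) (\<lambda>x. Ls (fst x) (snd x))"
    unfolding L_def Ls_def by (intro continuous_intros bounded_linear.continuous_on[OF J(1)] c)+
  have sl: "continuous_on \<Theta> (\<lambda>t. f s t)" if "continuous_on (?I \<times> \<Theta>) (\<lambda>x. f (fst x) (snd x))" "s \<in> ?I"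
    for f :: "real \<Rightarrow> real \<Rightarrow> 'a" and s
    using continuous_on_compose2[OF that(1) continuous_on_Pair[OF continuous_on_const continuous_on_id], of s \<Theta>] that(2)
    by (auto simp: image_subset_iff)
  have int: "(\<lambda>t. f s t \<bullet> g s t) integrable_on \<Theta>"
    if "continuous_on (?I \<times> \<Theta>) (\<lambda>x. f (fst x) (snd x))" "continuous_on (?I \<times> \<Theta>) (\<lambda>x. g (fst x) (snd x))" "s \<in> ?I"
    for f g :: "real \<Rightarrow> real \<Rightarrow> 'a" and s
    unfolding \<Theta>_def by (intro integrable_continuous_real continuous_intros sl[unfolded \<Theta>_def] that[unfolded \<Theta>_def])
  have leib: "((\<lambda>s. integral \<Theta> (\<lambda>t. f s t \<bullet> g s t)) has_real_derivative
       integral \<Theta> (\<lambda>t. f s t \<bullet> g' s t + f' s t \<bullet> g s t)) (at s within ?I)"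
    if cc: "continuous_on (?I \<times> \<Theta>) (\<lambda>x. f (fst x) (snd x))" "continuous_on (?I \<times> \<Theta>) (\<lambda>x. g (fst x) (snd x))"
      "continuous_on (?I \<times> \<Theta>) (\<lambda>x. f' (fst x) (snd x))" "continuous_on (?I \<times> \<Theta>) (\<lambda>x. g' (fst x) (snd x))"
      and fd: "\<And>s t. s \<in> ?I \<Longrightarrow> t \<in> \<Theta> \<Longrightarrow> ((\<lambda>s. f s t) has_vector_derivative f' s t) (at s within ?I)"
      and gd: "\<And>s t. s \<in> ?I \<Longrightarrow> t \<in> \<Theta> \<Longrightarrow> ((\<lambda>s. g s t) has_vector_derivative g' s t) (at s within ?I)"
      and s: "s \<in> ?I"
    for f g f' g' :: "real \<Rightarrow> real \<Rightarrow> 'a" and s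
  proof -
    have "((\<lambda>s. integral (cbox 0 (2*pi)) (\<lambda>t. f s t \<bullet> g s t)) has_real_derivative
       integral (cbox 0 (2*pi)) (\<lambda>t. f s t \<bullet> g' s t + f' s t \<bullet> g s t)) (at s within ?I)"
    proof (rule leibniz_rule_field_derivative)
      show "((\<lambda>s. f s t \<bullet> g s t) has_real_derivative f s t \<bullet> g' s t + f' s t \<bullet> g s t) (at s within ?I)"
        if "s \<in> ?I" "t \<in> cbox 0 (2*pi)" for s t
        unfolding has_real_derivative_iff_has_vector_derivative
        using bounded_bilinear.has_vector_derivative[OF bounded_bilinear_inner fd gd] that by (simp add: \<Theta>_def)
      show "(\<lambda>t. f s t \<bullet> g s t) integrable_on cbox 0 (2*pi)" if "s \<in> ?I" for s
        using int[OF cc(1,2) that] by (simp add: \<Theta>_def)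
      show "continuous_on (?I \<times> cbox 0 (2*pi)) (\<lambda>(s, t). f s t \<bullet> g' s t + f' s t \<bullet> g s t)"
        unfolding split_beta using cc by (auto simp: \<Theta>_def intro!: continuous_intros)
    qed (use s in auto)
    then show ?thesis by (simp add: \<Theta>_def)
  qed
  have Ld: "((\<lambda>s. L s t) has_vector_derivative Ls s t) (at s within ?I)" if "s \<in> ?I" "t \<in> \<Theta>" for s t
    unfolding L_def Ls_def
    by (intro has_vector_derivative_minus bounded_linear.has_vector_derivative[OF J(1)] dst that)
  have Hd: "(H has_real_derivative 2 * b s) (at s within ?I)" if s: "s \<in> ?I" for s
  proof -
    have "integral \<Theta> (\<lambda>t. u s t \<bullet> us s t + us s t \<bullet> u s t) = integral \<Theta> (\<lambda>t. 2 * (us s t \<bullet> u s t))"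
      by (simp add: inner_commute)
    also have "\<dots> = 2 * b s" by (simp add: b_def)
    finally show ?thesis using leib[OF c(1) c(1) c(2) c(2) du du s] by (simp add: H_def[abs_def])
  qed
  \<comment> \<open>The operator - J d/dt is self-adjoint on periodic functions: J is skew, and so
    is d/dt after integration by parts over a full period. This is what gives D' = 2 a.\<close>
  have ibp: "integral \<Theta> (\<lambda>t. Ls s t \<bullet> u s t) = a s" if s: "s \<in> ?I" for s
  proof -
    have "((\<lambda>t. - J (us s t) \<bullet> ut s t + Ls s t \<bullet> u s t) has_integral
       - J (us s (2*pi)) \<bullet> u s (2*pi) - (- J (us s 0) \<bullet> u s 0)) \<Theta>"
      unfolding \<Theta>_def
    proof (rule fundamental_theorem_of_calculus)
      fix t assume t: "t \<in> {0..2*pi}"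
      have "((\<lambda>t. - J (us s t)) has_vector_derivative Ls s t) (at t within {0..2*pi})"
        unfolding Ls_def using dts[OF s] t
        by (intro has_vector_derivative_minus bounded_linear.has_vector_derivative[OF J(1)]) (auto simp: \<Theta>_def)
      then show "((\<lambda>t. - J (us s t) \<bullet> u s t) has_vector_derivative - J (us s t) \<bullet> ut s t + Ls s t \<bullet> u s t)
        (at t within {0..2*pi})"
        using bounded_bilinear.has_vector_derivative[OF bounded_bilinear_inner _ dt[OF s, unfolded \<Theta>_def, OF t]] by blast
    qed auto
    then have "integral \<Theta> (\<lambda>t. - J (us s t) \<bullet> ut s t + Ls s t \<bullet> u s t) = 0"
      using per[OF s] by (simp add: integral_unique)
    moreover have "- J (us s t) \<bullet> ut s t = - (L s t \<bullet> us s t)" for t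
      using J(2)[of "us s t" "ut s t"] by (simp add: L_def inner_commute)
    ultimately have "integral \<Theta> (\<lambda>t. Ls s t \<bullet> u s t - L s t \<bullet> us s t) = 0" by simp
    then show ?thesis
      using integral_diff[OF int[OF cL(2) c(1) s] int[OF cL(1) c(2) s]] by (simp add: a_def)
  qed
  have Dd: "(D has_real_derivative 2 * a s) (at s within ?I)" if s: "s \<in> ?I" for s
  proof -
    have "integral \<Theta> (\<lambda>t. L s t \<bullet> us s t + Ls s t \<bullet> u s t) = a s + a s"
      using integral_add[OF int[OF cL(1) c(2) s] int[OF cL(2) c(1) s]] ibp[OF s] by (simp add: a_def)
    then show ?thesis using leib[OF cL(1) c(1) cL(2) c(2) Ld du s] by (simp add: D_def[abs_def])
  qed
  have key: "2 * a s - N * (2 * b s) \<ge> - (K\<^sup>2 / 2) * H s" if s: "s \<in> ?I" and N: "D s = N * H s" for s N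
  proof -
    let ?X = "\<lambda>t. L s t - N *\<^sub>R u s t"
    have i: "((\<lambda>t. L s t \<bullet> us s t) has_integral a s) \<Theta>" "((\<lambda>t. us s t \<bullet> u s t) has_integral b s) \<Theta>"
      "((\<lambda>t. L s t \<bullet> u s t) has_integral D s) \<Theta>" "((\<lambda>t. u s t \<bullet> u s t) has_integral H s) \<Theta>"
      unfolding a_def b_def D_def H_def by (intro integrable_integral int c cL s)+
    \<comment> \<open>Because D = N H, the terms - 2 N D + 2 N^2 H add up to 0; they are inserted to
      complete a square. With the error P = us - L, the integrand is at least half of |2 X + P|^2,
      where K^2 / 2 compensates half of |P|^2.\<close>
    have "((\<lambda>t. 2 * (L s t \<bullet> us s t) - 2 * N * (us s t \<bullet> u s t) - 2 * N * (L s t \<bullet> u s t)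
        + (2 * N\<^sup>2 + K\<^sup>2 / 2) * (u s t \<bullet> u s t)) has_integral
       2 * a s - 2 * N * b s - 2 * N * D s + (2 * N\<^sup>2 + K\<^sup>2 / 2) * H s) \<Theta>"
      by (intro has_integral_add has_integral_diff has_integral_mult_right i)
    moreover have "2 * (L s t \<bullet> us s t) - 2 * N * (us s t \<bullet> u s t) - 2 * N * (L s t \<bullet> u s t)
        + (2 * N\<^sup>2 + K\<^sup>2 / 2) * (u s t \<bullet> u s t) \<ge> 0" if t: "t \<in> \<Theta>" for t
    proof -
      define P where "P = us s t - L s t"
      have "norm P \<le> K * norm (u s t)" using K(2)[OF s t] by (simp add: P_def L_def)
      then have "P \<bullet> P \<le> K\<^sup>2 * (u s t \<bullet> u s t)"
        by (metis norm_ge_zero power2_norm_eq_inner power_mono power_mult_distrib)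
      moreover have "0 \<le> (2 *\<^sub>R ?X t + P) \<bullet> (2 *\<^sub>R ?X t + P)" by simp
      moreover have "us s t = L s t + P" by (simp add: P_def)
      ultimately show ?thesis
        by (simp add: inner_commute algebra_simps power2_eq_square)
    qed
    ultimately have "2 * a s - 2 * N * b s - 2 * N * D s + (2 * N\<^sup>2 + K\<^sup>2 / 2) * H s \<ge> 0"
      by (rule has_integral_nonneg)
    then show ?thesis unfolding N by (simp add: algebra_simps power2_eq_square)
  qed
  have bD: "b s \<le> D s + K * H s" if s: "s \<in> ?I" for s
  proof -
    have i: "((\<lambda>t. us s t \<bullet> u s t) has_integral b s) \<Theta>"
      "((\<lambda>t. L s t \<bullet> u s t) has_integral D s) \<Theta>" "((\<lambda>t. u s t \<bullet> u s t) has_integral H s) \<Theta>"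
      unfolding b_def D_def H_def by (intro integrable_integral int c cL s)+
    show ?thesis
    proof (rule has_integral_le[OF i(1) has_integral_add[OF i(2) has_integral_mult_right[OF i(3)]]])
      fix t assume t: "t \<in> \<Theta>"
      have "(us s t - L s t) \<bullet> u s t \<le> norm (us s t - L s t) * norm (u s t)" by (rule norm_cauchy_schwarz)
      also have "\<dots> \<le> K * norm (u s t) * norm (u s t)"
        using K(2)[OF s t] by (intro mult_right_mono) (auto simp: L_def)
      also have "K * norm (u s t) * norm (u s t) = K * (u s t \<bullet> u s t)"
        by (simp add: dot_square_norm power2_eq_square)
      finally show "us s t \<bullet> u s t \<le> L s t \<bullet> u s t + K * (u s t \<bullet> u s t)"
        by (simp add: inner_diff_left)
    qed
  qed
  have Hnn: "H s \<ge> 0" if s: "s \<in> ?I" for s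
    unfolding H_def by (intro integral_nonneg int c s) auto
  have Hc: "continuous_on ?I H" by (rule DERIV_continuous_on[OF Hd])
  have Dc: "continuous_on ?I D" by (rule DERIV_continuous_on[OF Dd])
  have "\<not> H s2 > 0"
  proof
    assume H2: "H s2 > 0"
    let ?Z = "{s \<in> ?I. H s = 0}"
    have "closed ?Z"
      using continuous_closed_preimage_constant[OF Hc] by simp
    moreover have Zne: "s1 \<in> ?Z" using H1 s12 by (simp add: H_def)
    moreover have bZ: "bdd_above ?Z" by (auto intro: bdd_aboveI[of _ s2])
    ultimately have SZ: "Sup ?Z \<in> ?Z" using closed_contains_Sup[of ?Z] by blast
    \<comment> \<open>The last zero of H, so the frequency N is defined on all of (r, s2].\<close>
    define r where "r = Sup ?Z"
    have r: "r \<in> ?I" "H r = 0" using SZ by (auto simp: r_def)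
    then have rs: "r < s2" using H2 by (cases "r = s2") auto
    have pos: "H s > 0" if "r < s" "s \<le> s2" for s
    proof -
      have "s \<notin> ?Z" using cSup_upper[OF _ bZ, of s] that by (auto simp: r_def)
      then show ?thesis using Hnn[of s] that r by auto
    qed
    have atI: "at s within ?I = at s" if "r < s" "s < s2" for s
      using that r by (intro at_within_interior) auto
    define N where "N s = D s / H s" for s
    have Nd: "(N has_real_derivative (2 * a s - N s * (2 * b s)) / H s) (at s)" if "r < s" "s < s2" for s
    proof -
      have sI: "s \<in> ?I" and Hp: "H s > 0" using that r pos by auto
      have "(N has_real_derivative (2 * a s * H s - D s * (2 * b s)) / (H s * H s)) (at s)"
        unfolding N_def using Dd[OF sI] Hd[OF sI] Hp by (intro DERIV_divide) (auto simp: atI that)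
      moreover have "(2 * a s * H s - D s * (2 * b s)) / (H s * H s) = (2 * a s - N s * (2 * b s)) / H s"
        using Hp by (simp add: N_def field_simps)
      ultimately show ?thesis by simp
    qed
    define Nm where "Nm = N s2 + K\<^sup>2 / 2 * (s2 - r)"
    have Nb: "N s \<le> Nm" if s: "r < s" "s \<le> s2" for s
    proof -
      have "N s + K\<^sup>2 / 2 * s \<le> N s2 + K\<^sup>2 / 2 * s2"
      proof (rule DERIV_nonneg_imp_increasing_open[where f="\<lambda>s. N s + K\<^sup>2 / 2 * s"])
        have "H x \<noteq> 0" if "x \<in> {s..s2}" for x using pos[of x] that s by auto
        then show "continuous_on {s..s2} (\<lambda>s. N s + K\<^sup>2 / 2 * s)"
          unfolding N_def using s r
          by (intro continuous_intros continuous_on_subset[OF Hc] continuous_on_subset[OF Dc]) auto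
        fix x assume x: "s < x" "x < s2"
        have Hp: "H x > 0" using pos x s by auto
        have "2 * a x - N x * (2 * b x) \<ge> - (K\<^sup>2 / 2) * H x"
          by (rule key) (use x s r Hp in \<open>auto simp: N_def\<close>)
        then have "(2 * a x - N x * (2 * b x)) / H x \<ge> - (K\<^sup>2 / 2)" using Hp by (simp add: pos_le_divide_eq)
        moreover have "((\<lambda>s. N s + K\<^sup>2 / 2 * s) has_real_derivative (2 * a x - N x * (2 * b x)) / H x + K\<^sup>2 / 2) (at x)"
          using Nd[of x] x s by (auto intro!: derivative_eq_intros)
        ultimately show "\<exists>y. ((\<lambda>s. N s + K\<^sup>2 / 2 * s) has_real_derivative y) (at x) \<and> 0 \<le> y" by force
      qed (use s in auto)
      also have "\<dots> \<le> Nm + K\<^sup>2 / 2 * s"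
        using mult_left_mono[of r s "K\<^sup>2 / 2"] s by (simp add: Nm_def field_simps)
      finally show ?thesis by simp
    qed
    \<comment> \<open>H' = 2 b, so \<open>bD\<close> together with N \<le> Nm gives H' \<le> k H.
      Hence H exp(- k s) does not increase, and its zero at r contradicts H s2 > 0.\<close>
    define k where "k = 2 * (Nm + K)"
    have "H s2 * exp (- k * s2) \<le> H r * exp (- k * r)"
    proof (rule DERIV_nonpos_imp_decreasing_open[where f="\<lambda>s. H s * exp (- k * s)"])
      show "continuous_on {r..s2} (\<lambda>s. H s * exp (- k * s))"
        using r by (intro continuous_intros continuous_on_subset[OF Hc]) auto
      fix x assume x: "r < x" "x < s2"
      have xI: "x \<in> ?I" and Hp: "H x > 0" using x r pos by auto
      have "b x \<le> D x + K * H x" by (rule bD[OF xI])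
      also have "D x = N x * H x" using Hp by (simp add: N_def)
      also have "N x * H x + K * H x \<le> (Nm + K) * H x"
        using mult_right_mono[OF Nb[of x], of "H x"] x Hp by (simp add: algebra_simps)
      finally have "2 * b x - k * H x \<le> 0" by (simp add: k_def algebra_simps)
      then have "(2 * b x - k * H x) * exp (- k * x) \<le> 0" by (intro mult_nonpos_nonneg) auto
      moreover have "((\<lambda>s. H s * exp (- k * s)) has_real_derivative (2 * b x - k * H x) * exp (- k * x)) (at x)"
        using Hd[OF xI] atI[OF x] by (auto intro!: derivative_eq_intros simp: algebra_simps)
      ultimately show "\<exists>y. ((\<lambda>s. H s * exp (- k * s)) has_real_derivative y) (at x) \<and> y \<le> 0" by blast
    qed (use rs in auto)
    then show False using r(2) H2 by (simp add: mult_le_0_iff)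
  qed
  then have "H s2 = 0" using Hnn[of s2] s12 by auto
  then show ?thesis by (simp add: H_def)
qed

text \<open>In coordinates c0 + exp (s + i t), the pair U consisting of 2 a_z and a satisfies |dbar
  U| \<le> const |U|: dbar of the first entry is half the Laplacian, which |a| bounds, and dbar of
  the second entry is bounded by the first. Multiplication by twice the conjugate of exp (s + i t)
  turns dbar into d/ds + i d/dt, the operator in \<open>frequency_vanishing\<close> with J =
  multiplication by i.\<close>

lemma unique_continuation_ball:
  fixes a :: "complex \<Rightarrow> real"
  assumes S: "open S" "cball c0 R \<subseteq> S" and a: "smooth_on S a"
    and C: "\<And>p. p \<in> cball c0 R \<Longrightarrow> \<bar>pdx (pdx a) p + pdy (pdy a) p\<bar> \<le> C * \<bar>a p\<bar>"
    and e: "e > 0" "\<And>p. p \<in> ball c0 e \<Longrightarrow> a p = 0"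
    and q: "q \<in> cball c0 R"
  shows "a q = 0"
proof (cases "q \<in> ball c0 e")
  case True
  then show ?thesis using e by blast
next
  case False
  define \<rho> where "\<rho> = norm (q - c0)"
  have \<rho>: "\<rho> \<ge> e" "\<rho> \<le> R" "\<rho> > 0" using False q e(1) by (auto simp: \<rho>_def dist_norm norm_minus_commute)
  \<comment> \<open>The circle for s1 has radius e / 2 and lies in the disc where a vanishes; the
    circle for s2 passes through q.\<close>
  define s1 s2 where "s1 = ln (e / 2)" and "s2 = ln \<rho>"
  define \<zeta> where "\<zeta> s t = exp (Complex s t)" for s t :: real
  define z where "z s t = c0 + \<zeta> s t" for s t
  define U where "U p = (complex_of_real (pdx a p) - \<i> * complex_of_real (pdy a p), complex_of_real (a p))" for p
  \<comment> \<open>\<open>V f\<close> and \<open>V' f\<close> are the derivatives of f along s and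
    along t.\<close>
  define V where "V f s t = Re (\<zeta> s t) *\<^sub>R pdx f (z s t) + Im (\<zeta> s t) *\<^sub>R pdy f (z s t)"
    for f :: "complex \<Rightarrow> complex \<times> complex" and s t
  define V' where "V' f s t = - Im (\<zeta> s t) *\<^sub>R pdx f (z s t) + Re (\<zeta> s t) *\<^sub>R pdy f (z s t)"
    for f :: "complex \<Rightarrow> complex \<times> complex" and s t
  define J where "J x = (\<i> * fst x, \<i> * snd x)" for x :: "complex \<times> complex"
  note ar = smooth_on_pd[OF a]
  have Us: "smooth_on S U" unfolding U_def
    by (intro smooth_on_Pair smooth_on_diff smooth_on_linear[OF S(1) bounded_linear_of_real]
        smooth_on_linear[OF S(1) bounded_linear_mult_right] S(1) a ar)
  note Ud = smooth_on_pd[OF Us]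
  have nz: "cmod (\<zeta> s t) = exp s" for s t by (simp add: \<zeta>_def)
  have zin: "z s t \<in> cball c0 R" if "s \<le> s2" for s t
  proof -
    have "exp s \<le> exp (ln \<rho>)" using that by (simp add: s2_def)
    then show ?thesis using nz[of s t] \<rho> by (simp add: z_def dist_norm)
  qed
  have zS: "z s t \<in> S" if "s \<le> s2" for s t using zin[OF that] S(2) by blast
  have zd: "((\<lambda>s. \<zeta> s t) has_derivative (\<lambda>h. of_real h * \<zeta> s t)) (at s)"
    "((\<lambda>t. \<zeta> s t) has_derivative (\<lambda>h. of_real h * (\<i> * \<zeta> s t))) (at t)" for s t
  proof -
    have "((\<lambda>s. Complex s t) has_derivative (\<lambda>h. of_real h)) (at s)"
      "((\<lambda>t. Complex s t) has_derivative (\<lambda>h. of_real h * \<i>)) (at t)"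
      unfolding Complex_eq by (auto intro!: derivative_eq_intros)
    from this[THEN has_derivative_compose, OF DERIV_exp[unfolded has_field_derivative_def]]
    show "((\<lambda>s. \<zeta> s t) has_derivative (\<lambda>h. of_real h * \<zeta> s t)) (at s)"
      "((\<lambda>t. \<zeta> s t) has_derivative (\<lambda>h. of_real h * (\<i> * \<zeta> s t))) (at t)"
      unfolding \<zeta>_def by (simp_all add: mult_ac)
  qed
  have zd': "((\<lambda>s. z s t) has_derivative (\<lambda>h. of_real h * \<zeta> s t)) (at s)"
    "((\<lambda>t. z s t) has_derivative (\<lambda>h. of_real h * (\<i> * \<zeta> s t))) (at t)" for s t
    unfolding z_def using has_derivative_add[OF has_derivative_const zd(1)] has_derivative_add[OF has_derivative_const zd(2)]
    by simp_all
  have comp: "((\<lambda>s. f (z s t)) has_vector_derivative V f s t) (at s)"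
    "((\<lambda>t. f (z s t)) has_vector_derivative V' f s t) (at t)" if "smooth_on S f" "s \<le> s2" for f s t
  proof -
    note fd = has_derivative_pd[OF smooth_on_at[OF that(1) S(1) zS[OF that(2)]], of t]
    show "((\<lambda>s. f (z s t)) has_vector_derivative V f s t) (at s)"
      using has_derivative_compose[OF zd'(1) fd] by (simp add: has_vector_derivative_def V_def scaleR_add_right)
    show "((\<lambda>t. f (z s t)) has_vector_derivative V' f s t) (at t)"
      using has_derivative_compose[OF zd'(2) fd] by (simp add: has_vector_derivative_def V'_def scaleR_add_right scaleR_diff_right)
  qed
  have Red: "((\<lambda>s. Re (\<zeta> s t)) has_vector_derivative Re (\<zeta> s t)) (at s)"
    "((\<lambda>s. Im (\<zeta> s t)) has_vector_derivative Im (\<zeta> s t)) (at s)"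
    "((\<lambda>t. Re (\<zeta> s t)) has_vector_derivative - Im (\<zeta> s t)) (at t)"
    "((\<lambda>t. Im (\<zeta> s t)) has_vector_derivative Re (\<zeta> s t)) (at t)" for s t
    using has_derivative_Re[OF zd(1)] has_derivative_Im[OF zd(1)] has_derivative_Re[OF zd(2)] has_derivative_Im[OF zd(2)]
    by (simp_all add: has_vector_derivative_def)
  let ?ust = "\<lambda>s t. - Im (\<zeta> s t) *\<^sub>R V (pdx U) s t + - Im (\<zeta> s t) *\<^sub>R pdx U (z s t)
      + (Re (\<zeta> s t) *\<^sub>R V (pdy U) s t + Re (\<zeta> s t) *\<^sub>R pdy U (z s t))"
  note sc = bounded_bilinear.has_vector_derivative[OF bounded_bilinear_scaleR]
  have d1: "((\<lambda>s. V' U s t) has_vector_derivative ?ust s t) (at s)" if "s \<le> s2" for s t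
    unfolding V'_def
    by (intro has_vector_derivative_add sc has_vector_derivative_minus Red comp(1)[OF Ud(1) that] comp(1)[OF Ud(2) that])
  have d2: "((\<lambda>t. V U s t) has_vector_derivative ?ust s t) (at t)" if "s \<le> s2" for s t
  proof -
    have "((\<lambda>t. V U s t) has_vector_derivative Re (\<zeta> s t) *\<^sub>R V' (pdx U) s t + - Im (\<zeta> s t) *\<^sub>R pdx U (z s t)
      + (Im (\<zeta> s t) *\<^sub>R V' (pdy U) s t + Re (\<zeta> s t) *\<^sub>R pdy U (z s t))) (at t)"
      unfolding V_def
      by (intro has_vector_derivative_add sc Red comp(2)[OF Ud(1) that] comp(2)[OF Ud(2) that])
    then show ?thesis
      by (rule has_vector_derivative_eq_rhs)
        (simp add: V_def V'_def pd_commute[OF S(1) Us zS[OF that]] algebra_simps)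
  qed
  have zc: "continuous_on X (\<lambda>x. \<zeta> (fst x) (snd x))" for X
    unfolding \<zeta>_def Complex_eq by (intro continuous_intros)
  have fc: "continuous_on ({s1..s2} \<times> {0..2*pi}) (\<lambda>x. f (z (fst x) (snd x)))" if "smooth_on S f"
    for f :: "complex \<Rightarrow> complex \<times> complex"
    by (rule continuous_on_compose2[OF smooth_on_continuous_on[OF that]])
      (use zS in \<open>auto simp: z_def intro!: continuous_intros zc\<close>)
  note fcs = fc[OF Us] fc[OF Ud(1)] fc[OF Ud(2)] fc[OF smooth_on_pd(1)[OF Ud(1)]] fc[OF smooth_on_pd(1)[OF Ud(2)]]
    fc[OF smooth_on_pd(2)[OF Ud(1)]] fc[OF smooth_on_pd(2)[OF Ud(2)]]
  \<comment> \<open>rho bounds |exp (s + i t)|. Adding 1 to |C| keeps the factor at least 1, so that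
    it also covers the gradient in the second entry.\<close>
  define K where "K = \<rho> * (\<bar>C\<bar> + 1)"
  have "integral {0..2*pi} (\<lambda>t. U (z s2 t) \<bullet> U (z s2 t)) = 0"
  proof (rule frequency_vanishing[where ?s1.0=s1 and ?s2.0=s2 and u="\<lambda>s t. U (z s t)" and us="V U" and ut="V' U"
        and ust="?ust" and J=J and K=K])
    show "s1 \<le> s2" using \<rho> e by (simp add: s1_def s2_def)
    show "continuous_on ({s1..s2} \<times> {0..2*pi}) (\<lambda>x. U (z (fst x) (snd x)))" by (rule fcs)
    show "continuous_on ({s1..s2} \<times> {0..2*pi}) (\<lambda>x. V U (fst x) (snd x))"
      "continuous_on ({s1..s2} \<times> {0..2*pi}) (\<lambda>x. V' U (fst x) (snd x))"
      "continuous_on ({s1..s2} \<times> {0..2*pi}) (\<lambda>x. ?ust (fst x) (snd x))"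
      unfolding V_def V'_def by (intro continuous_intros fcs zc)+
    show "U (z s 0) = U (z s (2*pi))" "V U s 0 = V U s (2*pi)" for s
    proof -
      have "\<zeta> s 0 = \<zeta> s (2*pi)" by (simp add: \<zeta>_def exp_eq_polar cis_conv_exp[symmetric])
      then show "U (z s 0) = U (z s (2*pi))" "V U s 0 = V U s (2*pi)" by (simp_all add: z_def V_def)
    qed
    show "bounded_linear J" unfolding J_def
      by (intro bounded_linear_Pair bounded_linear_const_mult bounded_linear_fst bounded_linear_snd)
    show "J x \<bullet> y = - (x \<bullet> J y)" for x y
      by (cases x; cases y) (simp add: J_def inner_complex_def algebra_simps)
    show "K \<ge> 0" using \<rho> by (simp add: K_def)
    show "integral {0..2*pi} (\<lambda>t. U (z s1 t) \<bullet> U (z s1 t)) = 0"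
    proof -
      have "U (z s1 t) = 0" for t
      proof -
        have "exp s1 = e / 2" using e by (simp add: s1_def)
        then have zb: "z s1 t \<in> ball c0 e" using nz[of s1 t] e by (simp add: z_def dist_norm)
        have "pdx a (z s1 t) = 0" "pdy a (z s1 t) = 0"
          using pd_cong[OF open_ball zb, of a "\<lambda>_. 0"] e(2) by (auto simp: pd_const)
        then show ?thesis using e(2)[OF zb] by (simp add: U_def zero_prod_def)
      qed
      then show ?thesis by simp
    qed
    fix s t assume st: "s \<in> {s1..s2}" "t \<in> {0..2*pi}"
    then have s: "s \<le> s2" by simp
    show "((\<lambda>s. U (z s t)) has_vector_derivative V U s t) (at s within {s1..s2})"
      "((\<lambda>t. U (z s t)) has_vector_derivative V' U s t) (at t within {0..2*pi})"
      "((\<lambda>s. V' U s t) has_vector_derivative ?ust s t) (at s within {s1..s2})"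
      "((\<lambda>t. V U s t) has_vector_derivative ?ust s t) (at t within {0..2*pi})"
      using comp[OF Us s] d1[OF s] d2[OF s] has_vector_derivative_at_within by blast+
    let ?p = "z s t"
    have dd: "pdx a differentiable at ?p" "pdy a differentiable at ?p" "a differentiable at ?p"
      using smooth_on_at[OF _ S(1) zS[OF s]] a ar by blast+
    have dc: "(\<lambda>p. complex_of_real (f p)) differentiable at ?p" if "f differentiable at ?p" for f
      using has_derivative_of_real[OF has_derivative_pd[OF that]] by (auto simp: differentiable_def)
    have dm: "(\<lambda>p. \<i> * complex_of_real (f p)) differentiable at ?p" if "f differentiable at ?p" for f
      using has_derivative_mult_right[OF has_derivative_of_real[OF has_derivative_pd[OF that]]] by (auto simp: differentiable_def)
    have dD: "(\<lambda>p. complex_of_real (pdx a p) - \<i> * complex_of_real (pdy a p)) differentiable at ?p"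
      using dc dm dd differentiable_diff by blast
    have Ux: "pdx U ?p = (complex_of_real (pdx (pdx a) ?p) - \<i> * complex_of_real (pdx (pdy a) ?p), complex_of_real (pdx a ?p))"
      "pdy U ?p = (complex_of_real (pdy (pdx a) ?p) - \<i> * complex_of_real (pdy (pdy a) ?p), complex_of_real (pdy a ?p))"
      unfolding U_def using dd dc dm dD
      by (simp_all add: pd_Pair pd_diff pd_linear[OF bounded_linear_of_real]
          pd_linear[OF bounded_linear_mult_right[of \<i>]])
    have "V U s t + J (V' U s t) = (cnj (\<zeta> s t) * complex_of_real (pdx (pdx a) ?p + pdy (pdy a) ?p),
       cnj (\<zeta> s t) * Complex (pdx a ?p) (pdy a ?p))"
      unfolding V_def V'_def J_def Ux pd_commute[OF S(1) a zS[OF s]]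
      by (simp add: complex_eq_iff algebra_simps)
    also have "norm \<dots> = exp s * sqrt ((pdx (pdx a) ?p + pdy (pdy a) ?p)\<^sup>2 + ((pdx a ?p)\<^sup>2 + (pdy a ?p)\<^sup>2))"
      unfolding norm_Pair norm_mult complex_mod_cnj nz power_mult_distrib distrib_left[symmetric] real_sqrt_mult norm_of_real
      by (simp add: cmod_def)
    also have "\<dots> \<le> \<rho> * sqrt ((\<bar>C\<bar> + 1)\<^sup>2 * ((pdx a ?p)\<^sup>2 + (pdy a ?p)\<^sup>2 + (a ?p)\<^sup>2))"
    proof (intro mult_mono real_sqrt_le_mono)
      have "exp s \<le> exp s2" using s by simp
      then show "exp s \<le> \<rho>" using \<rho> by (simp add: s2_def)
      have "\<bar>pdx (pdx a) ?p + pdy (pdy a) ?p\<bar> \<le> (\<bar>C\<bar> + 1) * \<bar>a ?p\<bar>"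
        using C[OF zin[OF s], of t] mult_right_mono[of C "\<bar>C\<bar> + 1" "\<bar>a ?p\<bar>"] by linarith
      then have "(pdx (pdx a) ?p + pdy (pdy a) ?p)\<^sup>2 \<le> (\<bar>C\<bar> + 1)\<^sup>2 * (a ?p)\<^sup>2"
        by (metis abs_ge_zero power2_abs power_mono power_mult_distrib)
      moreover have "1 * ((pdx a ?p)\<^sup>2 + (pdy a ?p)\<^sup>2) \<le> (\<bar>C\<bar> + 1)\<^sup>2 * ((pdx a ?p)\<^sup>2 + (pdy a ?p)\<^sup>2)"
        by (intro mult_right_mono) (auto simp: one_le_power)
      ultimately show "(pdx (pdx a) ?p + pdy (pdy a) ?p)\<^sup>2 + ((pdx a ?p)\<^sup>2 + (pdy a ?p)\<^sup>2)
        \<le> (\<bar>C\<bar> + 1)\<^sup>2 * ((pdx a ?p)\<^sup>2 + (pdy a ?p)\<^sup>2 + (a ?p)\<^sup>2)" by (simp add: algebra_simps)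
    qed (use \<rho> in auto)
    also have "\<dots> = K * norm (U ?p)"
      unfolding real_sqrt_mult K_def U_def norm_Pair by (simp add: cmod_power2)
    finally show "norm (V U s t + J (V' U s t)) \<le> K * norm (U ?p)" .
  qed
  moreover have "continuous_on {0..2*pi} (\<lambda>t. U (z s2 t))"
  proof (rule continuous_at_imp_continuous_on, rule ballI)
    fix t show "isCont (\<lambda>t. U (z s2 t)) t"
      by (rule has_vector_derivative_continuous[OF comp(2)[OF Us order_refl]])
  qed
  \<comment> \<open>A continuous nonnegative function with integral 0 vanishes, so U is zero on the
    whole circle through q.\<close>
  ultimately have "\<forall>t\<in>{0..2*pi}. U (z s2 t) \<bullet> U (z s2 t) = 0"
    by (subst integral_eq_0_iff[symmetric]) (simp_all add: continuous_on_inner)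
  then have "U (z s2 t) = 0" if "t \<in> {0..2*pi}" for t
    using that by (simp only: inner_eq_zero_iff)
  then have U0: "a (z s2 t) = 0" if "t \<in> {0..2*pi}" for t
    using that by (auto simp: U_def zero_prod_def)
  define t where "t = Arg2pi (q - c0)"
  have "q - c0 = of_real \<rho> * exp (\<i> * of_real t)" and tt: "t \<in> {0..2*pi}"
    using Arg2pi[of "q - c0"] by (auto simp: \<rho>_def t_def is_Arg_def)
  moreover have "\<zeta> s2 t = of_real \<rho> * exp (\<i> * of_real t)"
    unfolding \<zeta>_def Complex_eq exp_add exp_of_real s2_def exp_ln[OF \<rho>(3)] ..
  ultimately have "z s2 t = q" unfolding z_def by (metis add.commute diff_add_cancel)
  then show ?thesis using U0[OF tt] by simp
qed

section \<open>Adapted frames in Lorentz space\<close>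

lemma lor3_altdef: "lor3 a b = - fst a * fst b + fst (snd a) * fst (snd b) + snd (snd a) * snd (snd b)"
  by (cases a; cases b) auto

lemma lor3_commute: "lor3 a b = lor3 b a"
  by (simp add: lor3_altdef algebra_simps)

lemma lor3_simps:
  "lor3 (a + b) c = lor3 a c + lor3 b c" "lor3 c (a + b) = lor3 c a + lor3 c b"
  "lor3 (a - b) c = lor3 a c - lor3 b c" "lor3 c (a - b) = lor3 c a - lor3 c b"
  "lor3 (r *\<^sub>R a) c = r * lor3 a c" "lor3 c (r *\<^sub>R a) = r * lor3 c a"
  "lor3 (- a) c = - lor3 a c" "lor3 c (- a) = - lor3 c a" "lor3 0 c = 0" "lor3 c 0 = 0"
  by (simp_all add: lor3_altdef algebra_simps)

lemma bounded_bilinear_lor3: "bounded_bilinear lor3"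
  unfolding bilinear_conv_bounded_bilinear[symmetric] bilinear_def linear_iff by (simp add: lor3_simps)

lemma lor4_altdef: "lor4 x y = lor3 (fst x) (fst y) + snd x * snd y"
  by (cases x; cases y) auto

text \<open>\<open>lor3 c (lcross a b)\<close> is the determinant of a, b, c. For a unit timelike a,
  \<open>lcross a\<close> is a skew isometry of the plane orthogonal to a, hence a rotation by a
  right angle there: the complex structure from which the frame is built.\<close>

fun lcross :: "L3 \<Rightarrow> L3 \<Rightarrow> L3" where
  "lcross (a0, a1, a2) (b0, b1, b2) = (a2 * b1 - a1 * b2, a2 * b0 - a0 * b2, a0 * b1 - a1 * b0)"

lemma lcross_altdef: "lcross a b = (snd (snd a) * fst (snd b) - fst (snd a) * snd (snd b),
    snd (snd a) * fst b - fst a * snd (snd b), fst a * fst (snd b) - fst (snd a) * fst b)"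
  by (cases a; cases b) auto

lemma bounded_bilinear_lcross: "bounded_bilinear lcross"
  unfolding bilinear_conv_bounded_bilinear[symmetric] bilinear_def linear_iff
  by (auto simp: lcross_altdef algebra_simps prod_eq_iff)

lemma lcross_self: "lcross a a = 0"
  by (simp add: lcross_altdef zero_prod_def)

lemma lcross_scaleR: "lcross a (r *\<^sub>R a) = 0"
  by (simp add: lcross_altdef zero_prod_def algebra_simps)

lemma lor3_lcross: "lor3 a (lcross a b) = 0" "lor3 b (lcross a b) = 0" "lor3 (lcross a b) a = 0" "lor3 (lcross a b) b = 0"
  "lor3 b (lcross a c) = - lor3 c (lcross a b)"
  by (simp_all add: lcross_altdef lor3_altdef algebra_simps)

lemma lor3_lcross_lcross: "lor3 (lcross a b) (lcross a c) = lor3 a b * lor3 a c - lor3 a a * lor3 b c"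
  by (simp add: lcross_altdef lor3_altdef algebra_simps)

text \<open>In signature (2,1) the square of a determinant is minus the Gram determinant;
  orthogonality to g splits off a factor -1 and leaves the Gram determinant of x and y.\<close>

lemma triple_product_gram:
  assumes "lor3 g g = -1" "lor3 g x = 0" "lor3 g y = 0"
  shows "(lor3 x (lcross g y))\<^sup>2 = lor3 x x * lor3 y y - (lor3 x y)\<^sup>2"
proof -
  have "(lor3 x (lcross g y))\<^sup>2 = - (lor3 g g * (lor3 x x * lor3 y y - lor3 x y * lor3 x y)
     - lor3 g x * (lor3 g x * lor3 y y - lor3 x y * lor3 g y) + lor3 g y * (lor3 g x * lor3 x y - lor3 x x * lor3 g y))"
    unfolding lor3_altdef lcross_altdef fst_conv snd_conv by algebra
  then show ?thesis using assms by (simp add: power2_eq_square)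
qed

text \<open>Pairing with g, f1, f2 recovers the coordinates, so the three vectors are independent
  and span by dimension. The minus sign at g comes from its norm -1.\<close>

lemma lor3_frame_expand:
  assumes o: "lor3 g g = -1" "lor3 f1 f1 = k" "lor3 f2 f2 = k" "lor3 g f1 = 0" "lor3 g f2 = 0" "lor3 f1 f2 = 0"
    and k: "k > 0"
  shows "X = (- lor3 X g) *\<^sub>R g + (lor3 X f1 / k) *\<^sub>R f1 + (lor3 X f2 / k) *\<^sub>R f2"
proof -
  define \<phi> where "\<phi> v = fst v *\<^sub>R g + fst (snd v) *\<^sub>R f1 + snd (snd v) *\<^sub>R f2" for v :: L3
  have lin: "linear \<phi>" by (auto simp: \<phi>_def linear_iff algebra_simps)
  have o': "lor3 f1 g = 0" "lor3 f2 g = 0" "lor3 f2 f1 = 0" using o lor3_commute by metis+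
  have co: "lor3 (\<phi> v) g = - fst v" "lor3 (\<phi> v) f1 = k * fst (snd v)" "lor3 (\<phi> v) f2 = k * snd (snd v)" for v
    unfolding \<phi>_def by (simp_all add: lor3_simps o o')
  have "inj \<phi>"
    unfolding linear_injective_0[OF lin]
  proof (intro allI impI)
    fix v assume v: "\<phi> v = 0"
    show "v = 0" using co[of v] k unfolding v by (simp add: lor3_simps prod_eq_iff)
  qed
  then have "surj \<phi>" by (rule linear_injective_imp_surjective[OF lin]) simp
  then obtain v where v: "X = \<phi> v" by blast
  show ?thesis unfolding v co using k by (simp add: \<phi>_def)
qed

lemma lor3_frame_eqI:
  assumes "lor3 g g = -1" "lor3 f1 f1 = k" "lor3 f2 f2 = k" "lor3 g f1 = 0" "lor3 g f2 = 0" "lor3 f1 f2 = 0"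
    and "k > 0" "lor3 X g = lor3 Y g" "lor3 X f1 = lor3 Y f1" "lor3 X f2 = lor3 Y f2"
  shows "X = Y"
  using lor3_frame_expand[OF assms(1-7), of X] lor3_frame_expand[OF assms(1-7), of Y] assms(8-) by metis

text \<open>Multiplied by n0^2, \<open>lor3 x x\<close> becomes a sum of squares: x0 is eliminated
  by orthogonality and Lagrange's identity is applied to the rest.\<close>

lemma lor3_spacelike:
  assumes "lor3 n n = -1" "lor3 n x = 0"
  shows "lor3 x x \<ge> 0" "lor3 x x = 0 \<Longrightarrow> x = 0"
proof -
  obtain n0 n1 n2 where n: "n = (n0, n1, n2)" by (cases n) auto
  obtain x0 x1 x2 where x: "x = (x0, x1, x2)" by (cases x) auto
  have nn: "n0\<^sup>2 = 1 + n1\<^sup>2 + n2\<^sup>2" and nx: "n0 * x0 = n1 * x1 + n2 * x2"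
    using assms by (auto simp: n x power2_eq_square)
  have "n0\<^sup>2 * lor3 x x = n0\<^sup>2 * (x1\<^sup>2 + x2\<^sup>2) - (n0 * x0)\<^sup>2"
    by (simp add: x power2_eq_square algebra_simps)
  also have "\<dots> = (1 + n1\<^sup>2 + n2\<^sup>2) * (x1\<^sup>2 + x2\<^sup>2) - (n1 * x1 + n2 * x2)\<^sup>2"
    unfolding nn nx ..
  also have "\<dots> = x1\<^sup>2 + x2\<^sup>2 + (n1 * x2 - n2 * x1)\<^sup>2" by (simp add: power2_eq_square algebra_simps)
  finally have e: "n0\<^sup>2 * lor3 x x = x1\<^sup>2 + x2\<^sup>2 + (n1 * x2 - n2 * x1)\<^sup>2" .
  have n0: "n0\<^sup>2 > 0" unfolding nn by (smt (verit) zero_le_power2)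
  have "n0\<^sup>2 * lor3 x x \<ge> 0" unfolding e by simp
  then show "lor3 x x \<ge> 0" using n0 by (simp add: zero_le_mult_iff)
  assume "lor3 x x = 0"
  then have "x1\<^sup>2 + x2\<^sup>2 + (n1 * x2 - n2 * x1)\<^sup>2 = 0" using e by simp
  then have "x1 = 0" "x2 = 0" by (smt (verit) zero_le_power2 power2_eq_iff_nonneg zero_eq_power2)+
  then show "x = 0" using nx n0 by (simp add: x zero_prod_def)
qed

section \<open>Derivatives of Lorentz products and of logarithms\<close>

lemma pd_lor3:
  assumes "f differentiable at p" "g differentiable at p"
  shows "pdx (\<lambda>q. lor3 (f q) (g q)) p = lor3 (pdx f p) (g p) + lor3 (f p) (pdx g p)"
    "pdy (\<lambda>q. lor3 (f q) (g q)) p = lor3 (pdy f p) (g p) + lor3 (f p) (pdy g p)"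
  using pd_bilinear[OF bounded_bilinear_lor3 assms] .

text \<open>The usual way to reach derivatives below: a product whose value is known on S is
  differentiated, which gives a linear relation between products of derivatives.\<close>

lemma lor3_pd_eq:
  assumes "open S" "p \<in> S" "smooth_on S f" "smooth_on S g" "\<And>q. q \<in> S \<Longrightarrow> lor3 (f q) (g q) = \<phi> q"
  shows "lor3 (pdx f p) (g p) + lor3 (f p) (pdx g p) = pdx \<phi> p"
    "lor3 (pdy f p) (g p) + lor3 (f p) (pdy g p) = pdy \<phi> p"
  using pd_lor3[of f p g] smooth_on_at[OF assms(3,1,2)] smooth_on_at[OF assms(4,1,2)]
    pd_cong[OF assms(1,2), of "\<lambda>q. lor3 (f q) (g q)" \<phi>] assms(5) by auto

lemma smooth_on_lor3: "open S \<Longrightarrow> smooth_on S f \<Longrightarrow> smooth_on S g \<Longrightarrow> smooth_on S (\<lambda>q. lor3 (f q) (g q))"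
  by (rule smooth_on_bilinear[OF _ bounded_bilinear_lor3])

lemma smooth_on_scaleR: "open S \<Longrightarrow> smooth_on S f \<Longrightarrow> smooth_on S g \<Longrightarrow> smooth_on S (\<lambda>q. f q *\<^sub>R g q)"
  by (rule smooth_on_bilinear[OF _ bounded_bilinear_scaleR])

lemma smooth_on_lcross: "open S \<Longrightarrow> smooth_on S f \<Longrightarrow> smooth_on S g \<Longrightarrow> smooth_on S (\<lambda>q. lcross (f q) (g q))"
  by (rule smooth_on_bilinear[OF _ bounded_bilinear_lcross])

lemmas smooth_intros = smooth_on_const smooth_on_add smooth_on_diff smooth_on_mult smooth_on_scaleR
  smooth_on_lor3 smooth_on_lcross smooth_on_Pair smooth_on_pd

lemma pd_ln_laplacian:
  fixes m :: "complex \<Rightarrow> real"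
  assumes "open S" "p \<in> S" "smooth_on S m" "\<And>q. q \<in> S \<Longrightarrow> m q > 0"
  shows "pdx (pdx (\<lambda>q. ln (m q))) p + pdy (pdy (\<lambda>q. ln (m q))) p =
    (pdx (pdx m) p + pdy (pdy m) p) / m p - ((pdx m p)\<^sup>2 + (pdy m p)\<^sup>2) / (m p)\<^sup>2"
proof -
  have d: "m differentiable at q" "pdx m differentiable at q" "pdy m differentiable at q" if "q \<in> S" for q
    using smooth_on_at[OF _ assms(1) that] assms(3) smooth_on_pd by blast+
  have m0: "m p > 0" using assms by blast
  have inv: "(inverse has_real_derivative - inverse ((m p)\<^sup>2)) (at (m p))"
    using m0 by (auto intro!: derivative_eq_intros simp: power2_eq_square)
  note iv = pd_real_comp[OF inv d(1)[OF assms(2)]]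
  have "pdx (pdx (\<lambda>q. ln (m q))) p = pdx (\<lambda>q. pdx m q * inverse (m q)) p"
    by (rule pd_cong[OF assms(1,2)]) (use pd_ln[OF d(1)] assms(4) in \<open>auto simp: divide_inverse\<close>)
  also have "\<dots> = pdx (pdx m) p * inverse (m p) + pdx m p * (- inverse ((m p)\<^sup>2) * pdx m p)"
    using pd_bilinear(1)[OF bounded_bilinear_mult d(2)[OF assms(2)] iv(3)] iv by simp
  finally have x: "pdx (pdx (\<lambda>q. ln (m q))) p = \<dots>" .
  have "pdy (pdy (\<lambda>q. ln (m q))) p = pdy (\<lambda>q. pdy m q * inverse (m q)) p"
    by (rule pd_cong[OF assms(1,2)]) (use pd_ln[OF d(1)] assms(4) in \<open>auto simp: divide_inverse\<close>)
  also have "\<dots> = pdy (pdy m) p * inverse (m p) + pdy m p * (- inverse ((m p)\<^sup>2) * pdy m p)"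
    using pd_bilinear(2)[OF bounded_bilinear_mult d(3)[OF assms(2)] iv(3)] iv by simp
  finally have y: "pdy (pdy (\<lambda>q. ln (m q))) p = \<dots>" .
  show ?thesis unfolding x y using m0 by (simp add: field_simps power2_eq_square)
qed

text \<open>In complex notation \<open>F = f1 - \<i> f2\<close> is isotropic, orthogonal to \<open>G\<close>, with \<open>\<langle>F, F-bar\<rangle> = m\<close>, and
  \<open>G\<^sub>z = F/2 - (Q/m) F-bar\<close> for \<open>Q = q1 + \<i> q2\<close>: the adapted frame of a spacelike surface of constant mean
  curvature in \<open>L\<^sup>3\<close> with Gauss map \<open>G\<close>.\<close>
locale gauss_frame =
  fixes S :: "complex set" and G f1 f2 :: "complex \<Rightarrow> L3" and q1 q2 m :: "complex \<Rightarrow> real"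
  assumes S: "open S"
    and smooth: "smooth_on S G" "smooth_on S f1" "smooth_on S f2" "smooth_on S q1" "smooth_on S q2" "smooth_on S m"
    and m_pos: "p \<in> S \<Longrightarrow> m p > 0"
    and orth: "p \<in> S \<Longrightarrow> lor3 (G p) (G p) = -1" "p \<in> S \<Longrightarrow> lor3 (f1 p) (f1 p) = m p / 2"
      "p \<in> S \<Longrightarrow> lor3 (f2 p) (f2 p) = m p / 2" "p \<in> S \<Longrightarrow> lor3 (G p) (f1 p) = 0"
      "p \<in> S \<Longrightarrow> lor3 (G p) (f2 p) = 0" "p \<in> S \<Longrightarrow> lor3 (f1 p) (f2 p) = 0"
    and dG: "p \<in> S \<Longrightarrow> lor3 (f1 p) (pdx G p) = m p / 2 - q1 p" "p \<in> S \<Longrightarrow> lor3 (f1 p) (pdy G p) = q2 p"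
      "p \<in> S \<Longrightarrow> lor3 (f2 p) (pdx G p) = q2 p" "p \<in> S \<Longrightarrow> lor3 (f2 p) (pdy G p) = m p / 2 + q1 p"
    and closed: "p \<in> S \<Longrightarrow> pdy f1 p = pdx f2 p"
begin

lemma orth':
  assumes "p \<in> S"
  shows "lor3 (f1 p) (G p) = 0" "lor3 (f2 p) (G p) = 0" "lor3 (f2 p) (f1 p) = 0"
  using orth[OF assms] lor3_commute by metis+

lemma expand:
  assumes "p \<in> S"
  shows "X = (- lor3 X (G p)) *\<^sub>R G p + (2 * lor3 X (f1 p) / m p) *\<^sub>R f1 p + (2 * lor3 X (f2 p) / m p) *\<^sub>R f2 p"
  using lor3_frame_expand[OF orth[OF assms], of X] m_pos[OF assms] by (simp add: mult.commute)

lemma eqI: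
  assumes "p \<in> S" "lor3 X (G p) = lor3 Y (G p)" "lor3 X (f1 p) = lor3 Y (f1 p)" "lor3 X (f2 p) = lor3 Y (f2 p)"
  shows "X = Y"
  using lor3_frame_eqI[OF orth[OF assms(1)] _ assms(2-)] m_pos[OF assms(1)] by simp

lemma G_pd_orth: "p \<in> S \<Longrightarrow> lor3 (pdx G p) (G p) = 0" "p \<in> S \<Longrightarrow> lor3 (pdy G p) (G p) = 0"
  using lor3_pd_eq[OF S _ smooth(1,1), of p "\<lambda>_. -1"] orth(1) by (simp_all add: pd_const lor3_commute[of "G p" "pdx G p"] lor3_commute[of "G p" "pdy G p"])

lemma G_pd:
  assumes "p \<in> S"
  shows "pdx G p = (1 - 2 * q1 p / m p) *\<^sub>R f1 p + (2 * q2 p / m p) *\<^sub>R f2 p"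
    "pdy G p = (2 * q2 p / m p) *\<^sub>R f1 p + (1 + 2 * q1 p / m p) *\<^sub>R f2 p"
  using expand[OF assms, of "pdx G p"] expand[OF assms, of "pdy G p"] G_pd_orth[OF assms] dG[OF assms] m_pos[OF assms]
  lor3_commute[of "f1 p"] lor3_commute[of "f2 p"]
  by (simp_all add: diff_divide_distrib add_divide_distrib)

text \<open>As for a Levi-Civita connection, the differentiated orthogonality relations determine
  all products, with \<open>closed\<close> in the place of vanishing torsion.\<close>

lemma f_pd_lor3:
  assumes "p \<in> S"
  shows "lor3 (pdx f1 p) (G p) = - (m p / 2 - q1 p)" "lor3 (pdx f1 p) (f1 p) = pdx m p / 4"
    "lor3 (pdx f1 p) (f2 p) = - pdy m p / 4"
    "lor3 (pdx f2 p) (G p) = - q2 p" "lor3 (pdx f2 p) (f1 p) = pdy m p / 4" "lor3 (pdx f2 p) (f2 p) = pdx m p / 4"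
    "lor3 (pdy f2 p) (G p) = - (m p / 2 + q1 p)" "lor3 (pdy f2 p) (f1 p) = - pdx m p / 4"
    "lor3 (pdy f2 p) (f2 p) = pdy m p / 4"
proof -
  have mh: "pdx (\<lambda>q. m q / 2) p = pdx m p / 2" "pdy (\<lambda>q. m q / 2) p = pdy m p / 2"
    using pd_linear[OF bounded_linear_divide[of 2] smooth_on_at[OF smooth(6) S assms]] by auto
  note c = lor3_commute
  note e1 = lor3_pd_eq[OF S assms smooth(2,2) orth(2), unfolded mh]
    and e2 = lor3_pd_eq[OF S assms smooth(3,3) orth(3), unfolded mh]
    and e3 = lor3_pd_eq[OF S assms smooth(2,1) orth'(1), unfolded pd_const]
    and e4 = lor3_pd_eq[OF S assms smooth(3,1) orth'(2), unfolded pd_const]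
    and e5 = lor3_pd_eq[OF S assms smooth(2,3) orth(6), unfolded pd_const]
  show "lor3 (pdx f1 p) (G p) = - (m p / 2 - q1 p)" using e3(1) dG[OF assms] by simp
  show "lor3 (pdx f1 p) (f1 p) = pdx m p / 4" using e1(1) c[of "f1 p" "pdx f1 p"] by simp
  show "lor3 (pdx f2 p) (G p) = - q2 p" using e4(1) dG[OF assms] by simp
  show 1: "lor3 (pdx f2 p) (f1 p) = pdy m p / 4"
    using e1(2) c[of "f1 p" "pdy f1 p"] by (simp add: closed[OF assms])
  then show "lor3 (pdx f1 p) (f2 p) = - pdy m p / 4" using e5(1) c[of "f1 p" "pdx f2 p"] by simp
  show 2: "lor3 (pdx f2 p) (f2 p) = pdx m p / 4" using e2(1) c[of "f2 p" "pdx f2 p"] by simp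
  show "lor3 (pdy f2 p) (G p) = - (m p / 2 + q1 p)" using e4(2) dG[OF assms] by simp
  show "lor3 (pdy f2 p) (f1 p) = - pdx m p / 4"
    using e5(2) 2 c[of "f1 p" "pdy f2 p"] by (simp add: closed[OF assms])
  show "lor3 (pdy f2 p) (f2 p) = pdy m p / 4" using e2(2) c[of "f2 p" "pdy f2 p"] by simp
qed

lemma f_pd:
  assumes "p \<in> S"
  shows "pdx f1 p = (m p / 2 - q1 p) *\<^sub>R G p + (pdx m p / (2 * m p)) *\<^sub>R f1 p - (pdy m p / (2 * m p)) *\<^sub>R f2 p"
    "pdx f2 p = q2 p *\<^sub>R G p + (pdy m p / (2 * m p)) *\<^sub>R f1 p + (pdx m p / (2 * m p)) *\<^sub>R f2 p"
    "pdy f1 p = q2 p *\<^sub>R G p + (pdy m p / (2 * m p)) *\<^sub>R f1 p + (pdx m p / (2 * m p)) *\<^sub>R f2 p"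
    "pdy f2 p = (m p / 2 + q1 p) *\<^sub>R G p - (pdx m p / (2 * m p)) *\<^sub>R f1 p + (pdy m p / (2 * m p)) *\<^sub>R f2 p"
  using expand[OF assms, of "pdx f1 p"] expand[OF assms, of "pdx f2 p"] expand[OF assms, of "pdy f2 p"]
    f_pd_lor3[OF assms] closed[OF assms] by simp_all

text \<open>The Gauss equation of the frame: \<open>closed\<close> and commuting derivatives give
  \<open>pdy (pdx f1) p = pdx (pdx f2) p\<close>, and both sides are paired with f2.\<close>

lemma laplacian_m:
  assumes "p \<in> S"
  shows "pdx (pdx m) p + pdy (pdy m) p =
    ((pdx m p)\<^sup>2 + (pdy m p)\<^sup>2) / m p + (m p)\<^sup>2 - 4 * ((q1 p)\<^sup>2 + (q2 p)\<^sup>2)"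
proof -
  note s = smooth_on_pd[OF smooth(2)] smooth_on_pd[OF smooth(3)] smooth_on_pd[OF smooth(6)]
  have d4: "pdx (\<lambda>q. pdx m q / 4) p = pdx (pdx m) p / 4" "pdy (\<lambda>q. - pdy m q / 4) p = - pdy (pdy m) p / 4"
    using pd_linear(1)[OF bounded_linear_divide[of 4] smooth_on_at[OF s(5) S assms]]
      pd_linear(2)[OF bounded_linear_minus[OF bounded_linear_divide[of 4]] smooth_on_at[OF s(6) S assms]] by auto
  have e1: "lor3 (pdy (pdx f1) p) (f2 p) + lor3 (pdx f1 p) (pdy f2 p) = - pdy (pdy m) p / 4"
    using lor3_pd_eq(2)[OF S assms s(1) smooth(3) f_pd_lor3(3)] unfolding d4 .
  have e2: "lor3 (pdx (pdx f2) p) (f2 p) + lor3 (pdx f2 p) (pdx f2 p) = pdx (pdx m) p / 4"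
    using lor3_pd_eq(1)[OF S assms s(3) smooth(3) f_pd_lor3(6)] unfolding d4 .
  have "pdy (pdx f1) p = pdx (pdy f1) p" by (rule pd_commute[OF S smooth(2) assms, symmetric])
  also have "\<dots> = pdx (pdx f2) p" by (rule pd_cong[OF S assms closed])
  finally have "pdx (pdx m) p / 4 + pdy (pdy m) p / 4 = lor3 (pdx f2 p) (pdx f2 p) - lor3 (pdx f1 p) (pdy f2 p)"
    using e1 e2 by simp
  then have "pdx (pdx m) p + pdy (pdy m) p = 4 * lor3 (pdx f2 p) (pdx f2 p) - 4 * lor3 (pdx f1 p) (pdy f2 p)"
    by simp
  also have "\<dots> = ((pdx m p)\<^sup>2 + (pdy m p)\<^sup>2) / m p + (m p)\<^sup>2 - 4 * ((q1 p)\<^sup>2 + (q2 p)\<^sup>2)"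
    unfolding f_pd[OF assms] using m_pos[OF assms]
    by (simp add: lor3_simps orth[OF assms] orth'[OF assms] field_simps power2_eq_square)
  finally show ?thesis .
qed

lemma laplacian_ln_m:
  assumes "p \<in> S"
  shows "pdx (pdx (\<lambda>q. ln (m q))) p + pdy (pdy (\<lambda>q. ln (m q))) p = m p - 4 * ((q1 p)\<^sup>2 + (q2 p)\<^sup>2) / m p"
proof -
  have "a / m p - g / (m p)\<^sup>2 = m p - k / m p" if "a = g / m p + (m p)\<^sup>2 - k" for a g k
    unfolding that using m_pos[OF assms] by (simp add: field_simps power2_eq_square)
  then show ?thesis
    using pd_ln_laplacian[OF S assms smooth(6) m_pos] laplacian_m[OF assms] by simp
qed

end

section \<open>The frame of a harmonic map with Weierstrass data\<close>

text \<open>Together with \<open>hopf_im\<close> the real and imaginary part of Q = - <G_z,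
  G_z>.\<close>

definition hopf_re :: "(complex \<Rightarrow> L3) \<Rightarrow> complex \<Rightarrow> real" where
  "hopf_re G p = (lor3 (pdy G p) (pdy G p) - lor3 (pdx G p) (pdx G p)) / 4"

definition hopf_im :: "(complex \<Rightarrow> L3) \<Rightarrow> complex \<Rightarrow> real" where
  "hopf_im G p = lor3 (pdx G p) (pdy G p) / 2"

text \<open>With \<open>frame2\<close>, for sigma = 1 or -1: f1 - i f2 is twice the component of G_z
  in the eigenline of \<open>lcross (G p)\<close> with eigenvalue sigma i. Eigenlines of a rotation
  are isotropic, which makes f1 and f2 orthogonal and equally long.\<close>

definition frame1 :: "real \<Rightarrow> (complex \<Rightarrow> L3) \<Rightarrow> complex \<Rightarrow> L3" where
  "frame1 \<sigma> G p = (1 / 2) *\<^sub>R (pdx G p - \<sigma> *\<^sub>R lcross (G p) (pdy G p))"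

definition frame2 :: "real \<Rightarrow> (complex \<Rightarrow> L3) \<Rightarrow> complex \<Rightarrow> L3" where
  "frame2 \<sigma> G p = (1 / 2) *\<^sub>R (pdy G p + \<sigma> *\<^sub>R lcross (G p) (pdx G p))"

text \<open>Half of |dG|^2 minus sigma times a signed Jacobian of G; for sigma = 1 or -1 also twice
  the common squared length of \<open>frame1\<close> and \<open>frame2\<close>.\<close>

definition frame_norm :: "real \<Rightarrow> (complex \<Rightarrow> L3) \<Rightarrow> complex \<Rightarrow> real" where
  "frame_norm \<sigma> G p = (lor3 (pdx G p) (pdx G p) + lor3 (pdy G p) (pdy G p)) / 2
     - \<sigma> * lor3 (pdx G p) (lcross (G p) (pdy G p))"

locale harmonic_map =
  fixes S :: "complex set" and G :: "complex \<Rightarrow> L3"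
  assumes S: "open S" and harm: "harmonic_H2 S G"
begin

lemma G_smooth: "smooth_on S G"
  using harm by (simp add: harmonic_H2_def)

lemma G_unit: "p \<in> S \<Longrightarrow> lor3 (G p) (G p) = -1"
  using harm by (auto simp: harmonic_H2_def H2_def)

lemma G_orth:
  assumes "p \<in> S"
  shows "lor3 (G p) (pdx G p) = 0" "lor3 (G p) (pdy G p) = 0"
  using lor3_pd_eq[OF S assms G_smooth G_smooth G_unit]
  by (simp_all add: pd_const lor3_commute[of "pdx G p" "G p"] lor3_commute[of "pdy G p" "G p"])

lemma G_laplacian:
  assumes "p \<in> S"
  obtains c where "pdx (pdx G) p + pdy (pdy G) p = c *\<^sub>R G p"
  using harm assms by (auto simp: harmonic_H2_def)

lemma pd_smooth: "smooth_on S (pdx G)" "smooth_on S (pdy G)"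
  using G_smooth smooth_on_pd by blast+

lemma smooth_frame:
  "smooth_on S (hopf_re G)" "smooth_on S (hopf_im G)" "smooth_on S (frame1 \<sigma> G)" "smooth_on S (frame2 \<sigma> G)"
  "smooth_on S (frame_norm \<sigma> G)"
proof -
  have dv: "smooth_on S (\<lambda>p. f p / c)" if "smooth_on S f" for f :: "complex \<Rightarrow> real" and c
    using smooth_on_linear[OF S bounded_linear_divide that] .
  show "smooth_on S (hopf_re G)" "smooth_on S (hopf_im G)" "smooth_on S (frame1 \<sigma> G)" "smooth_on S (frame2 \<sigma> G)"
    "smooth_on S (frame_norm \<sigma> G)"
    unfolding hopf_re_def[abs_def] hopf_im_def[abs_def] frame1_def[abs_def] frame2_def[abs_def] frame_norm_def[abs_def]
    by (intro smooth_intros dv S G_smooth)+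
qed

text \<open>The Laplacian of G is a multiple of G, hence orthogonal to G_x and G_y. This is the
  holomorphy of the Hopf differential of a harmonic map.\<close>

lemma hopf_cauchy_riemann:
  assumes p: "p \<in> S"
  shows "pdx (hopf_re G) p = pdy (hopf_im G) p" "pdy (hopf_re G) p = - pdx (hopf_im G) p"
proof -
  obtain c where c: "pdx (pdx G) p + pdy (pdy G) p = c *\<^sub>R G p" using G_laplacian[OF p] .
  have d: "pdx G differentiable at p" "pdy G differentiable at p"
    using smooth_on_at[OF _ S p] pd_smooth by blast+
  have dl: "(\<lambda>q. lor3 (f q) (g q)) differentiable at p" if "smooth_on S f" "smooth_on S g" for f g
    using smooth_on_at[OF smooth_on_lor3[OF S that] S p] .
  note dls = dl[OF pd_smooth(1) pd_smooth(1)] dl[OF pd_smooth(2) pd_smooth(2)] dl[OF pd_smooth]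
  have dd: "(\<lambda>q. lor3 (pdy G q) (pdy G q) - lor3 (pdx G q) (pdx G q)) differentiable at p"
    using dls by (intro differentiable_diff)
  note ex = pd_linear[OF bounded_linear_divide dd, of 4] pd_diff[OF dls(2,1)] pd_linear[OF bounded_linear_divide dls(3), of 2]
    pd_lor3[OF d(1,1)] pd_lor3[OF d(2,2)] pd_lor3[OF d]
  have cm: "pdx (pdy G) p = pdy (pdx G) p" by (rule pd_commute[OF S G_smooth p])
  have e: "lor3 (pdx (pdx G) p) X + lor3 (pdy (pdy G) p) X = c * lor3 (G p) X" for X
    using arg_cong[OF c, of "\<lambda>Y. lor3 Y X"] by (simp add: lor3_simps)
  note cc = lor3_commute[of "pdx G p"] lor3_commute[of "pdy G p" "pdy (pdy G) p"] lor3_commute[of "pdy G p" "pdy (pdx G) p"]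
  show "pdx (hopf_re G) p = pdy (hopf_im G) p"
    unfolding hopf_re_def[abs_def] hopf_im_def[abs_def] ex cm
    using e[of "pdx G p"] G_orth[OF p] cc by (simp add: field_simps)
  show "pdy (hopf_re G) p = - pdx (hopf_im G) p"
    unfolding hopf_re_def[abs_def] hopf_im_def[abs_def] ex cm
    using e[of "pdy G p"] G_orth[OF p] cc by (simp add: field_simps)
qed

text \<open>The terms with two first derivatives are cross products of a vector with itself. What is
  left differs by a multiple of G crossed with its Laplacian, which harmonicity makes zero.\<close>

lemma frame_closed:
  assumes p: "p \<in> S"
  shows "pdy (frame1 \<sigma> G) p = pdx (frame2 \<sigma> G) p"
proof -
  obtain c where c: "pdx (pdx G) p + pdy (pdy G) p = c *\<^sub>R G p" using G_laplacian[OF p] .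
  have d: "G differentiable at p" "pdx G differentiable at p" "pdy G differentiable at p"
    using smooth_on_at[OF _ S p] pd_smooth G_smooth by blast+
  have dc: "(\<lambda>q. lcross (G q) (g q)) differentiable at p" "(\<lambda>q. \<sigma> *\<^sub>R lcross (G q) (g q)) differentiable at p"
    if "smooth_on S g" for g
    using smooth_on_at[OF smooth_on_lcross[OF S G_smooth that] S p]
      smooth_on_at[OF smooth_on_scaleR[OF S smooth_on_const smooth_on_lcross[OF S G_smooth that]] S p] .
  note dx = dc[OF pd_smooth(1)] and dy = dc[OF pd_smooth(2)]
  have 1: "pdy (frame1 \<sigma> G) p = (1 / 2) *\<^sub>R (pdy (pdx G) p - \<sigma> *\<^sub>R lcross (G p) (pdy (pdy G) p))"
    unfolding frame1_def[abs_def] pd_linear(2)[OF bounded_linear_scaleR_right differentiable_diff[OF d(2) dy(2)]]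
      pd_diff[OF d(2) dy(2)] pd_linear(2)[OF bounded_linear_scaleR_right dy(1)]
      pd_bilinear[OF bounded_bilinear_lcross d(1) d(3)] by (simp add: lcross_self)
  have 2: "pdx (frame2 \<sigma> G) p = (1 / 2) *\<^sub>R (pdx (pdy G) p + \<sigma> *\<^sub>R lcross (G p) (pdx (pdx G) p))"
    unfolding frame2_def[abs_def] pd_linear(1)[OF bounded_linear_scaleR_right differentiable_add[OF d(3) dx(2)]]
      pd_add[OF d(3) dx(2)] pd_linear(1)[OF bounded_linear_scaleR_right dx(1)]
      pd_bilinear[OF bounded_bilinear_lcross d(1) d(2)] by (simp add: lcross_self)
  have "lcross (G p) (pdx (pdx G) p) + lcross (G p) (pdy (pdy G) p) = 0"
    using arg_cong[OF c, of "lcross (G p)"]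
    by (simp add: bounded_bilinear.add_right[OF bounded_bilinear_lcross] lcross_scaleR)
  then have "lcross (G p) (pdx (pdx G) p) = - lcross (G p) (pdy (pdy G) p)" by (simp add: eq_neg_iff_add_eq_0)
  then show ?thesis unfolding 1 2 pd_commute[OF S G_smooth p] by simp
qed

text \<open>All products follow from \<open>lcross (G p)\<close> being a skew isometry of the
  tangent plane and from sigma^2 = 1.\<close>

lemma gauss_frame_frame:
  assumes \<sigma>: "\<sigma> = 1 \<or> \<sigma> = -1" and T: "open T" "T \<subseteq> S" and pos: "\<And>p. p \<in> T \<Longrightarrow> frame_norm \<sigma> G p > 0"
  shows "gauss_frame T G (frame1 \<sigma> G) (frame2 \<sigma> G) (hopf_re G) (hopf_im G) (frame_norm \<sigma> G)"
proof
  show "open T" by fact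
  show "smooth_on T G" "smooth_on T (frame1 \<sigma> G)" "smooth_on T (frame2 \<sigma> G)" "smooth_on T (hopf_re G)"
    "smooth_on T (hopf_im G)" "smooth_on T (frame_norm \<sigma> G)"
    using smooth_on_subset[OF _ T(2)] G_smooth smooth_frame by blast+
  fix p assume "p \<in> T"
  then have p: "p \<in> S" using T by blast
  have s2: "\<sigma> * \<sigma> = 1" "\<sigma> * (\<sigma> * x) = x" for x using \<sigma> by auto
  note o = G_unit[OF p] G_orth[OF p]
  note o' = o(2,3)[unfolded lor3_commute[of "G p"]]
  have cy: "lor3 (pdy G p) (lcross (G p) (pdx G p)) = - lor3 (pdx G p) (lcross (G p) (pdy G p))"
    by (rule lor3_lcross(5))
  have cm: "lor3 (lcross (G p) X) Y = lor3 Y (lcross (G p) X)" for X Y by (rule lor3_commute)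
  have yx: "lor3 (pdy G p) (pdx G p) = lor3 (pdx G p) (pdy G p)" by (rule lor3_commute)
  note df = frame1_def frame2_def frame_norm_def hopf_re_def hopf_im_def
  show "frame_norm \<sigma> G p > 0" using pos \<open>p \<in> T\<close> by blast
  show "lor3 (G p) (G p) = -1" by (rule o)
  show "lor3 (frame1 \<sigma> G p) (frame1 \<sigma> G p) = frame_norm \<sigma> G p / 2"
    "lor3 (frame2 \<sigma> G p) (frame2 \<sigma> G p) = frame_norm \<sigma> G p / 2"
    "lor3 (G p) (frame1 \<sigma> G p) = 0" "lor3 (G p) (frame2 \<sigma> G p) = 0"
    "lor3 (frame1 \<sigma> G p) (frame2 \<sigma> G p) = 0"
    "lor3 (frame1 \<sigma> G p) (pdx G p) = frame_norm \<sigma> G p / 2 - hopf_re G p"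
    "lor3 (frame1 \<sigma> G p) (pdy G p) = hopf_im G p"
    "lor3 (frame2 \<sigma> G p) (pdx G p) = hopf_im G p"
    "lor3 (frame2 \<sigma> G p) (pdy G p) = frame_norm \<sigma> G p / 2 + hopf_re G p"
    unfolding df
    by (simp_all add: lor3_simps lor3_lcross_lcross o o' lor3_lcross(1-4) cm cy yx s2 field_simps)
  show "pdy (frame1 \<sigma> G) p = pdx (frame2 \<sigma> G) p" by (rule frame_closed[OF p])
qed

text \<open>The Jacobian terms cancel in the sum. The product is a difference of two squares, and
  the squared Jacobian is the Gram determinant of G_x and G_y.\<close>

lemma frame_norm_sum_prod:
  assumes p: "p \<in> S"
  shows "frame_norm 1 G p + frame_norm (-1) G p = lor3 (pdx G p) (pdx G p) + lor3 (pdy G p) (pdy G p)"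
    "frame_norm 1 G p * frame_norm (-1) G p = 4 * ((hopf_re G p)\<^sup>2 + (hopf_im G p)\<^sup>2)"
proof -
  show "frame_norm 1 G p + frame_norm (-1) G p = lor3 (pdx G p) (pdx G p) + lor3 (pdy G p) (pdy G p)"
    by (simp add: frame_norm_def)
  have "frame_norm 1 G p * frame_norm (-1) G p = ((lor3 (pdx G p) (pdx G p) + lor3 (pdy G p) (pdy G p)) / 2)\<^sup>2
     - (lor3 (pdx G p) (lcross (G p) (pdy G p)))\<^sup>2"
    by (simp add: frame_norm_def power2_eq_square algebra_simps)
  also have "\<dots> = 4 * ((hopf_re G p)\<^sup>2 + (hopf_im G p)\<^sup>2)"
    unfolding triple_product_gram[OF G_unit[OF p] G_orth[OF p]] hopf_re_def hopf_im_def
    by (simp add: power2_eq_square field_simps)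
  finally show "frame_norm 1 G p * frame_norm (-1) G p = 4 * ((hopf_re G p)\<^sup>2 + (hopf_im G p)\<^sup>2)" .
qed

end

text \<open>Used to bound m - tau by ln m - ln tau, the function to which unique continuation is
  applied. Both cases come from ln x \<le> x - 1.\<close>

lemma abs_diff_le_ln:
  fixes x y :: real
  assumes "x > 0" "y > 0"
  shows "\<bar>x - y\<bar> \<le> (x + y) * \<bar>ln x - ln y\<bar>"
proof -
  have *: "a - b \<le> (a + b) * (ln a - ln b)" if "a \<ge> b" "b > 0" for a b :: real
  proof -
    have "ln (b / a) \<le> b / a - 1" using that by (intro ln_le_minus_one) auto
    then have "a * (ln b - ln a) \<le> a * (b / a - 1)" using that by (intro mult_left_mono) (auto simp: ln_div)
    also have "\<dots> = b - a" using that by (simp add: field_simps)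
    finally have "a - b \<le> a * (ln a - ln b)" by (simp add: algebra_simps)
    moreover have "0 \<le> b * (ln a - ln b)" using that by simp
    ultimately show ?thesis by (simp add: algebra_simps)
  qed
  show ?thesis
  proof (cases "x \<ge> y")
    case True
    then show ?thesis using *[of y x] assms by simp
  next
    case False
    then show ?thesis using *[of x y] assms by (simp add: add.commute)
  qed
qed

section \<open>One sign of the frame for the whole domain\<close>

locale weierstrass_map = harmonic_map +
  fixes Q :: "complex \<Rightarrow> complex" and tau :: "complex \<Rightarrow> real"
  assumes wd: "weierstrass_data S G (\<lambda>p. - Q p) (\<lambda>p. 2 * tau p)"
begin

lemma tau_pos: "p \<in> S \<Longrightarrow> tau p > 0"
  using wd by (auto simp: weierstrass_data_def)

lemma tau_smooth: "smooth_on S tau"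
proof -
  have "smooth_on S (\<lambda>p. 2 * tau p / 2)"
    using wd smooth_on_linear[OF S bounded_linear_divide[of 2], of "\<lambda>p. 2 * tau p"]
    by (simp add: weierstrass_data_def)
  then show ?thesis by simp
qed

lemma Q_eq: "p \<in> S \<Longrightarrow> Q p = Complex (hopf_re G p) (hopf_im G p)"
proof -
  assume "p \<in> S"
  then have "- Q p = GzGz G p" using wd by (auto simp: weierstrass_data_def)
  then show ?thesis by (simp add: GzGz_def hopf_re_def hopf_im_def complex_eq_iff minus_equation_iff[of "Q p"])
qed

text \<open>Multiplied by tau, the Weierstrass condition says by Vieta's formulas that tau is a root
  of the quadratic whose roots are the two norms. Which root it is may still depend on the
  point.\<close>

lemma frame_norm_cases:
  assumes p: "p \<in> S"
  shows "frame_norm 1 G p = tau p \<or> frame_norm (-1) G p = tau p"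
proof -
  have "2 * GzGzb G p = tau p / 2 + 2 * (cmod (Q p))\<^sup>2 / tau p"
    using wd p by (auto simp: weierstrass_data_def)
  then have "lor3 (pdx G p) (pdx G p) + lor3 (pdy G p) (pdy G p) = tau p + 4 * ((hopf_re G p)\<^sup>2 + (hopf_im G p)\<^sup>2) / tau p"
    using tau_pos[OF p] by (simp add: GzGzb_def Q_eq[OF p] cmod_power2 field_simps)
  with frame_norm_sum_prod[OF p]
  have "frame_norm 1 G p + frame_norm (-1) G p = tau p + frame_norm 1 G p * frame_norm (-1) G p / tau p" by simp
  then have "(frame_norm 1 G p - tau p) * (frame_norm (-1) G p - tau p) = 0"
    using tau_pos[OF p] by (simp add: field_simps)
  then show ?thesis by simp
qed

lemma gauss_frame_tau:
  assumes "\<sigma> = 1 \<or> \<sigma> = -1" "open T" "T \<subseteq> S" "\<And>p. p \<in> T \<Longrightarrow> frame_norm \<sigma> G p = tau p"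
  shows "gauss_frame T G (frame1 \<sigma> G) (frame2 \<sigma> G) (hopf_re G) (hopf_im G) tau"
proof -
  interpret gauss_frame T G "frame1 \<sigma> G" "frame2 \<sigma> G" "hopf_re G" "hopf_im G" "frame_norm \<sigma> G"
    by (rule gauss_frame_frame) (use assms tau_pos in auto)
  show ?thesis
    by unfold_locales
      (use assms(2-4) tau_pos smooth smooth_on_subset[OF tau_smooth assms(3)] orth dG closed in auto)
qed

text \<open>The equation holds on every open set where \<open>tau\<close> equals one norm. If the
  defect E were nonzero at p, it would be so on a neighbourhood U; the open part of U where sign 1
  fails has sign -1 and hence E = 0, so it is empty. Then sign 1 holds on all of U and again E =
  0.\<close>

lemma laplacian_ln_tau:
  assumes p: "p \<in> S"
  shows "pdx (pdx (\<lambda>q. ln (tau q))) p + pdy (pdy (\<lambda>q. ln (tau q))) p =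
    tau p - 4 * ((hopf_re G p)\<^sup>2 + (hopf_im G p)\<^sup>2) / tau p"
proof (rule ccontr)
  define E where "E p = pdx (pdx (\<lambda>q. ln (tau q))) p + pdy (pdy (\<lambda>q. ln (tau q))) p -
    (tau p - 4 * ((hopf_re G p)\<^sup>2 + (hopf_im G p)\<^sup>2) / tau p)" for p
  assume "\<not> ?thesis"
  then have Ep: "E p \<noteq> 0" by (simp add: E_def)
  have E0: "E q = 0" if "\<sigma> = 1 \<or> \<sigma> = -1" "open T" "T \<subseteq> S" "\<And>p. p \<in> T \<Longrightarrow> frame_norm \<sigma> G p = tau p" "q \<in> T" for \<sigma> T q
    using gauss_frame.laplacian_ln_m[OF gauss_frame_tau[OF that(1-4)] that(5)] by (simp add: E_def)
  have ln: "smooth_on S (\<lambda>q. ln (tau q))" by (rule smooth_on_ln[OF S tau_smooth tau_pos])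
  have nz: "tau q \<noteq> 0" if "q \<in> S" for q using tau_pos[OF that] by simp
  have "continuous_on S E" unfolding E_def
    by (intro continuous_intros smooth_on_continuous_on smooth_on_pd ln tau_smooth smooth_frame) (use nz in auto)
  then have "open (S \<inter> E -` (- {0}))" using S by (intro continuous_open_preimage) auto
  moreover define U where "U = S \<inter> E -` (- {0})"
  ultimately have U: "open U" "p \<in> U" "U \<subseteq> S" "\<And>q. q \<in> U \<Longrightarrow> E q \<noteq> 0" using p Ep by auto
  have "continuous_on U (\<lambda>q. frame_norm 1 G q - tau q)"
    by (intro continuous_intros continuous_on_subset[OF _ U(3)] smooth_on_continuous_on tau_smooth smooth_frame)
  then have "open (U \<inter> (\<lambda>q. frame_norm 1 G q - tau q) -` (- {0}))"
    using U(1) by (intro continuous_open_preimage) auto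
  moreover define U' where "U' = U \<inter> (\<lambda>q. frame_norm 1 G q - tau q) -` (- {0})"
  ultimately have "open U'" by simp
  then have "U' = {}"
    using E0[of "-1" U'] frame_norm_cases U(3,4) unfolding U'_def by (auto simp: subset_iff) (metis U(3) subsetD)+
  then have "frame_norm 1 G q = tau q" if "q \<in> U" for q using that by (auto simp: U'_def)
  then show False using E0[of 1 U p] U by auto
qed

text \<open>Subtracting the equations for ln m and ln tau, the Laplacian of their difference a is m
  - tau times a positive factor; \<open>abs_diff_le_ln\<close> turns this into |Laplacian a| \<le> C
  |a|.\<close>

lemma frame_norm_continuation:
  assumes \<sigma>: "\<sigma> = 1 \<or> \<sigma> = -1" and B: "cball c0 R \<subseteq> S" "\<And>p. p \<in> cball c0 R \<Longrightarrow> frame_norm \<sigma> G p > 0"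
    and e: "e > 0" "\<And>p. p \<in> ball c0 e \<Longrightarrow> frame_norm \<sigma> G p = tau p" and q: "q \<in> cball c0 R"
  shows "frame_norm \<sigma> G q = tau q"
proof -
  let ?m = "frame_norm \<sigma> G"
  have cm: "continuous_on S ?m" using smooth_frame smooth_on_continuous_on by blast
  define T where "T = S \<inter> ?m -` {0<..}"
  have T: "open T" unfolding T_def using cm S by (intro continuous_open_preimage) auto
  have TS: "T \<subseteq> S" and Tm: "\<And>p. p \<in> T \<Longrightarrow> ?m p > 0" and BT: "cball c0 R \<subseteq> T" using B by (auto simp: T_def)
  interpret gauss_frame T G "frame1 \<sigma> G" "frame2 \<sigma> G" "hopf_re G" "hopf_im G" ?m
    by (rule gauss_frame_frame[OF \<sigma> T TS Tm])
  define a where "a p = ln (?m p) - ln (tau p)" for p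
  note tT = smooth_on_subset[OF tau_smooth TS]
  have l1: "smooth_on T (\<lambda>p. ln (?m p))" by (rule smooth_on_ln[OF T smooth(6) Tm])
  have l2: "smooth_on T (\<lambda>p. ln (tau p))" by (rule smooth_on_ln[OF T tT]) (use TS tau_pos in auto)
  have as: "smooth_on T a" unfolding a_def by (intro smooth_on_diff T l1 l2)
  \<comment> \<open>The factor that \<open>abs_diff_le_ln\<close> produces; it is bounded on the
    compact ball.\<close>
  define k where "k p = (?m p + tau p) * (1 + 4 * ((hopf_re G p)\<^sup>2 + (hopf_im G p)\<^sup>2) / (?m p * tau p))" for p
  have nz: "?m p \<noteq> 0" "tau p \<noteq> 0" if "p \<in> cball c0 R" for p
    using BT Tm TS tau_pos that by (metis less_irrefl subsetD)+
  have "continuous_on (cball c0 R) k" unfolding k_def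
    by (intro continuous_intros continuous_on_subset[OF smooth_on_continuous_on BT] smooth tT) (use nz in auto)
  then have "bounded (k ` cball c0 R)" by (intro compact_imp_bounded compact_continuous_image) auto
  then obtain C where "\<forall>x\<in>k ` cball c0 R. norm x \<le> C" unfolding bounded_iff by blast
  then have C: "\<bar>k p\<bar> \<le> C" if "p \<in> cball c0 R" for p using that by simp
  have lap: "pdx (pdx a) p + pdy (pdy a) p =
      (?m p - tau p) * (1 + 4 * ((hopf_re G p)\<^sup>2 + (hopf_im G p)\<^sup>2) / (?m p * tau p))" if p: "p \<in> T" for p
  proof -
    have d: "f differentiable at q" if "smooth_on T f" "q \<in> T" for f :: "complex \<Rightarrow> real" and q
      by (rule smooth_on_at[OF that(1) T that(2)])
    have "pdx (pdx a) p = pdx (\<lambda>q. pdx (\<lambda>q. ln (?m q)) q - pdx (\<lambda>q. ln (tau q)) q) p"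
      by (rule pd_cong[OF T p]) (simp add: a_def[abs_def] pd_diff d l1 l2)
    then have x: "pdx (pdx a) p = pdx (pdx (\<lambda>q. ln (?m q))) p - pdx (pdx (\<lambda>q. ln (tau q))) p"
      using pd_diff[OF d[OF smooth_on_pd(1)[OF l1] p] d[OF smooth_on_pd(1)[OF l2] p]] by simp
    have "pdy (pdy a) p = pdy (\<lambda>q. pdy (\<lambda>q. ln (?m q)) q - pdy (\<lambda>q. ln (tau q)) q) p"
      by (rule pd_cong[OF T p]) (simp add: a_def[abs_def] pd_diff d l1 l2)
    then have y: "pdy (pdy a) p = pdy (pdy (\<lambda>q. ln (?m q))) p - pdy (pdy (\<lambda>q. ln (tau q))) p"
      using pd_diff[OF d[OF smooth_on_pd(2)[OF l1] p] d[OF smooth_on_pd(2)[OF l2] p]] by simp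
    have "?m p > 0" "tau p > 0" using Tm tau_pos TS p by auto
    moreover have "x - 4 * w / x - (y - 4 * w / y) = (x - y) * (1 + 4 * w / (x * y))" if "x > 0" "y > 0" for x y w :: real
      using that by (simp add: field_simps)
    ultimately have "(?m p - 4 * ((hopf_re G p)\<^sup>2 + (hopf_im G p)\<^sup>2) / ?m p) -
       (tau p - 4 * ((hopf_re G p)\<^sup>2 + (hopf_im G p)\<^sup>2) / tau p) =
      (?m p - tau p) * (1 + 4 * ((hopf_re G p)\<^sup>2 + (hopf_im G p)\<^sup>2) / (?m p * tau p))" by blast
    then show ?thesis unfolding x y
      using laplacian_ln_m[OF p] laplacian_ln_tau[OF subsetD[OF TS p]] by linarith
  qed
  have "a q = 0"
  proof (rule unique_continuation_ball[OF T BT as _ e(1) _ q])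
    show "a p = 0" if "p \<in> ball c0 e" for p using e(2)[OF that] by (simp add: a_def)
    fix p assume p: "p \<in> cball c0 R"
    have "p \<in> T" "p \<in> S" using p BT TS by blast+
    then have pos: "?m p > 0" "tau p > 0" using Tm tau_pos by blast+
    let ?w = "1 + 4 * ((hopf_re G p)\<^sup>2 + (hopf_im G p)\<^sup>2) / (?m p * tau p)"
    have w: "?w \<ge> 0" using pos by simp
    have "\<bar>pdx (pdx a) p + pdy (pdy a) p\<bar> = \<bar>?m p - tau p\<bar> * ?w"
      using lap[OF subsetD[OF BT p]] w by (simp only: abs_mult abs_of_nonneg)
    also have "\<dots> \<le> ((?m p + tau p) * \<bar>a p\<bar>) * ?w"
      unfolding a_def by (intro mult_right_mono abs_diff_le_ln pos w)
    also have "\<dots> = k p * \<bar>a p\<bar>" by (simp add: k_def)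
    also have "\<dots> \<le> C * \<bar>a p\<bar>" using C[OF p] by (intro mult_right_mono) auto
    finally show "\<bar>pdx (pdx a) p + pdy (pdy a) p\<bar> \<le> C * \<bar>a p\<bar>" .
  qed
  then have "ln (?m q) = ln (tau q)" by (simp add: a_def)
  then show ?thesis using ln_inj_iff[of "?m q" "tau q"] B(2)[OF q] tau_pos[of q] B(1) q by auto
qed

text \<open>Either sign 1 holds on no nonempty open set, and then the open set where sign -1 fails
  is empty; or the interior of the set where sign 1 holds is closed in S by unique
  continuation.\<close>

lemma frame_norm_eq_tau:
  assumes conn: "connected S"
  obtains \<sigma> :: real where "\<sigma> = 1 \<or> \<sigma> = -1" "\<And>p. p \<in> S \<Longrightarrow> frame_norm \<sigma> G p = tau p"
proof -
  have cm: "continuous_on S (frame_norm \<sigma> G)" for \<sigma> using smooth_frame smooth_on_continuous_on by blast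
  have ct: "continuous_on S tau" using tau_smooth smooth_on_continuous_on by blast
  have op: "open {p \<in> S. frame_norm \<sigma> G p \<noteq> tau p}" for \<sigma>
  proof -
    have "open (S \<inter> (\<lambda>q. frame_norm \<sigma> G q - tau q) -` (- {0}))"
      using S by (intro continuous_open_preimage continuous_intros cm ct) auto
    moreover have "S \<inter> (\<lambda>q. frame_norm \<sigma> G q - tau q) -` (- {0}) = {p \<in> S. frame_norm \<sigma> G p \<noteq> tau p}" by auto
    ultimately show ?thesis by simp
  qed
  define V where "V = {p \<in> S. frame_norm 1 G p = tau p}"
  show thesis
  proof (cases "interior V = {}")
    case True
    have "frame_norm (-1) G p = tau p" if p: "p \<in> S" for p
    proof (rule ccontr)
      assume "frame_norm (-1) G p \<noteq> tau p"
      moreover have "{p \<in> S. frame_norm (-1) G p \<noteq> tau p} \<subseteq> V" using frame_norm_cases by (auto simp: V_def)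
      then have "{p \<in> S. frame_norm (-1) G p \<noteq> tau p} \<subseteq> interior V" by (rule interior_maximal[OF _ op])
      ultimately show False using True p by auto
    qed
    then show thesis using that[of "-1"] by blast
  next
    case False
    then obtain w where w: "w \<in> interior V" by blast
    have VS: "interior V \<subseteq> S" using interior_subset by (force simp: V_def)
    have "p \<in> interior V" if "p \<in> S" for p
    proof (rule connected_clopen_all[where P="\<lambda>p. p \<in> interior V", OF conn subsetD[OF VS w] w _ _ that])
      have "{p \<in> S. p \<in> interior V} = interior V" using VS by blast
      then show "open {p \<in> S. p \<in> interior V}" by simp
      show "open {p \<in> S. p \<notin> interior V}"
        unfolding open_contains_ball
      proof
        fix p assume "p \<in> {p \<in> S. p \<notin> interior V}"
        then have p: "p \<in> S" "p \<notin> interior V" by auto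
        show "\<exists>d>0. ball p d \<subseteq> {p \<in> S. p \<notin> interior V}"
        proof (cases "frame_norm 1 G p = tau p")
          case False
          then obtain d where d: "d > 0" "ball p d \<subseteq> {p \<in> S. frame_norm 1 G p \<noteq> tau p}"
            using op[of 1] p(1) unfolding open_contains_ball by blast
          moreover have "{p \<in> S. frame_norm 1 G p \<noteq> tau p} \<subseteq> {p \<in> S. p \<notin> interior V}"
            using interior_subset by (force simp: V_def)
          ultimately show ?thesis by blast
        next
          case True
          have "open (S \<inter> frame_norm 1 G -` {0<..})" using cm S by (intro continuous_open_preimage) auto
          moreover have "p \<in> S \<inter> frame_norm 1 G -` {0<..}" using p True tau_pos by auto
          ultimately obtain d where d: "d > 0" "ball p d \<subseteq> S \<inter> frame_norm 1 G -` {0<..}"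
            unfolding open_contains_ball by blast
          \<comment> \<open>With |q - p| < d / 3, the ball of radius d / 2 around q stays in the
            ball where the norm is positive and still contains p, so continuation from q would reach
            p.\<close>
          have "q \<notin> interior V" if q: "q \<in> ball p (d / 3)" for q
          proof
            assume "q \<in> interior V"
            then obtain e where e: "e > 0" "ball q e \<subseteq> V" by (auto simp: mem_interior)
            have qp: "dist p q < d / 3" using q by simp
            have sub: "cball q (d / 2) \<subseteq> ball p d"
            proof
              fix x assume "x \<in> cball q (d / 2)"
              then show "x \<in> ball p d" using dist_triangle[of p x q] qp d(1) by auto
            qed
            have "cball q (d / 2) \<subseteq> V"
            proof
              fix x assume x: "x \<in> cball q (d / 2)"
              have "frame_norm 1 G x = tau x"
                by (rule frame_norm_continuation[where R="d / 2" and ?c0.0=q, OF _ _ _ e(1) _ x])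
                  (use sub d e in \<open>auto simp: V_def\<close>)
              then show "x \<in> V" using sub d x by (auto simp: V_def)
            qed
            then have "ball q (d / 2) \<subseteq> interior V" by (intro interior_maximal) auto
            moreover have "p \<in> ball q (d / 2)" using qp d(1) by (simp add: dist_commute)
            ultimately show False using p by blast
          qed
          then show ?thesis using d by (intro exI[of _ "d / 3"]) (auto simp: subset_iff)
        qed
      qed
    qed
    then have "frame_norm 1 G p = tau p" if "p \<in> S" for p
      using that interior_subset by (force simp: V_def)
    then show thesis using that[of 1] by blast
  qed
qed

end

section \<open>The linear system for the height function\<close>

text \<open>A vector \<open>((P, R, B), h)\<close> stands for \<open>h\<^sub>x = P\<close>, \<open>h\<^sub>y = R\<close> and \<open>B = sqrt ((\<tau> + 2 |h\<^sub>z|\<^sup>2) / \<tau>)\<close>: in these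
  unknowns the nonlinear equations for \<open>h\<close> become a linear system. The coefficient vector is
  \<open>(\<tau>, q1, q2, \<tau>\<^sub>x/2\<tau>, \<tau>\<^sub>y/2\<tau>, q1/\<tau>, q2/\<tau>, 1)\<close>.\<close>
type_synonym coeffs = "real \<times> real \<times> real \<times> real \<times> real \<times> real \<times> real \<times> real"

text \<open>Carrying h along integrates the form P dx + R dy together with the rest. That h does not
  occur on the right reflects the freedom of vertical translations.\<close>

fun sys_x :: "coeffs \<Rightarrow> L4 \<Rightarrow> L4" where
  "sys_x (t, q1, q2, al, be, k1, k2, e) ((P, R, B), h) =
     ((t * B + 2 * q1 * B + al * P - be * R, al * R + be * P - 2 * q2 * B, e * P / 2 + k1 * P - k2 * R), e * P)"

fun sys_y :: "coeffs \<Rightarrow> L4 \<Rightarrow> L4" where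
  "sys_y (t, q1, q2, al, be, k1, k2, e) ((P, R, B), h) =
     ((al * R + be * P - 2 * q2 * B, t * B - 2 * q1 * B - al * P + be * R, e * R / 2 - k1 * R - k2 * P), e * R)"

lemma bounded_linear_sys: "bounded_linear (sys_x c)" "bounded_linear (sys_y c)"
  unfolding linear_conv_bounded_linear[symmetric]
  by (cases c; auto simp: linear_iff algebra_simps add_divide_distrib)+

lemma blinfun_sys: "blinfun_apply (Blinfun (sys_x c)) = sys_x c" "blinfun_apply (Blinfun (sys_y c)) = sys_y c"
  by (simp_all add: bounded_linear_Blinfun_apply bounded_linear_sys)

text \<open>The last coefficient, always 1 in use, stands in for the constants: with it the
  operators are linear and not merely affine in the coefficient vector, so their smoothness and
  derivatives are inherited from that vector.\<close>

lemma bounded_linear_Blinfun_sys: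
  "bounded_linear (\<lambda>c. Blinfun (sys_x c))" "bounded_linear (\<lambda>c. Blinfun (sys_y c))"
  unfolding linear_conv_bounded_linear[symmetric] linear_iff
  by (auto intro!: blinfun_eqI simp: blinfun_sys blinfun.bilinear_simps algebra_simps add_divide_distrib)

locale gauss_system = gauss_frame +
  assumes cr: "p \<in> S \<Longrightarrow> pdx q1 p = pdy q2 p" "p \<in> S \<Longrightarrow> pdy q1 p = - pdx q2 p"
begin

definition al where "al p = pdx (\<lambda>q. ln (m q)) p / 2"
definition be where "be p = pdy (\<lambda>q. ln (m q)) p / 2"
definition k1 where "k1 p = q1 p / m p"
definition k2 where "k2 p = q2 p / m p"
definition coeff :: "complex \<Rightarrow> coeffs" where
  "coeff p = (m p, q1 p, q2 p, al p, be p, k1 p, k2 p, 1)"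

lemma at: "smooth_on S f \<Longrightarrow> p \<in> S \<Longrightarrow> f differentiable at p"
  using smooth_on_at S by blast

lemma m_nz: "p \<in> S \<Longrightarrow> m p \<noteq> 0"
  using m_pos by force

lemma smooth_ln_m: "smooth_on S (\<lambda>q. ln (m q))"
  by (rule smooth_on_ln[OF S smooth(6) m_pos])

lemma smooth_coeffs: "smooth_on S al" "smooth_on S be" "smooth_on S k1" "smooth_on S k2"
  unfolding al_def[abs_def] be_def[abs_def] k1_def[abs_def] k2_def[abs_def]
  by (intro smooth_on_linear[OF S bounded_linear_divide] smooth_on_pd smooth_ln_m smooth_on_divide S smooth m_nz; assumption)+

lemma smooth_coeff: "smooth_on S coeff"
  unfolding coeff_def[abs_def] by (intro smooth_intros S smooth smooth_coeffs)

lemma pd_coeff: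
  assumes "p \<in> S"
  shows "pdx coeff p = (pdx m p, pdx q1 p, pdx q2 p, pdx al p, pdx be p, pdx k1 p, pdx k2 p, 0)"
    "pdy coeff p = (pdy m p, pdy q1 p, pdy q2 p, pdy al p, pdy be p, pdy k1 p, pdy k2 p, 0)"
proof -
  have d: "(\<lambda>q. (f q, g q)) differentiable at p" if "f differentiable at p" "g differentiable at p" for f g
    using that unfolding differentiable_def by (blast intro: has_derivative_Pair)
  note dd = at[OF smooth(6) assms] at[OF smooth(4) assms] at[OF smooth(5) assms] smooth_coeffs[THEN at, OF assms]
  show "pdx coeff p = (pdx m p, pdx q1 p, pdx q2 p, pdx al p, pdx be p, pdx k1 p, pdx k2 p, 0)"
    "pdy coeff p = (pdy m p, pdy q1 p, pdy q2 p, pdy al p, pdy be p, pdy k1 p, pdy k2 p, 0)"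
    unfolding coeff_def[abs_def] by (simp_all add: pd_Pair d dd pd_const)
qed

lemma pd_m: "p \<in> S \<Longrightarrow> pdx m p = 2 * al p * m p" "p \<in> S \<Longrightarrow> pdy m p = 2 * be p * m p"
  using pd_ln[OF at[OF smooth(6)] m_pos] m_nz by (simp_all add: al_def be_def)

lemma q_k: "p \<in> S \<Longrightarrow> q1 p = m p * k1 p" "p \<in> S \<Longrightarrow> q2 p = m p * k2 p"
  using m_nz by (simp_all add: k1_def k2_def)

lemma pd_q:
  assumes "p \<in> S"
  shows "pdx q1 p = m p * (pdx k1 p + 2 * al p * k1 p)" "pdy q1 p = m p * (pdy k1 p + 2 * be p * k1 p)"
    "pdx q2 p = m p * (pdx k2 p + 2 * al p * k2 p)" "pdy q2 p = m p * (pdy k2 p + 2 * be p * k2 p)"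
  using pd_bilinear[OF bounded_bilinear_mult at[OF smooth(6) assms] at[OF smooth_coeffs(3) assms]]
    pd_bilinear[OF bounded_bilinear_mult at[OF smooth(6) assms] at[OF smooth_coeffs(4) assms]]
    pd_cong[OF S assms q_k(1)] pd_cong[OF S assms q_k(2)] pd_m[OF assms]
  by (simp_all add: algebra_simps)

text \<open>Rewritten for the quotients k = q / m, the Cauchy-Riemann equations contain no division,
  so that flatness can be checked as a polynomial identity.\<close>

lemma cr_k:
  assumes "p \<in> S"
  shows "pdx k1 p = pdy k2 p + 2 * be p * k2 p - 2 * al p * k1 p"
    "pdy k1 p = - pdx k2 p - 2 * al p * k2 p - 2 * be p * k1 p"
proof -
  have "m p * (pdx k1 p + 2 * al p * k1 p) = m p * (pdy k2 p + 2 * be p * k2 p)"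
    "m p * (pdy k1 p + 2 * be p * k1 p) = m p * (- pdx k2 p - 2 * al p * k2 p)"
    using cr[OF assms] pd_q[OF assms] by (simp_all add: algebra_simps)
  then show "pdx k1 p = pdy k2 p + 2 * be p * k2 p - 2 * al p * k1 p"
    "pdy k1 p = - pdx k2 p - 2 * al p * k2 p - 2 * be p * k1 p"
    using m_nz[OF assms] by (simp_all add: mult_left_cancel)
qed

lemma pd_al_be:
  assumes "p \<in> S"
  shows "pdy al p = pdx be p" "pdy be p = m p * (1 / 2 - 2 * (k1 p)\<^sup>2 - 2 * (k2 p)\<^sup>2) - pdx al p"
proof -
  note d = at[OF smooth_on_pd(1)[OF smooth_ln_m] assms] at[OF smooth_on_pd(2)[OF smooth_ln_m] assms]
  note e = pd_linear[OF bounded_linear_divide[of 2] d(1)] pd_linear[OF bounded_linear_divide[of 2] d(2)]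
  show "pdy al p = pdx be p"
    unfolding al_def[abs_def] be_def[abs_def] e using pd_commute[OF S smooth_ln_m assms] by simp
  have "4 * ((q1 p)\<^sup>2 + (q2 p)\<^sup>2) / m p = m p * (4 * ((k1 p)\<^sup>2 + (k2 p)\<^sup>2))"
    unfolding k1_def k2_def using m_nz[OF assms] by (simp add: field_simps power2_eq_square)
  then show "pdy be p = m p * (1 / 2 - 2 * (k1 p)\<^sup>2 - 2 * (k2 p)\<^sup>2) - pdx al p"
    unfolding al_def[abs_def] be_def[abs_def] e using laplacian_ln_m[OF assms] by (simp add: algebra_simps)
qed

definition X where "X p = Blinfun (sys_x (coeff p))"
definition Y where "Y p = Blinfun (sys_y (coeff p))"

lemma smooth_XY: "smooth_on S X" "smooth_on S Y"
  unfolding X_def[abs_def] Y_def[abs_def]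
  by (rule smooth_on_linear[OF S _ smooth_coeff], rule bounded_linear_Blinfun_sys)+

text \<open>The integrability conditions follow from the Codazzi equations (\<open>cr_k\<close>) and
  the Gauss equation (\<open>pd_al_be\<close>); once these are substituted, a polynomial identity
  remains.\<close>

lemma system_flat:
  assumes "p \<in> S"
  shows "pdy X p + (X p o\<^sub>L Y p) = pdx Y p + (Y p o\<^sub>L X p)"
proof (rule blinfun_eqI)
  fix u :: L4
  obtain P R B h where u: "u = ((P, R, B), h)" by (metis prod.exhaust)
  have 1: "pdy X p = Blinfun (sys_x (pdy coeff p))" "pdx Y p = Blinfun (sys_y (pdx coeff p))"
    unfolding X_def[abs_def] Y_def[abs_def]
    using pd_linear(2)[OF bounded_linear_Blinfun_sys(1) at[OF smooth_coeff assms]]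
      pd_linear(1)[OF bounded_linear_Blinfun_sys(2) at[OF smooth_coeff assms]] by auto
  show "blinfun_apply (pdy X p + (X p o\<^sub>L Y p)) u = blinfun_apply (pdx Y p + (Y p o\<^sub>L X p)) u"
    unfolding 1 X_def Y_def pd_coeff[OF assms] coeff_def u
    apply (simp add: blinfun.add_left blinfun_sys)
    apply (simp only: pd_q[OF assms] pd_m[OF assms] cr_k[OF assms] pd_al_be[OF assms] q_k[OF assms])
    by (simp add: field_simps power2_eq_square)
qed

definition solution :: "(complex \<Rightarrow> L4) \<Rightarrow> bool" where
  "solution u \<longleftrightarrow> (\<forall>p\<in>S. (u has_derivative (\<lambda>v. Re v *\<^sub>R X p (u p) + Im v *\<^sub>R Y p (u p))) (at p))"

lemma solution_exists:
  assumes "simply_connected S" "z0 \<in> S"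
  obtains u where "u z0 = u0" "solution u"
  using flat_system_simply_connected[OF S assms smooth_XY system_flat, of u0] unfolding solution_def by blast

lemma solution_pd:
  assumes "solution u" "p \<in> S"
  shows "u differentiable at p" "pdx u p = sys_x (coeff p) (u p)" "pdy u p = sys_y (coeff p) (u p)"
proof -
  have d: "(u has_derivative (\<lambda>v. Re v *\<^sub>R X p (u p) + Im v *\<^sub>R Y p (u p))) (at p)"
    using assms by (auto simp: solution_def)
  show "u differentiable at p" using d by (auto simp: differentiable_def)
  show "pdx u p = sys_x (coeff p) (u p)" "pdy u p = sys_y (coeff p) (u p)"
    using pd_of_has_derivative[OF d] by (simp_all add: X_def Y_def blinfun_sys)
qed

lemma solutionI:
  assumes "\<And>p. p \<in> S \<Longrightarrow> u differentiable at p" "\<And>p. p \<in> S \<Longrightarrow> pdx u p = sys_x (coeff p) (u p)"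
    "\<And>p. p \<in> S \<Longrightarrow> pdy u p = sys_y (coeff p) (u p)"
  shows "solution u"
  unfolding solution_def
proof
  fix p assume p: "p \<in> S"
  show "(u has_derivative (\<lambda>v. Re v *\<^sub>R X p (u p) + Im v *\<^sub>R Y p (u p))) (at p)"
    using has_derivative_pd[OF assms(1)[OF p]] assms(2,3)[OF p] by (simp add: X_def Y_def blinfun_sys)
qed

text \<open>Bootstrapping: the partial derivatives of a solution are X u and Y u, which are as
  regular as u.\<close>

lemma solution_smooth:
  assumes "solution u"
  shows "smooth_on S u"
proof -
  have diff: "u differentiable_on S"
    using solution_pd(1)[OF assms] S by (simp add: differentiable_on_eq_differentiable_at)
  have "Cn_on n S u" for n
  proof (induction n)
    case (Suc n)
    have XY: "Cn_on n S X" "Cn_on n S Y" using smooth_XY by (auto simp: smooth_on_iff_Cn)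
    have "Cn_on n S (pdx u)"
      by (rule Cn_on_cong[OF S _ Cn_on_bilinear[OF S bounded_bilinear_blinfun_apply XY(1) Suc]])
        (simp add: solution_pd[OF assms] X_def blinfun_sys)
    moreover have "Cn_on n S (pdy u)"
      by (rule Cn_on_cong[OF S _ Cn_on_bilinear[OF S bounded_bilinear_blinfun_apply XY(2) Suc]])
        (simp add: solution_pd[OF assms] Y_def blinfun_sys)
    ultimately show ?case using diff by simp
  qed (simp add: diff)
  then show ?thesis by (simp add: smooth_on_iff_Cn)
qed

lemma solution_unique:
  assumes "connected S" "z0 \<in> S" "solution u" "solution v" "fst (u z0) = fst (v z0)" "p \<in> S"
  shows "u p = v p + (0, snd (u z0) - snd (v z0))"
proof -
  \<comment> \<open>A constant vertical vector is annihilated by both operators, so subtracting it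
    keeps a solution and makes the difference vanish at \<open>z0\<close>.\<close>
  define c where "c = (0::L3, snd (u z0) - snd (v z0))"
  have c0: "X q c = 0" "Y q c = 0" for q
    by (simp_all add: X_def Y_def blinfun_sys c_def zero_prod_def coeff_def)
  define w where "w p = u p - v p - c" for p
  have "w p = 0"
  proof (rule linear_system_unique[OF S assms(1,2) _ _ _ _ assms(6), of X Y w])
    show "continuous_on S X" "continuous_on S Y" using smooth_XY smooth_on_continuous_on by blast+
    show "w z0 = 0" using assms(5) by (simp add: w_def c_def prod_eq_iff)
    fix q assume q: "q \<in> S"
    have "(w has_derivative (\<lambda>d. (Re d *\<^sub>R X q (u q) + Im d *\<^sub>R Y q (u q)) - (Re d *\<^sub>R X q (v q) + Im d *\<^sub>R Y q (v q)) - 0)) (at q)"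
      unfolding w_def using assms(3,4) q unfolding solution_def
      by (intro has_derivative_diff has_derivative_const) auto
    then show "(w has_derivative (\<lambda>d. Re d *\<^sub>R X q (w q) + Im d *\<^sub>R Y q (w q))) (at q)"
      by (rule has_derivative_eq_rhs) (simp add: w_def blinfun.diff_right blinfun.add_right c0 algebra_simps)
  qed
  then show ?thesis by (simp add: w_def c_def algebra_simps)
qed

end

section \<open>Unit normals and the height function\<close>

lemma lor4_simps:
  "lor4 (a + b) c = lor4 a c + lor4 b c" "lor4 (a - b) c = lor4 a c - lor4 b c"
  "lor4 (r *\<^sub>R a) c = r * lor4 a c" "lor4 c (r *\<^sub>R a) = r * lor4 c a" "lor4 c (a - b) = lor4 c a - lor4 c b"
  "lor4 (- a) c = - lor4 a c" "lor4 c (- a) = - lor4 c a"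
  by (simp_all add: lor4_altdef lor3_simps algebra_simps)

lemma H2_lor3: "x \<in> H2 \<Longrightarrow> lor3 x x = -1"
  by (simp add: H2_def)

lemma lor4_tangent_pos:
  assumes "lor3 n n = -1" "lor3 (fst x) n = 0" "x \<noteq> 0"
  shows "lor4 x x > 0"
proof -
  have n: "lor3 n (fst x) = 0" using assms(2) lor3_commute by metis
  have s: "lor3 (fst x) (fst x) \<ge> 0" "lor3 (fst x) (fst x) = 0 \<Longrightarrow> fst x = 0"
    using lor3_spacelike[OF assms(1) n] by auto
  show ?thesis
  proof (cases "snd x = 0")
    case True
    then have "fst x \<noteq> 0" using assms(3) by (simp add: prod_eq_iff)
    then show ?thesis using s True by (auto simp: lor4_altdef less_le)
  next
    case False
    then have "snd x * snd x > 0" by (auto simp: zero_less_mult_iff)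
    then show ?thesis using s(1) by (simp add: lor4_altdef)
  qed
qed

lemma unit_normal_normalize:
  assumes H: "fst (psi p) \<in> H2" and x: "x \<noteq> 0" "lor4 x (pdx psi p) = 0" "lor4 x (pdy psi p) = 0"
    "lor3 (fst x) (fst (psi p)) = 0"
  obtains c where "c > 0" "unit_normal psi p (c *\<^sub>R x)"
proof
  have pos: "lor4 x x > 0" by (rule lor4_tangent_pos[OF H2_lor3[OF H] x(4,1)])
  then show "1 / sqrt (lor4 x x) > 0" by simp
  have "lor4 ((1 / sqrt (lor4 x x)) *\<^sub>R x) ((1 / sqrt (lor4 x x)) *\<^sub>R x) = lor4 x x / (sqrt (lor4 x x) * sqrt (lor4 x x))"
    by (simp add: lor4_simps)
  also have "\<dots> = 1" using pos by simp
  finally show "unit_normal psi p ((1 / sqrt (lor4 x x)) *\<^sub>R x)"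
    using x by (simp add: unit_normal_def lor4_simps lor3_simps)
qed

text \<open>For two upward unit normals the combination \<open>z\<close> is normal and horizontal.
  Were it nonzero, normalising it would give a unit normal with vanishing angle, against
  \<open>reg\<close>. So the normals are proportional, and equal by length and sign.\<close>

lemma canon_normal_eqI:
  assumes H: "fst (psi p) \<in> H2" and reg: "\<And>eta. unit_normal psi p eta \<Longrightarrow> snd eta \<noteq> 0"
    and eta: "unit_normal psi p eta" "snd eta > 0"
  shows "canon_normal psi p = eta"
  unfolding canon_normal_def
proof (rule the_equality)
  show "unit_normal psi p eta \<and> 0 < snd eta" using eta by blast
  fix xi assume xi: "unit_normal psi p xi \<and> 0 < snd xi"
  define z where "z = snd xi *\<^sub>R eta - snd eta *\<^sub>R xi"
  have "z = 0"
  proof (rule ccontr)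
    assume "z \<noteq> 0"
    moreover have "lor4 z (pdx psi p) = 0" "lor4 z (pdy psi p) = 0" "lor3 (fst z) (fst (psi p)) = 0"
      using eta xi by (auto simp: z_def unit_normal_def lor4_simps lor3_simps)
    ultimately obtain c where c: "unit_normal psi p (c *\<^sub>R z)" using unit_normal_normalize[where psi=psi and p=p, OF H] by metis
    have "snd (c *\<^sub>R z) = 0" by (simp add: z_def)
    then show False using reg[OF c] by blast
  qed
  then have e: "snd xi *\<^sub>R eta = snd eta *\<^sub>R xi" by (simp add: z_def)
  have "lor4 (snd xi *\<^sub>R eta) (snd xi *\<^sub>R eta) = lor4 (snd eta *\<^sub>R xi) (snd eta *\<^sub>R xi)" unfolding e ..
  then have "(snd xi)\<^sup>2 = (snd eta)\<^sup>2"
    using eta xi by (simp add: unit_normal_def lor4_simps power2_eq_square)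
  then have "snd xi = snd eta"
    by (rule power2_eq_imp_eq) (use eta xi in auto)
  then have "snd eta *\<^sub>R eta = snd eta *\<^sub>R xi" using e by (simp only:)
  then have "eta = xi" using eta(2) unfolding scaleR_cancel_left by linarith
  then show "xi = eta" ..
qed

text \<open>Three linear conditions in dimension four have a nonzero solution; \<open>reg\<close>
  makes its vertical part nonzero, so that the sign can be chosen.\<close>

lemma canon_normal:
  assumes H: "fst (psi p) \<in> H2" and reg: "\<And>eta. unit_normal psi p eta \<Longrightarrow> snd eta \<noteq> 0"
  shows "unit_normal psi p (canon_normal psi p)" "snd (canon_normal psi p) > 0"
proof -
  define f where "f x = (lor4 x (pdx psi p), lor4 x (pdy psi p), lor3 (fst x) (fst (psi p)))" for x
  have lin: "linear f" by (auto simp: f_def linear_iff lor4_simps lor3_simps)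
  have "\<not> inj f"
  proof
    assume "inj f"
    then have "dim (range f) = dim (UNIV :: L4 set)"
      by (intro dim_image_eq lin) (auto intro: inj_on_subset)
    moreover have "dim (range f) \<le> DIM(L3)" by (rule dim_subset_UNIV)
    ultimately show False by (simp add: dim_UNIV)
  qed
  then obtain x where x: "x \<noteq> 0" "f x = 0" using linear_injective_0[OF lin] by blast
  then obtain c where c: "c > 0" "unit_normal psi p (c *\<^sub>R x)"
    using unit_normal_normalize[where psi=psi and p=p and x=x, OF H] by (auto simp: f_def zero_prod_def)
  define eta where "eta = (if snd (c *\<^sub>R x) > 0 then c *\<^sub>R x else (-1) *\<^sub>R (c *\<^sub>R x))"
  have "unit_normal psi p ((-1) *\<^sub>R (c *\<^sub>R x))" using c(2) by (simp add: unit_normal_def lor4_simps lor3_simps del: scaleR_scaleR)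
  then have u: "unit_normal psi p eta" using c by (simp add: eta_def)
  have "snd eta > 0"
  proof (cases "snd (c *\<^sub>R x) > 0")
    case False
    then have "snd (c *\<^sub>R x) < 0" using reg[OF c(2)] by linarith
    then show ?thesis using False by (simp add: eta_def)
  qed (simp add: eta_def)
  then have "canon_normal psi p = eta" by (intro canon_normal_eqI H reg u)
  then show "unit_normal psi p (canon_normal psi p)" "snd (canon_normal psi p) > 0"
    using u \<open>snd eta > 0\<close> by auto
qed

text \<open>Cauchy-Schwarz in the last two coordinates: unit timelike vectors on opposite sheets
  have nonnegative product. It places the constructed N in \<open>H2\<close>, as its product with G
  is - B.\<close>

lemma timelike_same_sheet:
  assumes "lor3 n n = -1" "lor3 g g = -1" "fst g > 0" "lor3 n g < 0"
  shows "fst n > 0"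
proof (rule ccontr)
  obtain n0 n1 n2 where n: "n = (n0, n1, n2)" by (cases n) auto
  obtain g0 g1 g2 where g: "g = (g0, g1, g2)" by (cases g) auto
  assume "\<not> fst n > 0"
  then have n0: "- n0 \<ge> 0" by (simp add: n)
  have nn: "(- n0)\<^sup>2 = 1 + (n1\<^sup>2 + n2\<^sup>2)" and gg: "g0\<^sup>2 = 1 + (g1\<^sup>2 + g2\<^sup>2)"
    using assms by (auto simp: n g power2_eq_square)
  have "(n1 * g1 + n2 * g2)\<^sup>2 \<le> (n1\<^sup>2 + n2\<^sup>2) * (g1\<^sup>2 + g2\<^sup>2)"
    using zero_le_power2[of "n1 * g2 - n2 * g1"] by (simp add: power2_eq_square algebra_simps)
  also have "\<dots> \<le> (- n0)\<^sup>2 * g0\<^sup>2" unfolding nn gg by (intro mult_mono) auto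
  finally have "(n1 * g1 + n2 * g2)\<^sup>2 \<le> (- n0 * g0)\<^sup>2" by (simp add: power_mult_distrib)
  moreover have "0 \<le> - n0 * g0" using n0 assms(3) by (simp add: g mult_nonpos_nonneg)
  ultimately have "\<bar>n1 * g1 + n2 * g2\<bar> \<le> - n0 * g0" using abs_le_square_iff[of "n1 * g1 + n2 * g2" "- n0 * g0"] by simp
  then have "lor3 n g \<ge> 0" by (simp add: n g)
  then show False using assms(4) by simp
qed

section \<open>The height equations in real form and their link with the linear system\<close>

lemma wz_of_real:
  assumes "open S" "smooth_on S h" "p \<in> S"
  shows "wz (\<lambda>q. complex_of_real (h q)) p = Complex (pdx h p / 2) (- pdy h p / 2)"
    "wzb (\<lambda>q. complex_of_real (h q)) p = Complex (pdx h p / 2) (pdy h p / 2)"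
    "wz (wz (\<lambda>q. complex_of_real (h q))) p = Complex ((pdx (pdx h) p - pdy (pdy h) p) / 4) (- pdx (pdy h) p / 2)"
    "wzb (wz (\<lambda>q. complex_of_real (h q))) p = Complex ((pdx (pdx h) p + pdy (pdy h) p) / 4) 0"
proof -
  have w: "wz (\<lambda>q. complex_of_real (h q)) q = Complex (pdx h q / 2) (- pdy h q / 2)"
    "wzb (\<lambda>q. complex_of_real (h q)) q = Complex (pdx h q / 2) (pdy h q / 2)" if "q \<in> S" for q
    using pd_linear[OF bounded_linear_of_real[where 'a=complex] smooth_on_at[OF assms(2,1) that]]
    by (simp_all add: wz_def wzb_def complex_eq_iff)
  then show "wz (\<lambda>q. complex_of_real (h q)) p = Complex (pdx h p / 2) (- pdy h p / 2)"
    "wzb (\<lambda>q. complex_of_real (h q)) p = Complex (pdx h p / 2) (pdy h p / 2)" using assms(3) by auto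
  let ?L = "\<lambda>x::real \<times> real. Complex (fst x / 2) (- snd x / 2)"
  have "linear ?L" by (auto simp: linear_iff complex_eq_iff algebra_simps add_divide_distrib)
  then have bl: "bounded_linear ?L" by (simp add: linear_conv_bounded_linear)
  have d: "pdx h differentiable at p" "pdy h differentiable at p" "(\<lambda>q. (pdx h q, pdy h q)) differentiable at p"
    using smooth_on_at[OF _ assms(1,3)] smooth_on_pd[OF assms(2)] smooth_on_Pair[OF assms(1)] by blast+
  note pl = pd_linear[OF bl d(3)] pd_Pair[OF d(1,2)]
  have e: "pdx (wz (\<lambda>q. complex_of_real (h q))) p = Complex (pdx (pdx h) p / 2) (- pdx (pdy h) p / 2)"
    "pdy (wz (\<lambda>q. complex_of_real (h q))) p = Complex (pdx (pdy h) p / 2) (- pdy (pdy h) p / 2)"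
    using pd_cong[OF assms(1,3), of "wz (\<lambda>q. complex_of_real (h q))" "\<lambda>q. ?L (pdx h q, pdy h q)"] w(1) pl
      pd_commute[OF assms] by (simp_all)
  show "wz (wz (\<lambda>q. complex_of_real (h q))) p = Complex ((pdx (pdx h) p - pdy (pdy h) p) / 4) (- pdx (pdy h) p / 2)"
    "wzb (wz (\<lambda>q. complex_of_real (h q))) p = Complex ((pdx (pdx h) p + pdy (pdy h) p) / 4) 0"
    unfolding wz_def[of "wz _"] wzb_def[of "wz _"] e by (simp_all add: complex_eq_iff field_simps)
qed

context gauss_system
begin

text \<open>The square root in the equations for h, because 2 |h_z|^2 = (h_x^2 + h_y^2) / 2.\<close>

definition height_B :: "(complex \<Rightarrow> real) \<Rightarrow> complex \<Rightarrow> real" where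
  "height_B h p = sqrt ((m p + ((pdx h p)\<^sup>2 + (pdy h p)\<^sup>2) / 2) / m p)"

lemma height_B_iff:
  assumes "p \<in> S"
  shows "B = height_B h p \<longleftrightarrow> B \<ge> 0 \<and> m p * B\<^sup>2 = m p + ((pdx h p)\<^sup>2 + (pdy h p)\<^sup>2) / 2"
proof -
  have mp: "m p > 0" by (rule m_pos[OF assms])
  have n: "(m p + ((pdx h p)\<^sup>2 + (pdy h p)\<^sup>2) / 2) / m p \<ge> 0" using mp by simp
  show ?thesis
  proof
    assume "B = height_B h p"
    then show "B \<ge> 0 \<and> m p * B\<^sup>2 = m p + ((pdx h p)\<^sup>2 + (pdy h p)\<^sup>2) / 2"
      using n mp by (simp add: height_B_def)
  next
    assume B: "B \<ge> 0 \<and> m p * B\<^sup>2 = m p + ((pdx h p)\<^sup>2 + (pdy h p)\<^sup>2) / 2"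
    then have "(m p + ((pdx h p)\<^sup>2 + (pdy h p)\<^sup>2) / 2) / m p = B\<^sup>2" using mp by (simp add: field_simps)
    then show "B = height_B h p" using B by (simp add: height_B_def)
  qed
qed

lemma height_B_pos: "p \<in> S \<Longrightarrow> height_B h p > 0"
  using m_pos[of p] by (simp add: height_B_def add_pos_nonneg)

text \<open>The real and imaginary part of the equation for h_zz and the equation for h_zzbar,
  solved for the three second derivatives.\<close>

definition real_pde :: "(complex \<Rightarrow> real) \<Rightarrow> bool" where
  "real_pde h \<longleftrightarrow> (\<forall>p\<in>S.
     pdx (pdx h) p = m p * height_B h p + 2 * q1 p * height_B h p + al p * pdx h p - be p * pdy h p \<and>
     pdx (pdy h) p = al p * pdy h p + be p * pdx h p - 2 * q2 p * height_B h p \<and>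
     pdy (pdy h) p = m p * height_B h p - 2 * q1 p * height_B h p - al p * pdx h p + be p * pdy h p)"

lemma h_pde_iff:
  assumes h: "smooth_on S h" and Q: "\<And>p. p \<in> S \<Longrightarrow> Q p = Complex (q1 p) (q2 p)"
  shows "h_pde S Q m h \<longleftrightarrow> real_pde h"
  unfolding h_pde_def real_pde_def Let_def
proof (rule ball_cong[OF refl])
  fix p assume p: "p \<in> S"
  have mp: "m p > 0" by (rule m_pos[OF p])
  note w = wz_of_real[OF S h p]
  have n2: "2 * (cmod (wz (\<lambda>q. complex_of_real (h q)) p))\<^sup>2 = ((pdx h p)\<^sup>2 + (pdy h p)\<^sup>2) / 2"
    unfolding w(1) by (simp add: cmod_power2 power_divide)
  have sq: "sqrt (m p * (m p + ((pdx h p)\<^sup>2 + (pdy h p)\<^sup>2) / 2)) / 2 = m p * height_B h p / 2"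
  proof -
    have "m p * (m p + ((pdx h p)\<^sup>2 + (pdy h p)\<^sup>2) / 2) = (m p)\<^sup>2 * ((m p + ((pdx h p)\<^sup>2 + (pdy h p)\<^sup>2) / 2) / m p)"
      using mp by (simp add: power2_eq_square)
    then show ?thesis using mp by (simp only: real_sqrt_mult real_sqrt_abs height_B_def)
  qed
  have l: "wz (\<lambda>q. complex_of_real (ln (m q))) p = Complex (al p) (- be p)"
    using wz_of_real(1)[OF S smooth_ln_m p] by (simp add: al_def be_def)
  show "wz (wz (\<lambda>q. complex_of_real (h q))) p = wz (\<lambda>q. complex_of_real (ln (m q))) p * wz (\<lambda>q. complex_of_real (h q)) p
      + Q p * complex_of_real (sqrt ((m p + 2 * (cmod (wz (\<lambda>q. complex_of_real (h q)) p))\<^sup>2) / m p)) \<and>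
    wzb (wz (\<lambda>q. complex_of_real (h q))) p = complex_of_real (sqrt (m p * (m p + 2 * (cmod (wz (\<lambda>q. complex_of_real (h q)) p))\<^sup>2)) / 2)
    \<longleftrightarrow> (pdx (pdx h) p = m p * height_B h p + 2 * q1 p * height_B h p + al p * pdx h p - be p * pdy h p \<and>
     pdx (pdy h) p = al p * pdy h p + be p * pdx h p - 2 * q2 p * height_B h p \<and>
     pdy (pdy h) p = m p * height_B h p - 2 * q1 p * height_B h p - al p * pdx h p + be p * pdy h p)"
    (is "?L \<longleftrightarrow> ?R")
  proof -
    let ?B = "height_B h p"
    have "?L \<longleftrightarrow> (pdx (pdx h) p - pdy (pdy h) p) / 4 = (al p * pdx h p - be p * pdy h p) / 2 + q1 p * ?B \<and>
       - pdx (pdy h) p / 2 = - (al p * pdy h p + be p * pdx h p) / 2 + q2 p * ?B \<and>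
       (pdx (pdx h) p + pdy (pdy h) p) / 4 = m p * ?B / 2"
      unfolding n2 w(3,4) l Q[OF p] sq unfolding w(1) height_B_def[symmetric]
      by (simp add: complex_eq_iff field_simps)
    also have "\<dots> \<longleftrightarrow> ?R" by argo
    finally show ?thesis .
  qed
qed

text \<open>The equations for P and R are those for h. The one for B results from differentiating m
  B^2 = m + (P^2 + R^2) / 2, inserting the second derivatives of h and cancelling the positive
  factor m B.\<close>

lemma solution_of_height:
  assumes h: "smooth_on S h" and pde: "real_pde h"
  shows "solution (\<lambda>p. ((pdx h p, pdy h p, height_B h p), h p))"
proof -
  note hs = h smooth_on_pd[OF h]
  let ?g = "\<lambda>q. (m q + ((pdx h q)\<^sup>2 + (pdy h q)\<^sup>2) / 2) / m q"
  have "smooth_on S (\<lambda>q. (m q + (pdx h q * pdx h q + pdy h q * pdy h q) / 2) / m q)"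
    by (intro smooth_on_divide smooth_intros smooth_on_linear[OF S bounded_linear_divide] S smooth h m_nz)
  then have gs: "smooth_on S ?g" by (simp add: power2_eq_square)
  have Bd: "height_B h differentiable at p" if "p \<in> S" for p
  proof -
    have "?g p > 0" using height_B_pos[OF that, of h] by (simp add: height_B_def)
    then show ?thesis unfolding height_B_def[abs_def]
      using pd_real_comp(3)[OF DERIV_real_sqrt at[OF gs that]] by blast
  qed
  have Bpd: "pdx (height_B h) p = pdx h p / 2 + k1 p * pdx h p - k2 p * pdy h p"
    "pdy (height_B h) p = pdy h p / 2 - k1 p * pdy h p - k2 p * pdx h p" if p: "p \<in> S" for p
  proof -
    let ?B = "height_B h p"
    have B0: "?B > 0" by (rule height_B_pos[OF p])
    have mB: "m q * (height_B h q * height_B h q) = m q + (pdx h q * pdx h q + pdy h q * pdy h q) / 2" if "q \<in> S" for q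
      using height_B_iff[OF that, of "height_B h q" h] by (simp add: power2_eq_square)
    note d = at[OF smooth(6) p] at[OF hs(2) p] at[OF hs(3) p] Bd[OF p]
    have dm: "(\<lambda>q. f q * g q) differentiable at p" if "f differentiable at p" "g differentiable at p"
      for f g :: "complex \<Rightarrow> real" using that by (rule differentiable_mult)
    note pm = pd_bilinear[OF bounded_bilinear_mult]
    note dd = dm[OF d(2,2)] dm[OF d(3,3)] dm[OF d(4,4)]
    note ds = differentiable_add[OF dd(1,2)]
    note dv = bounded_linear.has_derivative[OF bounded_linear_divide[of 2] has_derivative_pd[OF ds]]
    have dv': "(\<lambda>q. (pdx h q * pdx h q + pdy h q * pdy h q) / 2) differentiable at p"
      using dv by (auto simp: differentiable_def)
    note ex = pm[OF d(1) dd(3)] pm[OF d(4,4)] pd_add[OF d(1) dv'] pd_linear[OF bounded_linear_divide[of 2] ds]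
      pd_add[OF dd(1,2)] pm[OF d(2,2)] pm[OF d(3,3)]
    have mB': "m p * (?B * ?B) = m p + (pdx h p * pdx h p + pdy h p * pdy h p) / 2" by (rule mB[OF p])
    have c: "pdx (\<lambda>q. m q * (height_B h q * height_B h q)) p = pdx (\<lambda>q. m q + (pdx h q * pdx h q + pdy h q * pdy h q) / 2) p"
      "pdy (\<lambda>q. m q * (height_B h q * height_B h q)) p = pdy (\<lambda>q. m q + (pdx h q * pdx h q + pdy h q * pdy h q) / 2) p"
      by (rule pd_cong[OF S p mB]; assumption)+
    have 1: "m p * ?B * (2 * pdx (height_B h) p) = m p * ?B * (2 * (pdx h p / 2 + k1 p * pdx h p - k2 p * pdy h p))"
    proof -
      have "pdx m p * (?B * ?B) + m p * (2 * ?B * pdx (height_B h) p) = pdx m p + pdx h p * pdx (pdx h) p + pdy h p * pdx (pdy h) p"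
        using c(1) unfolding ex by (simp add: field_simps)
      moreover have "pdx m p * (?B * ?B) = 2 * al p * (m p + (pdx h p * pdx h p + pdy h p * pdy h p) / 2)"
        unfolding pd_m[OF p] mB'[symmetric] by simp
      ultimately show ?thesis
        using pde[unfolded real_pde_def, rule_format, OF p] unfolding pd_m[OF p] q_k[OF p]
        by (simp add: field_simps)
    qed
    have 2: "m p * ?B * (2 * pdy (height_B h) p) = m p * ?B * (2 * (pdy h p / 2 - k1 p * pdy h p - k2 p * pdx h p))"
    proof -
      have "pdy m p * (?B * ?B) + m p * (2 * ?B * pdy (height_B h) p) = pdy m p + pdx h p * pdx (pdy h) p + pdy h p * pdy (pdy h) p"
        using c(2) unfolding ex by (simp add: pd_commute[OF S h p] field_simps)
      moreover have "pdy m p * (?B * ?B) = 2 * be p * (m p + (pdx h p * pdx h p + pdy h p * pdy h p) / 2)"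
        unfolding pd_m[OF p] mB'[symmetric] by simp
      ultimately show ?thesis
        using pde[unfolded real_pde_def, rule_format, OF p] unfolding pd_m[OF p] q_k[OF p]
        by (simp add: field_simps)
    qed
    have nz: "m p * ?B \<noteq> 0" using B0 m_nz[OF p] by simp
    show "pdx (height_B h) p = pdx h p / 2 + k1 p * pdx h p - k2 p * pdy h p"
      "pdy (height_B h) p = pdy h p / 2 - k1 p * pdy h p - k2 p * pdx h p"
      using iffD1[OF mult_left_cancel[OF nz] 1] iffD1[OF mult_left_cancel[OF nz] 2] by simp_all
  qed
  have dP: "(\<lambda>q. (f q, g q)) differentiable at p" if "f differentiable at p" "g differentiable at p" for f g p
    using that unfolding differentiable_def by (blast intro: has_derivative_Pair)
  show ?thesis
  proof (rule solutionI)
    fix p assume p: "p \<in> S"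
    note d = at[OF hs(1) p] at[OF hs(2) p] at[OF hs(3) p] Bd[OF p]
    show "(\<lambda>p. ((pdx h p, pdy h p, height_B h p), h p)) differentiable at p" by (intro dP d)
    show "pdx (\<lambda>p. ((pdx h p, pdy h p, height_B h p), h p)) p = sys_x (coeff p) ((pdx h p, pdy h p, height_B h p), h p)"
      "pdy (\<lambda>p. ((pdx h p, pdy h p, height_B h p), h p)) p = sys_y (coeff p) ((pdx h p, pdy h p, height_B h p), h p)"
      using pde[unfolded real_pde_def, rule_format, OF p] Bpd[OF p] pd_commute[OF S h p]
      by (simp_all add: pd_Pair dP d coeff_def)
  qed
qed

text \<open>A solution of the linear system solves the equations for h only if its B is the positive
  root. The constancy of I carries the relation between B and the gradient from \<open>z0\<close> to
  all of S, and B keeps its sign since m B^2 \<ge> m excludes zeros.\<close>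

lemma height_exists:
  assumes "simply_connected S" "z0 \<in> S"
  obtains h where "smooth_on S h" "real_pde h" "pdx h z0 = a" "pdy h z0 = b"
    "solution (\<lambda>p. ((pdx h p, pdy h p, height_B h p), h p))"
proof -
  have conn: "connected S" using assms(1) simply_connected_imp_connected by blast
  \<comment> \<open>This initial value makes I equal to 1 at \<open>z0\<close>.\<close>
  define b0 where "b0 = sqrt ((m z0 + (a\<^sup>2 + b\<^sup>2) / 2) / m z0)"
  obtain u where u0: "u z0 = ((a, b, b0), 0)" and sol: "solution u"
    using solution_exists[OF assms] by blast
  define P R B h where "P p = fst (fst (u p))" and "R p = fst (snd (fst (u p)))"
    and "B p = snd (snd (fst (u p)))" and "h p = snd (u p)" for p
  have us: "u p = ((P p, R p, B p), h p)" for p by (simp add: P_def R_def B_def h_def)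
  have su: "smooth_on S u" by (rule solution_smooth[OF sol])
  note bl1 = bounded_linear_compose[OF bounded_linear_fst bounded_linear_fst]
  note bl2 = bounded_linear_compose[OF bounded_linear_fst bounded_linear_compose[OF bounded_linear_snd bounded_linear_fst]]
  note bl3 = bounded_linear_compose[OF bounded_linear_snd bounded_linear_compose[OF bounded_linear_snd bounded_linear_fst]]
  have sm: "smooth_on S P" "smooth_on S R" "smooth_on S B" "smooth_on S h"
    unfolding P_def[abs_def] R_def[abs_def] B_def[abs_def] h_def[abs_def]
    by (rule smooth_on_linear[OF S _ su], rule bl1 bl2 bl3 bounded_linear_snd)+
  have pds: "pdx P p = m p * B p + 2 * q1 p * B p + al p * P p - be p * R p"
    "pdx R p = al p * R p + be p * P p - 2 * q2 p * B p"
    "pdx B p = P p / 2 + k1 p * P p - k2 p * R p" "pdx h p = P p"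
    "pdy P p = al p * R p + be p * P p - 2 * q2 p * B p"
    "pdy R p = m p * B p - 2 * q1 p * B p - al p * P p + be p * R p"
    "pdy B p = R p / 2 - k1 p * R p - k2 p * P p" "pdy h p = R p" if p: "p \<in> S" for p
  proof -
    note d = solution_pd(1)[OF sol p]
    note e = pd_linear[OF bl1 d] pd_linear[OF bl2 d] pd_linear[OF bl3 d] pd_linear[OF bounded_linear_snd d]
      solution_pd(2,3)[OF sol p]
    show "pdx P p = m p * B p + 2 * q1 p * B p + al p * P p - be p * R p"
      "pdx R p = al p * R p + be p * P p - 2 * q2 p * B p"
      "pdx B p = P p / 2 + k1 p * P p - k2 p * R p" "pdx h p = P p"
      "pdy P p = al p * R p + be p * P p - 2 * q2 p * B p"
      "pdy R p = m p * B p - 2 * q1 p * B p - al p * P p + be p * R p"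
      "pdy B p = R p / 2 - k1 p * R p - k2 p * P p" "pdy h p = R p"
      unfolding P_def[abs_def] R_def[abs_def] B_def[abs_def] h_def[abs_def] e
      by (simp_all add: us coeff_def)
  qed
  \<comment> \<open>The quadratic quantity preserved by the system; on the surface it will be - <N,
    N>.\<close>
  define I where "I p = B p * B p - (P p * P p + R p * R p) / 2 * inverse (m p)" for p
  have dI: "(I has_derivative (\<lambda>v. 0)) (at p)" if p: "p \<in> S" for p
  proof -
    have inv: "(inverse has_real_derivative - (inverse (m p) * inverse (m p))) (at (m p))"
      using m_nz[OF p] by (auto intro!: derivative_eq_intros simp: power2_eq_square)
    note iv = pd_real_comp[OF inv at[OF smooth(6) p]]
    define r where "r = inverse (m p)"
    have ivp: "pdx (\<lambda>q. inverse (m q)) p = - (2 * al p * r)" "pdy (\<lambda>q. inverse (m q)) p = - (2 * be p * r)"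
      unfolding iv(1,2) pd_m[OF p] r_def using m_nz[OF p] by simp_all
    note d = at[OF sm(1) p] at[OF sm(2) p] at[OF sm(3) p]
    have dm: "(\<lambda>q. f q * g q) differentiable at p" if "f differentiable at p" "g differentiable at p"
      for f g :: "complex \<Rightarrow> real" using that by (rule differentiable_mult)
    note dd = dm[OF d(1,1)] dm[OF d(2,2)] dm[OF d(3,3)]
    note ds = differentiable_add[OF dd(1,2)]
    have dv: "(\<lambda>q. (P q * P q + R q * R q) / 2) differentiable at p"
      using bounded_linear.has_derivative[OF bounded_linear_divide[of 2] has_derivative_pd[OF ds]]
      by (auto simp: differentiable_def)
    note pm = pd_bilinear[OF bounded_bilinear_mult]
    note ex = pd_diff[OF dd(3) dm[OF dv iv(3)]] pm[OF d(3,3)] pm[OF dv iv(3)] ivp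
      pd_linear[OF bounded_linear_divide[of 2] ds] pd_add[OF dd(1,2)] pm[OF d(1,1)] pm[OF d(2,2)]
    have w: "r * (m p * x) = x" for x
      using m_nz[OF p] by (simp add: r_def)
    have "P p * pdx P p + R p * pdx R p = m p * (B p * (P p + 2 * k1 p * P p - 2 * k2 p * R p)) + al p * (P p * P p + R p * R p)"
      "P p * pdy P p + R p * pdy R p = m p * (B p * (R p - 2 * k1 p * R p - 2 * k2 p * P p)) + be p * (P p * P p + R p * R p)"
      unfolding pds[OF p] q_k[OF p] by (simp_all add: algebra_simps)
    then have e: "r * (P p * pdx P p + R p * pdx R p) = B p * (P p + 2 * k1 p * P p - 2 * k2 p * R p)
        + r * (al p * (P p * P p + R p * R p))"
      "r * (P p * pdy P p + R p * pdy R p) = B p * (R p - 2 * k1 p * R p - 2 * k2 p * P p)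
        + r * (be p * (P p * P p + R p * R p))"
      by (simp_all only: distrib_left w)
    have "pdx I p = 2 * B p * pdx B p - r * (P p * pdx P p + R p * pdx R p) + al p * r * (P p * P p + R p * R p)"
      "pdy I p = 2 * B p * pdy B p - r * (P p * pdy P p + R p * pdy R p) + be p * r * (P p * P p + R p * R p)"
      unfolding I_def[abs_def] ex r_def[symmetric] by (simp_all add: field_simps)
    then have "pdx I p = 0" "pdy I p = 0"
      unfolding e pds(3,7)[OF p] by (simp_all add: algebra_simps)
    moreover have "I differentiable at p" unfolding I_def[abs_def] by (rule differentiable_diff[OF dd(3) dm[OF dv iv(3)]])
    ultimately show ?thesis using has_derivative_pd[of I p] by simp
  qed
  have I1: "I p = 1" if p: "p \<in> S" for p
  proof -
    have "I p = I z0" by (rule has_derivative_zero_unique_connected[OF S conn dI p assms(2)])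
    also have "I z0 = 1"
    proof -
      have mz: "m z0 > 0" by (rule m_pos[OF assms(2)])
      have "P z0 = a" "R z0 = b" "B z0 = b0" using u0 by (simp_all add: P_def R_def B_def)
      moreover have "b0 * b0 = (m z0 + (a\<^sup>2 + b\<^sup>2) / 2) / m z0" using mz by (simp add: b0_def)
      ultimately show ?thesis unfolding I_def using mz by (simp add: field_simps power2_eq_square)
    qed
    finally show ?thesis .
  qed
  have mB: "m p * (B p)\<^sup>2 = m p + ((P p)\<^sup>2 + (R p)\<^sup>2) / 2" if p: "p \<in> S" for p
    using I1[OF p] m_nz[OF p] unfolding I_def by (simp add: field_simps power2_eq_square)
  have Bnz: "B p \<noteq> 0" if p: "p \<in> S" for p
  proof
    assume "B p = 0"
    then have "m p + ((P p)\<^sup>2 + (R p)\<^sup>2) / 2 = 0" using mB[OF p] by simp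
    moreover have "((P p)\<^sup>2 + (R p)\<^sup>2) / 2 \<ge> 0" by simp
    ultimately show False using m_pos[OF p] by linarith
  qed
  have Bpos: "B p > 0" if p: "p \<in> S" for p
  proof (rule connected_clopen_all[where P="\<lambda>p. B p > 0", OF conn assms(2) _ _ _ p])
    have "B z0 = b0" "m z0 > 0" using u0 m_pos[OF assms(2)] by (auto simp: B_def)
    then show "B z0 > 0" by (simp add: b0_def add_pos_nonneg)
    have c: "continuous_on S B" by (rule smooth_on_continuous_on[OF sm(3)])
    have "open (S \<inter> B -` {0<..})" "open (S \<inter> B -` {..<0})" using c S by (auto intro: continuous_open_preimage)
    moreover have "S \<inter> B -` {0<..} = {p \<in> S. B p > 0}" "S \<inter> B -` {..<0} = {p \<in> S. \<not> B p > 0}"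
      using Bnz by (auto simp: less_le not_less)
    ultimately show "open {p \<in> S. B p > 0}" "open {p \<in> S. \<not> B p > 0}" by auto
  qed
  have hB: "height_B h p = B p" if p: "p \<in> S" for p
    using height_B_iff[OF p, of "B p" h] mB[OF p] Bpos[OF p] pds[OF p] by simp
  show thesis
  proof (rule that[of h])
    show sh: "smooth_on S h" by (rule sm)
    show pde: "real_pde h" unfolding real_pde_def
    proof (rule ballI)
      fix p assume p: "p \<in> S"
      have "pdx (pdx h) p = pdx P p" "pdx (pdy h) p = pdx R p" "pdy (pdy h) p = pdy R p"
        using pd_cong[OF S p] pds(4,8) by blast+
      then show "pdx (pdx h) p = m p * height_B h p + 2 * q1 p * height_B h p + al p * pdx h p - be p * pdy h p \<and>
       pdx (pdy h) p = al p * pdy h p + be p * pdx h p - 2 * q2 p * height_B h p \<and>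
       pdy (pdy h) p = m p * height_B h p - 2 * q1 p * height_B h p - al p * pdx h p + be p * pdy h p"
        using pds[OF p] hB[OF p] by simp
    qed
    show "pdx h z0 = a" "pdy h z0 = b" using pds(4,8)[OF assms(2)] u0 by (simp_all add: P_def R_def)
    show "solution (\<lambda>p. ((pdx h p, pdy h p, height_B h p), h p))" by (rule solution_of_height[OF sh pde])
  qed
qed

lemma height_unique:
  assumes "connected S" "z0 \<in> S" "smooth_on S h" "real_pde h" "smooth_on S h'" "real_pde h'"
    and "pdx h z0 = pdx h' z0" "pdy h z0 = pdy h' z0"
  obtains c where "\<And>p. p \<in> S \<Longrightarrow> h' p = h p + c" "\<And>p. p \<in> S \<Longrightarrow> pdx h' p = pdx h p"
    "\<And>p. p \<in> S \<Longrightarrow> pdy h' p = pdy h p" "\<And>p. p \<in> S \<Longrightarrow> height_B h' p = height_B h p"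
proof -
  have "height_B h z0 = height_B h' z0" using assms by (simp add: height_B_def)
  then have "((pdx h' p, pdy h' p, height_B h' p), h' p) = ((pdx h p, pdy h p, height_B h p), h p) + (0, h' z0 - h z0)"
    if "p \<in> S" for p
    using solution_unique[OF assms(1,2) solution_of_height[OF assms(5,6)] solution_of_height[OF assms(3,4)] _ that]
      assms(7,8) by simp
  then show thesis using that[of "h' z0 - h z0"] by (simp add: zero_prod_def)
qed

end

section \<open>The surface\<close>

context gauss_system
begin

definition surface_N :: "(complex \<Rightarrow> real) \<Rightarrow> complex \<Rightarrow> L3" where
  "surface_N h p = height_B h p *\<^sub>R G p + (pdx h p / m p) *\<^sub>R f1 p + (pdy h p / m p) *\<^sub>R f2 p"

definition surface :: "(complex \<Rightarrow> real) \<Rightarrow> complex \<Rightarrow> L4" where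
  "surface h p = (surface_N h p, h p)"

lemma G_pd_k:
  assumes "p \<in> S"
  shows "pdx G p = (1 - 2 * k1 p) *\<^sub>R f1 p + (2 * k2 p) *\<^sub>R f2 p" "pdy G p = (2 * k2 p) *\<^sub>R f1 p + (1 + 2 * k1 p) *\<^sub>R f2 p"
  using G_pd[OF assms] by (simp_all add: k1_def k2_def)

lemma f_pd_k:
  assumes "p \<in> S"
  shows "pdx f1 p = (m p / 2 - q1 p) *\<^sub>R G p + al p *\<^sub>R f1 p - be p *\<^sub>R f2 p"
    "pdx f2 p = q2 p *\<^sub>R G p + be p *\<^sub>R f1 p + al p *\<^sub>R f2 p"
    "pdy f1 p = q2 p *\<^sub>R G p + be p *\<^sub>R f1 p + al p *\<^sub>R f2 p"
    "pdy f2 p = (m p / 2 + q1 p) *\<^sub>R G p - al p *\<^sub>R f1 p + be p *\<^sub>R f2 p"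
  using f_pd[OF assms] pd_m[OF assms] m_nz[OF assms] by simp_all

text \<open>The matrix expressing G_x, G_y by f1, f2 has determinant 1 - 4 (k1^2 + k2^2). If it is
  0, then 2 k2 G_x = (1 - 2 k1) G_y; both coefficients vanish only for k2 = 0, k1 = 1/2, where G_x
  itself is 0.\<close>

lemma not_regular:
  assumes p: "p \<in> S" and "1 = 4 * ((k1 p)\<^sup>2 + (k2 p)\<^sup>2)"
  shows "\<not> regular_pt G p"
proof
  assume r: "regular_pt G p"
  have e: "(1 - 2 * k1 p) * (1 + 2 * k1 p) = 2 * k2 p * (2 * k2 p)"
    using assms(2) by (simp add: power2_eq_square algebra_simps)
  have "(2 * k2 p) *\<^sub>R pdx G p + (- (1 - 2 * k1 p)) *\<^sub>R pdy G p =
      (2 * k2 p * (2 * k2 p) - (1 - 2 * k1 p) * (1 + 2 * k1 p)) *\<^sub>R f2 p"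
    unfolding G_pd_k[OF p] by (simp add: algebra_simps)
  also have "\<dots> = 0" unfolding e by simp
  finally have "k2 p = 0" "1 - 2 * k1 p = 0" using r unfolding regular_pt_def by fastforce+
  then have "1 *\<^sub>R pdx G p + 0 *\<^sub>R pdy G p = 0" unfolding G_pd_k[OF p] by simp
  then show False using r unfolding regular_pt_def by fastforce
qed

section \<open>The surface built from a height function\<close>

context
  fixes h :: "complex \<Rightarrow> real"
  assumes h: "smooth_on S h" and pde: "real_pde h"
begin

abbreviation (input) "P \<equiv> pdx h"
abbreviation (input) "R \<equiv> pdy h"
abbreviation (input) "B \<equiv> height_B h"
abbreviation (input) "N \<equiv> surface_N h"

lemma smooth_B: "smooth_on S B"
proof -
  have "smooth_on S (\<lambda>p. snd (snd (fst ((P p, R p, B p), h p))))"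
    by (rule smooth_on_linear[OF S _ solution_smooth[OF solution_of_height[OF h pde]]])
      (intro bounded_linear_compose[OF bounded_linear_snd] bounded_linear_snd bounded_linear_fst)
  then show ?thesis by simp
qed

lemma B_pd:
  assumes p: "p \<in> S"
  shows "pdx B p = P p / 2 + k1 p * P p - k2 p * R p" "pdy B p = R p / 2 - k1 p * R p - k2 p * P p"
proof -
  note d = at[OF h p] at[OF smooth_on_pd(1)[OF h] p] at[OF smooth_on_pd(2)[OF h] p] at[OF smooth_B p]
  have dP: "(\<lambda>q. (f q, g q)) differentiable at p" if "f differentiable at p" "g differentiable at p" for f g
    using that unfolding differentiable_def by (blast intro: has_derivative_Pair)
  show "pdx B p = P p / 2 + k1 p * P p - k2 p * R p" "pdy B p = R p / 2 - k1 p * R p - k2 p * P p"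
    using solution_pd(2,3)[OF solution_of_height[OF h pde] p] by (simp_all add: pd_Pair dP d coeff_def)
qed

lemma B_eq:
  assumes p: "p \<in> S"
  shows "B p > 0" "(P p)\<^sup>2 + (R p)\<^sup>2 = 2 * m p * ((B p)\<^sup>2 - 1)"
  using height_B_pos[OF p, of h] height_B_iff[OF p, of "B p" h] by (auto simp: field_simps)

lemmas pde_at = pde[unfolded real_pde_def, rule_format]

lemma smooth_N: "smooth_on S N"
  unfolding surface_N_def[abs_def]
  by (intro smooth_intros smooth_on_divide smooth_B smooth h S m_nz)

lemma N_lor3:
  assumes p: "p \<in> S"
  shows "lor3 (N p) (G p) = - B p" "lor3 (N p) (f1 p) = P p / 2" "lor3 (N p) (f2 p) = R p / 2"
    "lor3 (G p) (N p) = - B p" "lor3 (f1 p) (N p) = P p / 2" "lor3 (f2 p) (N p) = R p / 2"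
proof -
  show 1: "lor3 (N p) (G p) = - B p" "lor3 (N p) (f1 p) = P p / 2" "lor3 (N p) (f2 p) = R p / 2"
    unfolding surface_N_def using m_nz[OF p] by (simp_all add: lor3_simps orth[OF p] orth'[OF p])
  show "lor3 (G p) (N p) = - B p" "lor3 (f1 p) (N p) = P p / 2" "lor3 (f2 p) (N p) = R p / 2"
    using 1 lor3_commute by metis+
qed

lemma N_unit: "p \<in> S \<Longrightarrow> lor3 (N p) (N p) = -1"
proof -
  assume p: "p \<in> S"
  have "lor3 (N p) (N p) = - (B p)\<^sup>2 + ((P p)\<^sup>2 + (R p)\<^sup>2) / (2 * m p)"
    using m_nz[OF p] by (subst (2) surface_N_def) (simp add: lor3_simps N_lor3[OF p] power2_eq_square field_simps)
  then show ?thesis unfolding B_eq(2)[OF p] using m_nz[OF p] by simp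
qed

text \<open>Differentiating \<open>N_lor3\<close> gives the products of N_x and N_y with the frame,
  and these determine both vectors; the height equations make most terms cancel.\<close>

lemma N_pd:
  assumes p: "p \<in> S"
  shows "pdx N p = P p *\<^sub>R G p + (2 * B p) *\<^sub>R f1 p" "pdy N p = R p *\<^sub>R G p + (2 * B p) *\<^sub>R f2 p"
proof -
  have half: "pdx (\<lambda>q. f q / 2) p = pdx f p / 2" "pdy (\<lambda>q. f q / 2) p = pdy f p / 2" if "smooth_on S f" for f :: "complex \<Rightarrow> real"
    using pd_linear[OF bounded_linear_divide[of 2] at[OF that p]] by auto
  have neg: "pdx (\<lambda>q. - B q) p = - pdx B p" "pdy (\<lambda>q. - B q) p = - pdy B p"
    using pd_linear[OF bounded_linear_minus[OF bounded_linear_ident] at[OF smooth_B p]] by auto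
  note e = lor3_pd_eq[OF S p smooth_N smooth(1) N_lor3(1), unfolded neg B_pd[OF p]]
    lor3_pd_eq[OF S p smooth_N smooth(2) N_lor3(2), unfolded half[OF smooth_on_pd(1)[OF h]]]
    lor3_pd_eq[OF S p smooth_N smooth(3) N_lor3(3), unfolded half[OF smooth_on_pd(2)[OF h]]]
  note e' = e[unfolded G_pd_k[OF p] f_pd_k[OF p] lor3_simps N_lor3[OF p] pd_commute[OF S h p, symmetric]]
  note o = orth[OF p] orth'[OF p] lor3_simps
  show "pdx N p = P p *\<^sub>R G p + (2 * B p) *\<^sub>R f1 p"
    by (rule eqI[OF p]) (use e'(1,3,5) pde_at[OF p] in \<open>simp_all add: o field_simps\<close>)
  show "pdy N p = R p *\<^sub>R G p + (2 * B p) *\<^sub>R f2 p"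
    by (rule eqI[OF p]) (use e'(2,4,6) pde_at[OF p] in \<open>simp_all add: o field_simps\<close>)
qed

lemma smooth_surface: "smooth_on S (surface h)"
  unfolding surface_def[abs_def] by (intro smooth_on_Pair S smooth_N h)

lemma surface_pd:
  assumes p: "p \<in> S"
  shows "pdx (surface h) p = (pdx N p, P p)" "pdy (surface h) p = (pdy N p, R p)"
  unfolding surface_def[abs_def] by (rule pd_Pair[OF at[OF smooth_N p] at[OF h p]])+

lemma surface_lor4:
  assumes p: "p \<in> S"
  shows "lor4 (pdx (surface h) p) (pdx (surface h) p) = 2 * m p * (B p)\<^sup>2"
    "lor4 (pdy (surface h) p) (pdy (surface h) p) = 2 * m p * (B p)\<^sup>2"
    "lor4 (pdx (surface h) p) (pdy (surface h) p) = 0"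
  unfolding surface_pd[OF p] N_pd[OF p] lor4_altdef
  by (simp_all add: lor3_simps orth[OF p] orth'[OF p] power2_eq_square)

text \<open>Forced by the hyperbolic Gauss map: eta = u (G, 1) - (N, 0) with u = 1 / B.\<close>

definition surface_normal :: "complex \<Rightarrow> L4" where
  "surface_normal p = ((1 / B p) *\<^sub>R G p - N p, 1 / B p)"

lemma unit_normal_surface:
  assumes p: "p \<in> S"
  shows "unit_normal (surface h) p (surface_normal p)"
  unfolding unit_normal_def surface_pd[OF p] N_pd[OF p] surface_normal_def lor4_altdef
  using B_eq(1)[OF p]
  by (simp add: surface_def lor3_simps orth[OF p] orth'[OF p] N_lor3[OF p] N_unit[OF p] field_simps)

text \<open>For a horizontal unit normal xi, orthogonality to the tangent plane expresses its
  products with f1 and f2 by g = <xi, G>. Orthogonality to N then reads 2 m g = 0, so all three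
  products vanish, and xi with them.\<close>

lemma surface_regular:
  assumes p: "p \<in> S" and xi: "unit_normal (surface h) p xi"
  shows "snd xi \<noteq> 0"
proof
  assume z: "snd xi = 0"
  define g where "g = lor3 (fst xi) (G p)"
  have B0: "B p > 0" and PR: "(P p)\<^sup>2 + (R p)\<^sup>2 = 2 * m p * ((B p)\<^sup>2 - 1)" using B_eq[OF p] by auto
  have e: "P p * g + 2 * B p * lor3 (fst xi) (f1 p) = 0" "R p * g + 2 * B p * lor3 (fst xi) (f2 p) = 0"
    "lor3 (fst xi) (N p) = 0" "lor3 (fst xi) (fst xi) = 1"
    using xi z unfolding unit_normal_def surface_pd[OF p] N_pd[OF p] lor4_altdef g_def
    by (simp_all add: lor3_simps surface_def)
  have "0 = 2 * m p * B p * lor3 (fst xi) (N p)" using e by simp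
  also have "\<dots> = 2 * m p * (B p)\<^sup>2 * g + P p * (2 * B p * lor3 (fst xi) (f1 p)) + R p * (2 * B p * lor3 (fst xi) (f2 p))"
    using m_nz[OF p] by (simp add: surface_N_def lor3_simps g_def field_simps power2_eq_square)
  also have "\<dots> = 2 * m p * (B p)\<^sup>2 * g - ((P p)\<^sup>2 + (R p)\<^sup>2) * g"
  proof -
    have "2 * B p * lor3 (fst xi) (f1 p) = - (P p * g)" "2 * B p * lor3 (fst xi) (f2 p) = - (R p * g)" using e by linarith+
    then show ?thesis by (simp add: power2_eq_square algebra_simps)
  qed
  also have "\<dots> = 2 * m p * g" unfolding PR by (simp add: algebra_simps)
  finally have "g = 0" using m_nz[OF p] by simp
  then have "lor3 (fst xi) (f1 p) = 0" "lor3 (fst xi) (f2 p) = 0" using e B0 by auto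
  then have "fst xi = 0" using \<open>g = 0\<close> by (intro eqI[OF p]) (simp_all add: g_def lor3_simps)
  then show False using e(4) by (simp add: lor3_simps)
qed

text \<open>Second derivatives of N enter only through products with G and N, which are obtained by
  differentiating first-order products. The result is the conformal factor, that is, mean curvature
  1/2.\<close>

lemma surface_laplacian:
  assumes p: "p \<in> S"
  shows "lor4 (pdx (pdx (surface h)) p + pdy (pdy (surface h)) p) (surface_normal p) = 2 * m p * (B p)\<^sup>2"
proof -
  note s = smooth_on_pd[OF smooth_N] smooth_on_pd[OF h]
  note d = at[OF s(1) p] at[OF s(2) p] at[OF s(3) p] at[OF s(4) p]
  have x: "pdx (pdx (surface h)) p = (pdx (pdx N) p, pdx P p)"
    using pd_cong(1)[OF S p surface_pd(1)] pd_Pair(1)[OF d(1,3)] by simp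
  have y: "pdy (pdy (surface h)) p = (pdy (pdy N) p, pdy R p)"
    using pd_cong(2)[OF S p surface_pd(2)] pd_Pair(2)[OF d(2,4)] by simp
  have neg: "pdx (\<lambda>q. - f q) p = - pdx f p" "pdy (\<lambda>q. - f q) p = - pdy f p" if "smooth_on S f" for f :: "complex \<Rightarrow> real"
    using pd_linear[OF bounded_linear_minus[OF bounded_linear_ident] at[OF that p]] by auto
  have "lor3 (pdx N q) (G q) = - P q" "lor3 (pdy N q) (G q) = - R q"
    "lor3 (pdx N q) (N q) = 0" "lor3 (pdy N q) (N q) = 0" if q: "q \<in> S" for q
    using N_lor3[OF q] by (simp_all add: N_pd[OF q] lor3_simps orth[OF q] orth'[OF q])
  note l = this
  note e1 = lor3_pd_eq(1)[OF S p s(1) smooth(1) l(1), unfolded neg[OF s(3)]]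
    lor3_pd_eq(2)[OF S p s(2) smooth(1) l(2), unfolded neg[OF s(4)]]
    lor3_pd_eq(1)[OF S p s(1) smooth_N l(3), unfolded pd_const]
    lor3_pd_eq(2)[OF S p s(2) smooth_N l(4), unfolded pd_const]
  have o: "lor3 (pdx N p) (pdx G p) + lor3 (pdy N p) (pdy G p) = 2 * m p * B p"
    "lor3 (pdx N p) (pdx N p) + lor3 (pdy N p) (pdy N p) = 4 * m p * (B p)\<^sup>2 - ((P p)\<^sup>2 + (R p)\<^sup>2)"
    unfolding N_pd[OF p]
    by (simp_all add: lor3_simps dG[OF p] orth[OF p] orth'[OF p] lor3_commute[of "G p" "pdx G p"] lor3_commute[of "G p" "pdy G p"]
      G_pd_orth[OF p] power2_eq_square algebra_simps)
  have hl: "pdx P p + pdy R p = 2 * m p * B p" using pde_at[OF p] by simp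
  have "lor3 (pdx (pdx N) p + pdy (pdy N) p) (G p) = - 4 * m p * B p"
    using e1(1,2) o(1) hl unfolding lor3_simps by linarith
  moreover have "lor3 (pdx (pdx N) p + pdy (pdy N) p) (N p) = - (4 * m p * (B p)\<^sup>2 - 2 * m p * ((B p)\<^sup>2 - 1))"
    using e1(3,4) o(2) B_eq(2)[OF p] unfolding lor3_simps by linarith
  ultimately show ?thesis
    unfolding x y surface_normal_def lor4_altdef using hl B_eq(1)[OF p]
    by (simp add: lor3_simps field_simps power2_eq_square)
qed

lemma surface_required:
  assumes GH: "\<And>p. p \<in> S \<Longrightarrow> G p \<in> H2" and z0: "wz (\<lambda>q. complex_of_real (h q)) z0 = th0"
  shows "required_props S G m z0 th0 (surface h)"
proof -
  have H: "fst (surface h p) \<in> H2" if p: "p \<in> S" for p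
  proof -
    have "fst (N p) > 0"
      using timelike_same_sheet[OF N_unit[OF p] orth(1)[OF p]] GH[OF p] N_lor3(1)[OF p] B_eq(1)[OF p]
      by (simp add: H2_def)
    then show ?thesis using N_unit[OF p] by (simp add: H2_def surface_def)
  qed
  have cn: "canon_normal (surface h) p = surface_normal p" if p: "p \<in> S" for p
    by (rule canon_normal_eqI[OF H[OF p] surface_regular[OF p] unit_normal_surface[OF p]])
      (use B_eq(1)[OF p] in \<open>simp_all add: surface_normal_def\<close>)
  have u: "angle_fun (surface h) p = 1 / B p" if p: "p \<in> S" for p
    by (simp add: angle_fun_def cn[OF p] surface_normal_def)
  have lm: "lam (surface h) p = 2 * m p * (B p)\<^sup>2" if p: "p \<in> S" for p
    unfolding lam_def by (rule surface_lor4[OF p])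
  have lp: "lam (surface h) p > 0" if p: "p \<in> S" for p
    unfolding lm[OF p] using m_pos[OF p] B_eq(1)[OF p] by simp
  show ?thesis
    unfolding required_props_def
  proof (intro conjI ballI)
    show "conformal_immersion S (surface h)"
      unfolding conformal_immersion_def using smooth_surface H lp surface_lor4 lm by auto
    show "regular_vertical_projection S (surface h)"
      unfolding regular_vertical_projection_def using surface_regular by blast
    show "hyp_gauss_map S (surface h) G"
      unfolding hyp_gauss_map_def
    proof
      fix p assume p: "p \<in> S"
      show "(G p, 1) = (1 / angle_fun (surface h) p) *\<^sub>R (canon_normal (surface h) p + (fst (surface h p), 0))"
        unfolding u[OF p] cn[OF p] using B_eq(1)[OF p] by (simp add: surface_normal_def surface_def)
    qed
    show "wz (\<lambda>q. complex_of_real (snd (surface h q))) z0 = th0" using z0 by (simp add: surface_def)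
    fix p assume p: "p \<in> S"
    show "mean_curv (surface h) (canon_normal (surface h)) p = 1 / 2"
      unfolding mean_curv_def cn[OF p] surface_laplacian[OF p] lm[OF p] using m_pos[OF p] B_eq(1)[OF p] by simp
    show "m p = lam (surface h) p * (angle_fun (surface h) p)\<^sup>2 / 2"
      unfolding lm[OF p] u[OF p] using B_eq(1)[OF p] by (simp add: power_divide)
  qed
qed

text \<open>At regular points the relation between G_x, G_y and the frame can be inverted. Its
  determinant D equals (m^2 - 4 |Q|^2) / m^2, which explains the denominator in the formula.\<close>

lemma surface_N_formula:
  assumes p: "p \<in> S" and Q: "Q p = Complex (q1 p) (q2 p)" and r: "regular_pt G p"
  shows "N p = N_formula G Q m h p"
proof -
  define D where "D = 1 - 4 * ((k1 p)\<^sup>2 + (k2 p)\<^sup>2)"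
  have D0: "D \<noteq> 0" using not_regular[OF p] r by (auto simp: D_def)
  have mD: "(m p)\<^sup>2 - 4 * (cmod (Q p))\<^sup>2 = (m p)\<^sup>2 * D"
    unfolding Q q_k[OF p] D_def by (simp add: cmod_power2 power_mult_distrib algebra_simps)
  note w = wz_of_real(1,2)[OF S h p]
  define a b where "a = m p * (P p / 2 + k1 p * P p - k2 p * R p)"
    and "b = m p * (R p / 2 - k1 p * R p - k2 p * P p)"
  have ab: "2 * cnj (Q p) * wz (\<lambda>q. complex_of_real (h q)) p + complex_of_real (m p) * wzb (\<lambda>q. complex_of_real (h q)) p
      = Complex a b"
    unfolding w Q q_k[OF p] a_def b_def by (simp add: complex_eq_iff algebra_simps)
  have "(a / 2) *\<^sub>R pdx G p + (b / 2) *\<^sub>R pdy G p =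
     (a / 2 * (1 - 2 * k1 p) + b / 2 * (2 * k2 p)) *\<^sub>R f1 p + (a / 2 * (2 * k2 p) + b / 2 * (1 + 2 * k1 p)) *\<^sub>R f2 p"
    unfolding G_pd_k[OF p] by (simp add: algebra_simps)
  also have "a / 2 * (1 - 2 * k1 p) + b / 2 * (2 * k2 p) = m p * D * P p / 4"
    by (simp add: a_def b_def D_def field_simps power2_eq_square)
  also have "a / 2 * (2 * k2 p) + b / 2 * (1 + 2 * k1 p) = m p * D * R p / 4"
    by (simp add: a_def b_def D_def field_simps power2_eq_square)
  finally have re: "re_Gz_mul G p (Complex a b) = (m p * D * P p / 4) *\<^sub>R f1 p + (m p * D * R p / 4) *\<^sub>R f2 p"
    by (simp add: re_Gz_mul_def)
  have Bs: "sqrt ((m p + 2 * (cmod (wz (\<lambda>q. complex_of_real (h q)) p))\<^sup>2) / m p) = B p"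
    unfolding w(1) height_B_def by (simp add: cmod_power2 power_divide)
  have co: "4 / ((m p)\<^sup>2 * D) * (m p * D * x / 4) = x / m p" for x
    using D0 m_nz[OF p] by (simp add: power2_eq_square)
  show ?thesis
    unfolding N_formula_def Let_def ab re Bs mD scaleR_add_right scaleR_scaleR co
    by (simp add: surface_N_def)
qed

end

text \<open>From any required surface, g1 and g2 are formed in the way \<open>N_pd\<close> would
  return f1 and f2 from N_x and N_y. Once they are identified with f1 and f2, differentiating <f1,
  N> and <f2, N> yields the height equations.\<close>

lemma required_unique:
  assumes sing: "interior {p\<in>S. \<not> regular_pt G p} = {}"
    and req: "required_props S G m z0 th0 psi"
  shows "smooth_on S (\<lambda>p. snd (psi p))" "real_pde (\<lambda>p. snd (psi p))"
    "p \<in> S \<Longrightarrow> psi p = surface (\<lambda>p. snd (psi p)) p"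
proof -
  define N h where "N p = fst (psi p)" and "h p = snd (psi p)" for p
  define u where "u p = angle_fun psi p" for p
  have ci: "smooth_on S psi" "\<And>p. p \<in> S \<Longrightarrow> N p \<in> H2" "\<And>p. p \<in> S \<Longrightarrow> lam psi p > 0"
    "\<And>p. p \<in> S \<Longrightarrow> lor4 (pdy psi p) (pdy psi p) = lam psi p" "\<And>p. p \<in> S \<Longrightarrow> lor4 (pdx psi p) (pdy psi p) = 0"
    and rv: "\<And>p eta. p \<in> S \<Longrightarrow> unit_normal psi p eta \<Longrightarrow> snd eta \<noteq> 0"
    and mc: "\<And>p. p \<in> S \<Longrightarrow> mean_curv psi (canon_normal psi) p = 1/2"
    and hg: "\<And>p. p \<in> S \<Longrightarrow> (G p, 1) = (1 / angle_fun psi p) *\<^sub>R (canon_normal psi p + (fst (psi p), 0))"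
    and tau: "\<And>p. p \<in> S \<Longrightarrow> m p = lam psi p * (u p)\<^sup>2 / 2"
    using req unfolding required_props_def conformal_immersion_def regular_vertical_projection_def hyp_gauss_map_def N_def u_def
    by auto
  have sN: "smooth_on S N" and sh: "smooth_on S h"
    unfolding N_def[abs_def] h_def[abs_def]
    using smooth_on_linear[OF S bounded_linear_fst ci(1)] smooth_on_linear[OF S bounded_linear_snd ci(1)] by auto
  have psi: "psi = (\<lambda>p. (N p, h p))" by (simp add: N_def h_def)
  have pdp: "pdx psi p = (pdx N p, pdx h p)" "pdy psi p = (pdy N p, pdy h p)" if p: "p \<in> S" for p
    unfolding psi by (rule pd_Pair[OF at[OF sN p] at[OF sh p]])+
  have eta: "unit_normal psi p (canon_normal psi p)" "u p > 0" "canon_normal psi p = (u p *\<^sub>R G p - N p, u p)" if p: "p \<in> S" for p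
  proof -
    have H: "fst (psi p) \<in> H2" using ci(2)[OF p] by (simp add: N_def)
    show "unit_normal psi p (canon_normal psi p)" "u p > 0"
      using canon_normal[where psi=psi and p=p, OF H rv[OF p]] by (simp_all add: u_def angle_fun_def)
    then have "u p *\<^sub>R (G p, 1) = canon_normal psi p + (fst (psi p), 0)"
      unfolding hg[OF p] u_def by simp
    then have "canon_normal psi p = u p *\<^sub>R (G p, 1) - (fst (psi p), 0)" by simp
    then show "canon_normal psi p = (u p *\<^sub>R G p - N p, u p)" by (simp add: N_def)
  qed
  have NN: "lor3 (N p) (N p) = -1" if p: "p \<in> S" for p using ci(2)[OF p] by (rule H2_lor3)
  define B where "B p = - lor3 (G p) (N p)" for p
  have c: "lor3 a b = lor3 b a" for a b by (rule lor3_commute)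
  have NN_pd: "lor3 (pdx N p) (N p) = 0" "lor3 (pdy N p) (N p) = 0" if p: "p \<in> S" for p
    using lor3_pd_eq[OF S p sN sN NN] c[of "N p" "pdx N p"] c[of "N p" "pdy N p"] by (simp_all add: pd_const)
  \<comment> \<open>The normal (u G - N, u) has length 1, which fixes <G, N> = - 1 / u.\<close>
  have Bu: "B p = 1 / u p" if p: "p \<in> S" for p
  proof -
    have "lor4 (canon_normal psi p) (canon_normal psi p) = 1" using eta(1)[OF p] by (simp add: unit_normal_def)
    then have "2 * u p * (1 - u p * B p) = 0"
      unfolding eta(3)[OF p] lor4_altdef B_def
      by (simp add: lor3_simps orth(1)[OF p] NN[OF p] c[of "N p" "G p"] algebra_simps)
        (use eta(2)[OF p] in algebra)
    then show ?thesis using eta(2)[OF p] by (simp add: field_simps)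
  qed
  have Bpos: "B p > 0" if p: "p \<in> S" for p unfolding Bu[OF p] using eta(2)[OF p] by simp
  have NG: "lor3 (N p) (G p) = - B p" for p by (simp add: B_def c[of "N p"])
  have NxG: "lor3 (pdx N p) (G p) = - pdx h p" "lor3 (pdy N p) (G p) = - pdy h p" if p: "p \<in> S" for p
  proof -
    have "lor4 (canon_normal psi p) (pdx psi p) = 0" "lor4 (canon_normal psi p) (pdy psi p) = 0"
      using eta(1)[OF p] by (auto simp: unit_normal_def)
    then have "u p * (lor3 (pdx N p) (G p) + pdx h p) = 0" "u p * (lor3 (pdy N p) (G p) + pdy h p) = 0"
      unfolding eta(3)[OF p] lor4_altdef pdp[OF p]
      using NN_pd[OF p] c[of "N p" "pdx N p"] c[of "N p" "pdy N p"] c[of "G p" "pdx N p"] c[of "G p" "pdy N p"]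
      by (simp_all add: lor3_simps algebra_simps)
    then show "lor3 (pdx N p) (G p) = - pdx h p" "lor3 (pdy N p) (G p) = - pdy h p" using eta(2)[OF p] by auto
  qed
  have lm: "lam psi p = 2 * m p * (B p)\<^sup>2" if p: "p \<in> S" for p
    unfolding tau[OF p] Bu[OF p] using eta(2)[OF p] by (simp add: power_divide)
  have nx: "lor3 (pdx N p) (pdx N p) = 2 * m p * (B p)\<^sup>2 - (pdx h p)\<^sup>2"
    "lor3 (pdy N p) (pdy N p) = 2 * m p * (B p)\<^sup>2 - (pdy h p)\<^sup>2"
    "lor3 (pdx N p) (pdy N p) = - pdx h p * pdy h p" if p: "p \<in> S" for p
    using lm[OF p] ci(4,5)[OF p] unfolding lam_def pdp[OF p] lor4_altdef by (simp_all add: power2_eq_square)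
  define g1 g2 where "g1 p = (1 / (2 * B p)) *\<^sub>R (pdx N p + (- pdx h p) *\<^sub>R G p)"
    and "g2 p = (1 / (2 * B p)) *\<^sub>R (pdy N p + (- pdy h p) *\<^sub>R G p)" for p
  have Nx: "pdx N p = pdx h p *\<^sub>R G p + (2 * B p) *\<^sub>R g1 p" "pdy N p = pdy h p *\<^sub>R G p + (2 * B p) *\<^sub>R g2 p" if p: "p \<in> S" for p
    using Bpos[OF p] by (simp_all add: g1_def g2_def)
  have g: "lor3 (G p) (g1 p) = 0" "lor3 (G p) (g2 p) = 0" "lor3 (g1 p) (g1 p) = m p / 2" "lor3 (g2 p) (g2 p) = m p / 2"
    "lor3 (g1 p) (g2 p) = 0" if p: "p \<in> S" for p
  proof -
    note cc = c[of "G p" "pdx N p"] c[of "G p" "pdy N p"]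
    show "lor3 (G p) (g1 p) = 0" "lor3 (G p) (g2 p) = 0"
      unfolding g1_def g2_def using NxG[OF p] cc orth(1)[OF p] by (simp_all add: lor3_simps)
    show "lor3 (g1 p) (g1 p) = m p / 2" "lor3 (g2 p) (g2 p) = m p / 2" "lor3 (g1 p) (g2 p) = 0"
      unfolding g1_def g2_def using NxG[OF p] cc orth(1)[OF p] nx[OF p] Bpos[OF p]
      by (simp_all add: lor3_simps field_simps power2_eq_square)
  qed
  \<comment> \<open>Mean curvature 1/2 gives the trace; equality of mixed derivatives of N and of h
    gives the symmetry.\<close>
  have trace: "lor3 (g1 p) (pdx G p) + lor3 (g2 p) (pdy G p) = m p"
    and sym: "lor3 (g1 p) (pdy G p) = lor3 (g2 p) (pdx G p)" if p: "p \<in> S" for p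
  proof -
    note s = smooth_on_pd[OF sN] smooth_on_pd[OF sh]
    have neg: "pdx (\<lambda>q. - f q) p = - pdx f p" "pdy (\<lambda>q. - f q) p = - pdy f p" if "smooth_on S f" for f :: "complex \<Rightarrow> real"
      using pd_linear[OF bounded_linear_minus[OF bounded_linear_ident] at[OF that p]] by auto
    note e = lor3_pd_eq[OF S p s(1) smooth(1) NxG(1), unfolded neg[OF s(3)]]
      lor3_pd_eq[OF S p s(2) smooth(1) NxG(2), unfolded neg[OF s(4)]]
    note e2 = lor3_pd_eq(1)[OF S p s(1) sN NN_pd(1), unfolded pd_const]
      lor3_pd_eq(2)[OF S p s(2) sN NN_pd(2), unfolded pd_const]
    have o: "lor3 (G p) (pdx G p) = 0" "lor3 (G p) (pdy G p) = 0" using G_pd_orth[OF p] c by metis+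
    have B0: "B p \<noteq> 0" using Bpos[OF p] by simp
    have "lor3 (pdx N p) (pdy G p) = lor3 (pdy N p) (pdx G p)"
      using e(2,3) pd_commute[OF S sN p] pd_commute[OF S sh p] by simp
    then show "lor3 (g1 p) (pdy G p) = lor3 (g2 p) (pdx G p)"
      unfolding Nx[OF p] using B0 by (simp add: lor3_simps o)
    have x: "pdx (pdx psi) p = (pdx (pdx N) p, pdx (pdx h) p)"
      using pd_cong(1)[OF S p pdp(1)] pd_Pair(1)[OF at[OF s(1) p] at[OF s(3) p]] by simp
    have y: "pdy (pdy psi) p = (pdy (pdy N) p, pdy (pdy h) p)"
      using pd_cong(2)[OF S p pdp(2)] pd_Pair(2)[OF at[OF s(2) p] at[OF s(4) p]] by simp
    have "lor4 (pdx (pdx psi) p + pdy (pdy psi) p) (canon_normal psi p) = lam psi p"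
      using mc[OF p] ci(3)[OF p] unfolding mean_curv_def by (simp add: field_simps)
    then have "u p * (lor3 (pdx (pdx N) p) (G p) + lor3 (pdy (pdy N) p) (G p) + pdx (pdx h) p + pdy (pdy h) p)
       - (lor3 (pdx (pdx N) p) (N p) + lor3 (pdy (pdy N) p) (N p)) = 2 * m p * (B p)\<^sup>2"
      unfolding x y eta(3)[OF p] lor4_altdef lm[OF p] by (simp add: lor3_simps algebra_simps)
    moreover have "lor3 (pdx (pdx N) p) (G p) + lor3 (pdy (pdy N) p) (G p) + pdx (pdx h) p + pdy (pdy h) p =
       - (lor3 (pdx N p) (pdx G p) + lor3 (pdy N p) (pdy G p))" using e(1,4) by simp
    moreover have "lor3 (pdx (pdx N) p) (N p) + lor3 (pdy (pdy N) p) (N p) = - (4 * m p * (B p)\<^sup>2 - ((pdx h p)\<^sup>2 + (pdy h p)\<^sup>2))"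
      using e2 nx[OF p] by simp
    moreover have "lor3 (pdx N p) (pdx G p) + lor3 (pdy N p) (pdy G p) = 2 * B p * (lor3 (g1 p) (pdx G p) + lor3 (g2 p) (pdy G p))"
      unfolding Nx[OF p] by (simp add: lor3_simps o algebra_simps)
    moreover have "u p * (2 * B p * x) = 2 * x" for x unfolding Bu[OF p] using eta(2)[OF p] by simp
    moreover have "(pdx h p)\<^sup>2 + (pdy h p)\<^sup>2 = 2 * m p * ((B p)\<^sup>2 - 1)"
    proof -
      have n: "lor3 (N p) (g1 p) = pdx h p / 2" "lor3 (N p) (g2 p) = pdy h p / 2"
        using NN_pd[OF p] B0 unfolding g1_def g2_def
        by (simp_all add: lor3_simps c[of "N p" "pdx N p"] c[of "N p" "pdy N p"] NG field_simps)
      have "m p / 2 > 0" using m_pos[OF p] by simp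
      from lor3_frame_expand[OF orth(1)[OF p] g(3,4,1,2,5)[OF p] this, of "N p"]
      have "lor3 (N p) (N p) = lor3 (N p) (B p *\<^sub>R G p + (pdx h p / m p) *\<^sub>R g1 p + (pdy h p / m p) *\<^sub>R g2 p)"
        unfolding n NG by simp
      then show ?thesis
        using m_nz[OF p] unfolding NN[OF p] lor3_simps n NG by (simp add: field_simps power2_eq_square)
    qed
    ultimately have "- 2 * (lor3 (g1 p) (pdx G p) + lor3 (g2 p) (pdy G p)) + (4 * m p * (B p)\<^sup>2 - 2 * m p * ((B p)\<^sup>2 - 1)) = 2 * m p * (B p)\<^sup>2"
      by simp
    then show "lor3 (g1 p) (pdx G p) + lor3 (g2 p) (pdy G p) = m p" by (simp add: algebra_simps)
  qed
  \<comment> \<open>By the trace, <G_x, G_y> and |G_x|^2 - |G_y|^2 are linear in the entries a, b, d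
    of the symmetric coefficient matrix. Both are also determined by Q, so the matrix is that of the
    frame f1, f2.\<close>
  have gG: "pdx G p = (1 - 2 * k1 p) *\<^sub>R g1 p + (2 * k2 p) *\<^sub>R g2 p" "pdy G p = (2 * k2 p) *\<^sub>R g1 p + (1 + 2 * k1 p) *\<^sub>R g2 p"
    if p: "p \<in> S" for p
  proof -
    define a b d where "a = lor3 (g1 p) (pdx G p)" and "b = lor3 (g1 p) (pdy G p)" and "d = lor3 (g2 p) (pdy G p)"
    have mp: "m p / 2 > 0" using m_pos[OF p] by simp
    have ab: "lor3 (pdx G p) (g1 p) = a" "lor3 (pdx G p) (g2 p) = b" "lor3 (pdy G p) (g1 p) = b" "lor3 (pdy G p) (g2 p) = d"
      using sym[OF p] by (simp_all add: a_def b_def d_def c[of "pdx G p"] c[of "pdy G p"])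
    have tr: "a + d = m p" using trace[OF p] by (simp add: a_def d_def)
    have ex: "pdx G p = (2 * a / m p) *\<^sub>R g1 p + (2 * b / m p) *\<^sub>R g2 p" "pdy G p = (2 * b / m p) *\<^sub>R g1 p + (2 * d / m p) *\<^sub>R g2 p"
      using lor3_frame_expand[OF orth(1)[OF p] g(3,4,1,2,5)[OF p] mp, of "pdx G p"]
        lor3_frame_expand[OF orth(1)[OF p] g(3,4,1,2,5)[OF p] mp, of "pdy G p"] G_pd_orth[OF p]
      unfolding ab by (simp_all add: mult.commute)
    have "lor3 (pdx G p) (pdy G p) = 2 * a / m p * b + 2 * b / m p * d"
      by (subst ex(1)) (simp add: lor3_simps c[of _ "pdy G p"] ab)
    also have "\<dots> = 2 * b * (a + d) / m p" by (simp add: algebra_simps add_divide_distrib)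
    also have "\<dots> = 2 * b" unfolding tr using m_nz[OF p] by simp
    finally have xy: "lor3 (pdx G p) (pdy G p) = 2 * b" .
    have "lor3 (pdx G p) (pdx G p) = 2 * a / m p * a + 2 * b / m p * b"
      by (subst ex(1)) (simp add: lor3_simps c[of _ "pdx G p"] ab)
    moreover have "lor3 (pdy G p) (pdy G p) = 2 * b / m p * b + 2 * d / m p * d"
      by (subst ex(2)) (simp add: lor3_simps c[of _ "pdy G p"] ab)
    ultimately have "lor3 (pdx G p) (pdx G p) - lor3 (pdy G p) (pdy G p)
      = (2 * a / m p * a + 2 * b / m p * b) - (2 * b / m p * b + 2 * d / m p * d)" by simp
    also have "\<dots> = 2 * (a - d) * (a + d) / m p"
      by (simp add: algebra_simps add_divide_distrib diff_divide_distrib)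
    also have "\<dots> = 2 * (a - d)" unfolding tr using m_nz[OF p] by simp
    finally have xx: "lor3 (pdx G p) (pdx G p) - lor3 (pdy G p) (pdy G p) = 2 * (a - d)" .
    have xy': "lor3 (pdx G p) (pdy G p) = 2 * q2 p"
      unfolding G_pd_k[OF p] q_k[OF p] by (simp add: lor3_simps orth[OF p] orth'[OF p] field_simps)
    have xx': "lor3 (pdx G p) (pdx G p) - lor3 (pdy G p) (pdy G p) = - 4 * q1 p"
      unfolding G_pd_k[OF p] q_k[OF p] by (simp add: lor3_simps orth[OF p] orth'[OF p] field_simps)
    have v: "b = q2 p" "a = m p / 2 - q1 p" "d = m p / 2 + q1 p" using xx xx' xy xy' tr by simp_all
    show "pdx G p = (1 - 2 * k1 p) *\<^sub>R g1 p + (2 * k2 p) *\<^sub>R g2 p" "pdy G p = (2 * k2 p) *\<^sub>R g1 p + (1 + 2 * k1 p) *\<^sub>R g2 p"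
      by (subst ex, use m_nz[OF p] in \<open>simp add: v k1_def k2_def diff_divide_distrib add_divide_distrib\<close>)+
  qed
  have fg: "f1 p = g1 p \<and> f2 p = g2 p" if p: "p \<in> S" and r: "regular_pt G p" for p
  proof -
    define D where "D = 1 - 4 * ((k1 p)\<^sup>2 + (k2 p)\<^sup>2)"
    have D0: "D \<noteq> 0" using not_regular[OF p] r by (auto simp: D_def)
    \<comment> \<open>Cramer's rule for the system of \<open>gG\<close>, with determinant D.\<close>
    have sv: "D *\<^sub>R a = (1 + 2 * k1 p) *\<^sub>R ((1 - 2 * k1 p) *\<^sub>R a + (2 * k2 p) *\<^sub>R b) - (2 * k2 p) *\<^sub>R ((2 * k2 p) *\<^sub>R a + (1 + 2 * k1 p) *\<^sub>R b)"
      "D *\<^sub>R b = (1 - 2 * k1 p) *\<^sub>R ((2 * k2 p) *\<^sub>R a + (1 + 2 * k1 p) *\<^sub>R b) - (2 * k2 p) *\<^sub>R ((1 - 2 * k1 p) *\<^sub>R a + (2 * k2 p) *\<^sub>R b)"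
      for a b :: L3
      by (simp_all add: D_def power2_eq_square algebra_simps)
    have "D *\<^sub>R f1 p = D *\<^sub>R g1 p" "D *\<^sub>R f2 p = D *\<^sub>R g2 p"
      using sv(1)[of "f1 p" "f2 p"] sv(2)[of "f2 p" "f1 p"] sv(1)[of "g1 p" "g2 p"] sv(2)[of "g2 p" "g1 p"] unfolding G_pd_k[OF p, symmetric] gG[OF p, symmetric] by simp_all
    then show ?thesis using D0 by simp
  qed
  have Bs: "smooth_on S B" unfolding B_def[abs_def]
    using smooth_on_linear[OF S bounded_linear_minus[OF bounded_linear_ident] smooth_on_lor3[OF S smooth(1) sN]] by simp
  have gc: "continuous_on S g1" "continuous_on S g2"
    unfolding g1_def[abs_def] g2_def[abs_def]
    by (intro continuous_intros smooth_on_continuous_on Bs smooth smooth_on_pd sN sh; use Bpos in force)+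
  have feq: "f p = g p" if "continuous_on S f" "continuous_on S g" "\<And>p. p \<in> S \<Longrightarrow> regular_pt G p \<Longrightarrow> f p = g p" "p \<in> S"
    for f g :: "complex \<Rightarrow> L3" and p
  proof (rule ccontr)
    assume "f p \<noteq> g p"
    have "open (S \<inter> (\<lambda>p. f p - g p) -` (- {0}))"
      using S that(1,2) by (intro continuous_open_preimage continuous_intros) auto
    moreover have "S \<inter> (\<lambda>p. f p - g p) -` (- {0}) \<subseteq> {p\<in>S. \<not> regular_pt G p}" using that(3) by auto
    ultimately have "S \<inter> (\<lambda>p. f p - g p) -` (- {0}) \<subseteq> interior {p\<in>S. \<not> regular_pt G p}" by (rule interior_maximal[rotated])
    then show False using sing \<open>f p \<noteq> g p\<close> that(4) by auto
  qed
  have f12: "f1 p = g1 p" "f2 p = g2 p" if "p \<in> S" for p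
    using feq[OF smooth_on_continuous_on[OF smooth(2)] gc(1) _ that] feq[OF smooth_on_continuous_on[OF smooth(3)] gc(2) _ that] fg
    by blast+
  have Nxf: "pdx N p = pdx h p *\<^sub>R G p + (2 * B p) *\<^sub>R f1 p" "pdy N p = pdy h p *\<^sub>R G p + (2 * B p) *\<^sub>R f2 p"
    if p: "p \<in> S" for p
    unfolding f12[OF p] by (rule Nx[OF p])+
  have Nf: "lor3 (f1 p) (N p) = pdx h p / 2" "lor3 (f2 p) (N p) = pdy h p / 2" if p: "p \<in> S" for p
    using NN_pd[OF p] Bpos[OF p] unfolding Nxf[OF p]
    by (simp_all add: lor3_simps c[of "G p" "N p"] NG)
  have Nexp: "N p = B p *\<^sub>R G p + (pdx h p / m p) *\<^sub>R f1 p + (pdy h p / m p) *\<^sub>R f2 p" if p: "p \<in> S" for p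
    using expand[OF p, of "N p"] unfolding NG c[of "N p" "f1 p"] c[of "N p" "f2 p"] Nf[OF p] by simp
  have Beq: "B p = height_B h p" if p: "p \<in> S" for p
  proof -
    have "lor3 (N p) (N p) = lor3 (B p *\<^sub>R G p + (pdx h p / m p) *\<^sub>R f1 p + (pdy h p / m p) *\<^sub>R f2 p) (N p)"
      using Nexp[OF p] by simp
    then have "-1 = - (B p * B p) + (pdx h p)\<^sup>2 / (2 * m p) + (pdy h p)\<^sup>2 / (2 * m p)"
      unfolding NN[OF p] lor3_simps Nf[OF p] c[of "G p" "N p"] NG by (simp add: power2_eq_square)
    then show ?thesis using height_B_iff[OF p, of "B p" h] Bpos[OF p] m_nz[OF p]
      by (simp add: field_simps power2_eq_square)
  qed
  have "real_pde h"
    unfolding real_pde_def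
  proof
    fix p assume p: "p \<in> S"
    have half: "pdx (\<lambda>q. f q / 2) p = pdx f p / 2" "pdy (\<lambda>q. f q / 2) p = pdy f p / 2" if "smooth_on S f" for f :: "complex \<Rightarrow> real"
      using pd_linear[OF bounded_linear_divide[of 2] at[OF that p]] by auto
    note s = smooth_on_pd[OF sh]
    note e = lor3_pd_eq[OF S p smooth(2) sN Nf(1), unfolded half[OF s(1)]]
      lor3_pd_eq[OF S p smooth(3) sN Nf(2), unfolded half[OF s(2)]]
    note e' = e[unfolded f_pd_k[OF p] Nxf[OF p] lor3_simps Nf[OF p] c[of "G p" "N p"] NG orth[OF p] orth'[OF p]]
    show "pdx (pdx h) p = m p * height_B h p + 2 * q1 p * height_B h p + al p * pdx h p - be p * pdy h p \<and>
       pdx (pdy h) p = al p * pdy h p + be p * pdx h p - 2 * q2 p * height_B h p \<and>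
       pdy (pdy h) p = m p * height_B h p - 2 * q1 p * height_B h p - al p * pdx h p + be p * pdy h p"
      unfolding Beq[OF p, symmetric] using e' by (simp add: field_simps)
  qed
  then show "real_pde (\<lambda>p. snd (psi p))" by (simp add: h_def[abs_def])
  show "smooth_on S (\<lambda>p. snd (psi p))" using sh by (simp add: h_def[abs_def])
  show "psi p = surface (\<lambda>p. snd (psi p)) p" if p: "p \<in> S"
    unfolding surface_def surface_N_def h_def[symmetric] Beq[OF p, symmetric] Nexp[OF p, symmetric]
    by (simp add: N_def h_def)
qed

end

theorem mainTheorem6:
  fixes S :: "complex set" and G :: "complex \<Rightarrow> L3" and Q :: "complex \<Rightarrow> complex"
    and tau :: "complex \<Rightarrow> real" and z0 th0 :: complex
  assumes "open S" and "simply_connected S"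
    and "harmonic_H2 S G"
    and "weierstrass_data S G (\<lambda>p. - Q p) (\<lambda>p. 2 * tau p)"
    and "interior {p\<in>S. \<not> regular_pt G p} = {}"
    and "z0 \<in> S" and "regular_pt G z0"
  shows "\<exists>psi. required_props S G tau z0 th0 psi
     \<and> (\<forall>psi'. required_props S G tau z0 th0 psi' \<longrightarrow>
           (\<exists>c::real. \<forall>p\<in>S. psi' p = psi p + (0, c)))
     \<and> smooth_on S (\<lambda>p. snd (psi p))
     \<and> h_pde S Q tau (\<lambda>p. snd (psi p))
     \<and> (\<forall>h'. smooth_on S h' \<and> h_pde S Q tau h' \<and> wz (\<lambda>q. complex_of_real (h' q)) z0 = th0 \<longrightarrow>
           (\<exists>c::real. \<forall>p\<in>S. h' p = snd (psi p) + c))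
     \<and> (\<forall>p\<in>S. regular_pt G p \<longrightarrow> fst (psi p) = N_formula G Q tau (\<lambda>q. snd (psi q)) p)"
proof -
  have conn: "connected S" using assms(2) simply_connected_imp_connected by blast
  interpret weierstrass_map S G Q tau by unfold_locales (use assms in auto)
  obtain \<sigma> :: real where \<sigma>: "\<sigma> = 1 \<or> \<sigma> = -1" "\<And>p. p \<in> S \<Longrightarrow> frame_norm \<sigma> G p = tau p"
    using frame_norm_eq_tau[OF conn] by blast
  interpret F: gauss_frame S G "frame1 \<sigma> G" "frame2 \<sigma> G" "hopf_re G" "hopf_im G" tau
    by (rule gauss_frame_tau[OF \<sigma>(1) S order_refl \<sigma>(2)])
  interpret F: gauss_system S G "frame1 \<sigma> G" "frame2 \<sigma> G" "hopf_re G" "hopf_im G" tau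
    by unfold_locales (fact hopf_cauchy_riemann)+
  have GH: "G p \<in> H2" if "p \<in> S" for p using assms(3) that by (auto simp: harmonic_H2_def)
  \<comment> \<open>Since h_z = (h_x - i h_y) / 2, the value \<open>th0\<close> of h_z at
    \<open>z0\<close> prescribes both first derivatives.\<close>
  obtain h where h: "smooth_on S h" "F.real_pde h" and init: "pdx h z0 = 2 * Re th0" "pdy h z0 = - 2 * Im th0"
    using F.height_exists[OF assms(2,6)] by metis
  have wz0: "wz (\<lambda>q. complex_of_real (h q)) z0 = th0"
    unfolding wz_of_real(1)[OF S h(1) assms(6)] init by (simp add: complex_eq_iff)
  have init': "pdx h z0 = pdx h' z0" "pdy h z0 = pdy h' z0"
    if "smooth_on S h'" "wz (\<lambda>q. complex_of_real (h' q)) z0 = th0" for h'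
    using that(2) unfolding wz_of_real(1)[OF S that(1) assms(6)] init by auto
  have sn: "(\<lambda>p. snd (F.surface h p)) = h" by (simp add: F.surface_def)
  show ?thesis
  proof (intro exI[of _ "F.surface h"] conjI allI impI ballI)
    show "required_props S G tau z0 th0 (F.surface h)" by (rule F.surface_required[OF h GH wz0])
    show "smooth_on S (\<lambda>p. snd (F.surface h p))" "h_pde S Q tau (\<lambda>p. snd (F.surface h p))"
      unfolding sn using h F.h_pde_iff[OF h(1) Q_eq] by auto
    show "\<exists>c. \<forall>p\<in>S. psi' p = F.surface h p + (0, c)" if "required_props S G tau z0 th0 psi'" for psi'
    proof -
      note u = F.required_unique[OF assms(5) that]
      have w: "wz (\<lambda>q. complex_of_real (snd (psi' q))) z0 = th0" using that by (simp add: required_props_def)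
      obtain c where "\<And>p. p \<in> S \<Longrightarrow> snd (psi' p) = h p + c"
        "\<And>p. p \<in> S \<Longrightarrow> pdx (\<lambda>q. snd (psi' q)) p = pdx h p" "\<And>p. p \<in> S \<Longrightarrow> pdy (\<lambda>q. snd (psi' q)) p = pdy h p"
        "\<And>p. p \<in> S \<Longrightarrow> F.height_B (\<lambda>q. snd (psi' q)) p = F.height_B h p"
        using F.height_unique[OF conn assms(6) h u(1,2) init'[OF u(1) w]] by metis
      then have "psi' p = F.surface h p + (0, c)" if "p \<in> S" for p
        using u(3)[OF that] that by (simp add: F.surface_def F.surface_N_def)
      then show ?thesis by blast
    qed
    show "\<exists>c. \<forall>p\<in>S. h' p = snd (F.surface h p) + c"
      if "smooth_on S h' \<and> h_pde S Q tau h' \<and> wz (\<lambda>q. complex_of_real (h' q)) z0 = th0" for h'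
    proof -
      have s: "smooth_on S h'" and w: "wz (\<lambda>q. complex_of_real (h' q)) z0 = th0" using that by auto
      have r: "F.real_pde h'" using that F.h_pde_iff[OF s Q_eq] by simp
      obtain c where "\<And>p. p \<in> S \<Longrightarrow> h' p = h p + c"
        using F.height_unique[OF conn assms(6) h s r init'[OF s w]] by metis
      then show ?thesis by (auto simp: F.surface_def)
    qed
    show "fst (F.surface h p) = N_formula G Q tau (\<lambda>q. snd (F.surface h q)) p" if "p \<in> S" "regular_pt G p" for p
      unfolding sn using F.surface_N_formula[where Q=Q and p=p, OF h that(1) Q_eq[OF that(1)] that(2)] by (simp add: F.surface_def)
  qed
qed

end
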